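(* Let $M>0$, $|a|\le M$. For any smooth solution $(\alpha,\underline\alpha,\rho,\sigma)$ of the Maxwell equations (stated in the context) on the Kerr exterior relative to the algebraically special frame, the identities $$\frac1\Sigma\Big(D_3+\tfrac12\mathrm{tr}\underline\chi+\tfrac32(\varepsilon\cdot\underline\chi){}^\star\Big)\Big[\Sigma\Big(D_3+\tfrac12\mathrm{tr}\underline\chi+\tfrac12(\varepsilon\cdot\underline\chi){}^\star\Big)\alpha\Big]=-(D+2\eta)\,\mathrm{div}\,\underline\alpha-{}^\star(D+2\eta)\,\mathrm{curl}\,\underline\alpha,$$ $$\Big(D_4+\tfrac12\mathrm{tr}\chi+\tfrac32(\varepsilon\cdot\chi){}^\star\Big)\Big[\Sigma\Big(D_4+\hat\omega+\tfrac12\mathrm{tr}\chi+\tfrac12(\varepsilon\cdot\chi){}^\star\Big)\underline\alpha\Big]=-(D+2\underline\eta)\,\mathrm{div}(\Sigma\alpha)-{}^\star(D+2\underline\eta)\,\mathrm{curl}(\Sigma\alpha)$$ hold.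
   Context: Kerr exterior. For $M>0$, $|a|\le M$ let $r_\pm=M\pm\sqrt{M^2-a^2}$, $\Delta=(r-r_+)(r-r_-)$, $\Sigma=r^2+a^2\cos^2\theta$. $(\mathcal M,g)$ is $\mathbb R_{\bar t}\times[r_+,\infty)_r\times\mathbb S^2_{(\theta,\bar\phi)}$ with $g=-(1-\frac{2Mr}{\Sigma})d\bar t^2+2d\bar t\,dr+\Sigma d\theta^2+\frac{(r^2+a^2)^2-\Delta a^2\sin^2\theta}{\Sigma}\sin^2\theta\,d\bar\phi^2-2a\sin^2\theta\,dr\,d\bar\phi-\frac{4aMr}{\Sigma}\sin^2\theta\,d\bar t\,d\bar\phi$. Boyer–Lindquist coordinates $(t,r,\theta,\phi)$ on $r>r_+$ are given (with $r_0=9M/4$) by $\bar t=t+\int_{r_0}^r\frac{s^2+a^2}{\Delta(s)}ds$, $\bar\phi=\phi+\int_{r_0}^r\frac{a}{\Delta(s)}ds$. Algebraically special frame and horizontal calculus. $e_4=\frac{r^2+a^2}{\Sigma}\partial_t+\frac{\Delta}{\Sigma}\partial_r+\frac a\Sigma\partial_\phi$, $e_3=\frac{r^2+a^2}{\Delta}\partial_t-\partial_r+\frac a\Delta\partial_\phi$ (Boyer–Lindquist; both extend smoothly to $r=r_+$), $e_1=\frac{a^2\sin\theta\cos\theta}{\Sigma}\partial_t+\frac r\Sigma\partial_\theta+\frac{a\cos\theta}{\Sigma\sin\theta}\partial_\phi$, $e_2=\frac{ar\sin\theta}{\Sigma}\partial_t-\frac{a\cos\theta}{\Sigma}\partial_\theta+\frac{r}{\Sigma\sin\theta}\partial_\phi$.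 $\mathfrak D=\langle e_3,e_4\rangle^\perp$ is the horizontal distribution, with orthonormal frame $(e_1,e_2)$; $\gamma=g|_{\mathfrak D}$, $\varepsilon$ its area form with $\varepsilon(e_1,e_2)=1$. $\mathfrak D$ one-forms are sections of $\mathfrak D^*$ (identified with spacetime one-forms vanishing on $e_3,e_4$). $D$ is the connection on $\mathfrak D$ obtained by orthogonally projecting to $\mathfrak D$ the Levi-Civita connection $\nabla$ of $g$: $(D_X\varsigma)(Y)=X(\varsigma(Y))-\varsigma(\Pi_{\mathfrak D}\nabla_XY)$; $D_3=D_{e_3}$, $D_4=D_{e_4}$, $D$ without index is differentiation in $\mathfrak D$-directions (for functions $Du=du|_{\mathfrak D}$). $\mathrm{div}\,\varsigma=\gamma^{AB}(D_A\varsigma)_B$, $\mathrm{curl}\,\varsigma=\varepsilon^{AB}(D_A\varsigma)_B$, $({}^\star\varsigma)_A=\varepsilon_A{}^B\varsigma_B$, $(\varsigma,\tilde\varsigma)=\gamma^{AB}\varsigma_A\tilde\varsigma_B$, $\varsigma\wedge\tilde\varsigma=\varepsilon^{AB}\varsigma_A\tilde\varsigma_B$. For a function $u$ and $\mathfrak D$ one-form $\xi$: $(D+\xi)u=Du+u\,\xi$ and ${}^\star(D+\xi)u={}^\star(Du+u\,\xi)$. Connection coefficients: $\mathrm{tr}\chi=\frac{2r\Delta}{\Sigma^2}$, $(\varepsilon\cdot\chi)=\frac{2a\Delta\cos\theta}{\Sigma^2}$, $\mathrm{tr}\underline\chi=-\frac{2r}\Sigma$, $(\varepsilon\cdot\underline\chi)=\frac{2a\cos\theta}{\Sigma}$,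 $\hat\omega=-\frac{2(a^2(M-r)\cos^2\theta+a^2r-Mr^2)}{\Sigma^2}$; $\chi\cdot\varsigma=\frac12\mathrm{tr}\chi\,\varsigma+\frac12(\varepsilon\cdot\chi){}^\star\varsigma$, $\underline\chi\cdot\varsigma=\frac12\mathrm{tr}\underline\chi\,\varsigma+\frac12(\varepsilon\cdot\underline\chi){}^\star\varsigma$; in Boyer–Lindquist coordinates $\eta=-\frac{a^2r}{\Sigma^2}\sin^2\theta\,dt-\frac{a^2\sin2\theta}{2\Sigma}d\theta+\frac{ar(r^2+a^2)}{\Sigma^2}\sin^2\theta\,d\phi$, $\underline\eta=\frac{a^2r}{\Sigma^2}\sin^2\theta\,dt-\frac{a^2\sin2\theta}{2\Sigma}d\theta-\frac{ar(r^2+a^2)}{\Sigma^2}\sin^2\theta\,d\phi$. Maxwell equations. For a two-form $F$ with $dF=0$, $d\star F=0$, set $\alpha(e_A)=F(e_A,e_4)$, $\underline\alpha(e_A)=F(e_A,e_3)$ ($A=1,2$), $\rho=\frac12F(e_3,e_4)$, $\sigma=\frac12\varepsilon^{AB}F(e_A,e_B)$. In terms of these the Maxwell equations are $D_3\sigma+\mathrm{tr}\underline\chi\,\sigma=-\mathrm{curl}\,\underline\alpha-(\varepsilon\cdot\underline\chi)\rho$, $D_3\rho+\mathrm{tr}\underline\chi\,\rho=-\mathrm{div}\,\underline\alpha+(\varepsilon\cdot\underline\chi)\sigma$, $D_4\sigma+\mathrm{tr}\chi\,\sigma=-\mathrm{curl}\,\alpha-(\eta+\underline\eta)\wedge\alpha+(\varepsilon\cdot\chi)\rho$,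 $D_4\rho+\mathrm{tr}\chi\,\rho=\mathrm{div}\,\alpha+(\eta+\underline\eta,\alpha)-(\varepsilon\cdot\chi)\sigma$, $D_3\alpha+\underline\chi\cdot\alpha=D\rho+{}^\star D\sigma+2\eta\rho+2{}^\star\eta\,\sigma$, $D_4\underline\alpha+\chi\cdot\underline\alpha+\hat\omega\,\underline\alpha=-D\rho+{}^\star D\sigma-2\underline\eta\rho+2{}^\star\underline\eta\,\sigma$. *)

theory Defs
  imports "HOL-Analysis.Analysis"
begin

section \<open>The Kerr exterior in one global chart\<close>

text \<open>
  Since \<open>r\<^sub>+ > 0\<close>, the manifold \<open>\<real> \<times> [r\<^sub>+, \<infinity>) \<times> S\<^sup>2\<close> is identified with the
  closed region \<open>|x| \<ge> r\<^sub>+\<close> of \<open>\<real> \<times> \<real>\<^sup>3\<close> through \<open>(t, r, \<omega>) \<mapsto> (t, r \<omega>)\<close>, where \<open>t\<close> is the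
  ingoing time (\<open>t\<close> with a bar in the usual notation).  Thus \<open>p $ 1\<close> is the ingoing time,
  \<open>(p $ 2, p $ 3, p $ 4) = r (sin \<theta> cos \<phi>, sin \<theta> sin \<phi>, cos \<theta>)\<close> with \<open>\<phi>\<close> the ingoing azimuth,
  and neither the axis nor the horizon is singular.  Tangent vectors and one-forms are both given
  by their four components in this chart; the pairing of a one-form \<open>\<xi>\<close> with a vector \<open>v\<close> is
  \<open>\<xi> \<bullet> v\<close>, and \<open>axis i 1\<close> is the \<open>i\<close>-th coordinate vector field as well as the \<open>i\<close>-th
  coordinate differential.
\<close>

type_synonym point = "real^4"
type_synonym tvec = "real^4"
type_synonym covec = "real^4"

definition r_plus :: "real \<Rightarrow> real \<Rightarrow> real" where
  "r_plus M a = M + sqrt (M\<^sup>2 - a\<^sup>2)"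

definition r_minus :: "real \<Rightarrow> real \<Rightarrow> real" where
  "r_minus M a = M - sqrt (M\<^sup>2 - a\<^sup>2)"

definition radius :: "point \<Rightarrow> real" where
  "radius p = sqrt ((p $ 2)\<^sup>2 + (p $ 3)\<^sup>2 + (p $ 4)\<^sup>2)"

definition cos_theta :: "point \<Rightarrow> real" where
  "cos_theta p = p $ 4 / radius p"

definition sin_theta :: "point \<Rightarrow> real" where
  "sin_theta p = sqrt ((p $ 2)\<^sup>2 + (p $ 3)\<^sup>2) / radius p"

definition Delta_r :: "real \<Rightarrow> real \<Rightarrow> real \<Rightarrow> real" where
  "Delta_r M a r = (r - r_plus M a) * (r - r_minus M a)"

definition Delta :: "real \<Rightarrow> real \<Rightarrow> point \<Rightarrow> real" where
  "Delta M a p = Delta_r M a (radius p)"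

definition Sig :: "real \<Rightarrow> point \<Rightarrow> real" where
  "Sig a p = (radius p)\<^sup>2 + a\<^sup>2 * (cos_theta p)\<^sup>2"

definition kerr_exterior :: "real \<Rightarrow> real \<Rightarrow> point set" where
  "kerr_exterior M a = {p. r_plus M a \<le> radius p}"

definition d_t :: "covec" where
  "d_t = axis 1 1"

definition d_r :: "point \<Rightarrow> covec" where
  "d_r p = (1 / radius p) *\<^sub>R vector [0, p $ 2, p $ 3, p $ 4]"

text \<open>The smooth one-form \<open>d (cos \<theta>) = - sin \<theta> d\<theta>\<close>.\<close>

definition d_cos_theta :: "point \<Rightarrow> covec" where
  "d_cos_theta p = (1 / radius p) *\<^sub>R (axis 4 1 - cos_theta p *\<^sub>R d_r p)"

text \<open>The smooth one-form \<open>sin\<^sup>2 \<theta> d\<phi>\<close> (ingoing azimuth).\<close>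

definition sin2_d_phi :: "point \<Rightarrow> covec" where
  "sin2_d_phi p = (1 / (radius p)\<^sup>2) *\<^sub>R vector [0, - (p $ 3), p $ 2, 0]"

text \<open>The round metric \<open>d\<theta>\<^sup>2 + sin\<^sup>2 \<theta> d\<phi>\<^sup>2 = (|dx|\<^sup>2 - dr\<^sup>2) / r\<^sup>2\<close>.\<close>

definition round_metric :: "point \<Rightarrow> tvec \<Rightarrow> tvec \<Rightarrow> real" where
  "round_metric p u v =
     (u $ 2 * v $ 2 + u $ 3 * v $ 3 + u $ 4 * v $ 4 - (d_r p \<bullet> u) * (d_r p \<bullet> v)) / (radius p)\<^sup>2"

text \<open>
  The angular part of the Kerr metric is written with the identity
  \<open>((r\<^sup>2 + a\<^sup>2)\<^sup>2 - \<Delta> a\<^sup>2 sin\<^sup>2 \<theta>) / \<Sigma> = \<Sigma> + a\<^sup>2 (1 + 2 M r / \<Sigma>) sin\<^sup>2 \<theta>\<close>, which makes it manifestly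
  smooth across the axis.  The usual coordinate components are recovered in
  \<open>kerr_metric_components\<close> below.
\<close>

definition kerr_metric :: "real \<Rightarrow> real \<Rightarrow> point \<Rightarrow> tvec \<Rightarrow> tvec \<Rightarrow> real" where
  "kerr_metric M a p u v =
     (let r = radius p; S = Sig a p;
          ut = d_t \<bullet> u; vt = d_t \<bullet> v;
          ur = d_r p \<bullet> u; vr = d_r p \<bullet> v;
          uf = sin2_d_phi p \<bullet> u; vf = sin2_d_phi p \<bullet> v
      in - (1 - 2 * M * r / S) * ut * vt + (ut * vr + ur * vt)
         + S * round_metric p u v + a\<^sup>2 * (1 + 2 * M * r / S) * uf * vf
         - a * (ur * vf + uf * vr) - (2 * a * M * r / S) * (ut * vf + uf * vt))"

definition metric_matrix :: "real \<Rightarrow> real \<Rightarrow> point \<Rightarrow> real^4^4" where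
  "metric_matrix M a p = (\<chi> i j. kerr_metric M a p (axis i 1) (axis j 1))"

section \<open>Calculus on the exterior\<close>

text \<open>
  Derivatives are taken within the region, so that they are one-sided at the horizon; smoothness
  is smoothness up to and including the horizon.
\<close>

primrec Ck_on :: "nat \<Rightarrow> ('a::euclidean_space \<Rightarrow> 'b::real_normed_vector) \<Rightarrow> 'a set \<Rightarrow> bool" where
  "Ck_on 0 f S \<longleftrightarrow> continuous_on S f"
| "Ck_on (Suc k) f S \<longleftrightarrow>
     f differentiable_on S \<and> (\<forall>v. Ck_on k (\<lambda>x. frechet_derivative f (at x within S) v) S)"

definition smooth_on :: "('a::euclidean_space \<Rightarrow> 'b::real_normed_vector) \<Rightarrow> 'a set \<Rightarrow> bool" where
  "smooth_on f S \<longleftrightarrow> (\<forall>k. Ck_on k f S)"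

definition deriv_along ::
  "real \<Rightarrow> real \<Rightarrow> tvec \<Rightarrow> (point \<Rightarrow> 'b::real_normed_vector) \<Rightarrow> point \<Rightarrow> 'b" where
  "deriv_along M a X f p = frechet_derivative f (at p within kerr_exterior M a) X"

text \<open>\<open>christoffel M a p k i j\<close> is the Christoffel symbol with upper index \<open>k\<close>.\<close>

definition christoffel :: "real \<Rightarrow> real \<Rightarrow> point \<Rightarrow> 4 \<Rightarrow> 4 \<Rightarrow> 4 \<Rightarrow> real" where
  "christoffel M a p k i j =
     (1/2) * (\<Sum>l\<in>UNIV. matrix_inv (metric_matrix M a p) $ k $ l *
       (deriv_along M a (axis i 1) (\<lambda>q. metric_matrix M a q $ l $ j) p
        + deriv_along M a (axis j 1) (\<lambda>q. metric_matrix M a q $ l $ i) p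
        - deriv_along M a (axis l 1) (\<lambda>q. metric_matrix M a q $ i $ j) p))"

text \<open>The Levi-Civita connection; \<open>X\<close> is a vector at \<open>p\<close>, \<open>Y\<close> a vector field.\<close>

definition nabla :: "real \<Rightarrow> real \<Rightarrow> tvec \<Rightarrow> (point \<Rightarrow> tvec) \<Rightarrow> point \<Rightarrow> tvec" where
  "nabla M a X Y p =
     deriv_along M a X Y p
     + (\<chi> k. \<Sum>i\<in>UNIV. \<Sum>j\<in>UNIV. christoffel M a p k i j * X $ i * Y p $ j)"

section \<open>The algebraically special frame and the horizontal distribution\<close>

text \<open>
  The fields \<open>\<partial>\<^sub>r\<close>, \<open>\<partial>\<^sub>\<phi>\<close> here belong to the ingoing coordinates.  In Boyer-Lindquist coordinates the
  radial field is \<open>\<partial>\<^sub>r + ((r\<^sup>2 + a\<^sup>2) / \<Delta>) \<partial>\<^sub>t + (a / \<Delta>) \<partial>\<^sub>\<phi>\<close>, and \<open>e3\<close>, \<open>e4\<close> below are the smooth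
  extensions to the horizon of the Boyer-Lindquist expressions; see \<open>e3_boyer_lindquist\<close> and
  \<open>e4_boyer_lindquist\<close>.
\<close>

definition del_t :: tvec where
  "del_t = axis 1 1"

definition del_r :: "point \<Rightarrow> tvec" where
  "del_r p = (1 / radius p) *\<^sub>R vector [0, p $ 2, p $ 3, p $ 4]"

definition del_phi :: "point \<Rightarrow> tvec" where
  "del_phi p = vector [0, - (p $ 3), p $ 2, 0]"

definition e3 :: "point \<Rightarrow> tvec" where
  "e3 p = - del_r p"

definition e4 :: "real \<Rightarrow> real \<Rightarrow> point \<Rightarrow> tvec" where
  "e4 M a p =
     (2 * ((radius p)\<^sup>2 + a\<^sup>2) / Sig a p) *\<^sub>R del_t
     + (Delta M a p / Sig a p) *\<^sub>R del_r p
     + (2 * a / Sig a p) *\<^sub>R del_phi p"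

definition horizontal :: "real \<Rightarrow> real \<Rightarrow> point \<Rightarrow> tvec set" where
  "horizontal M a p =
     {v. kerr_metric M a p v (e3 p) = 0 \<and> kerr_metric M a p v (e4 M a p) = 0}"

definition hproj :: "real \<Rightarrow> real \<Rightarrow> point \<Rightarrow> tvec \<Rightarrow> tvec" where
  "hproj M a p v = (THE w. w \<in> horizontal M a p \<and> v - w \<in> span {e3 p, e4 M a p})"

text \<open>The vector \<open>\<xi>\<^sup>A = \<gamma>\<^sup>A\<^sup>B \<xi>\<^sub>B\<close>, where \<open>\<gamma>\<close> is the restriction of the metric to the distribution.\<close>

definition hsharp :: "real \<Rightarrow> real \<Rightarrow> point \<Rightarrow> covec \<Rightarrow> tvec" where
  "hsharp M a p \<xi> =
     (THE w. w \<in> horizontal M a p \<and> (\<forall>v\<in>horizontal M a p. kerr_metric M a p w v = \<xi> \<bullet> v))"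

text \<open>
  The area form \<open>\<epsilon>(u, v) = (1/2) vol (e3, e4, u, v)\<close>, extended by zero to \<open>e3\<close> and \<open>e4\<close>.  The factor
  accounts for \<open>g (e3, e4) = -2\<close>, and the orientation is the one with \<open>\<epsilon>(e1, e2) = 1\<close>; see
  \<open>harea_frame\<close>.
\<close>

definition harea :: "real \<Rightarrow> real \<Rightarrow> point \<Rightarrow> tvec \<Rightarrow> tvec \<Rightarrow> real" where
  "harea M a p u v =
     (1/2) * sqrt (- det (metric_matrix M a p)) *
       det (vector [e3 p, e4 M a p, u, v] :: real^4^4)"

definition gamma_inv :: "real \<Rightarrow> real \<Rightarrow> point \<Rightarrow> 4 \<Rightarrow> 4 \<Rightarrow> real" where
  "gamma_inv M a p i j = axis i 1 \<bullet> hsharp M a p (axis j 1)"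

definition eps_inv :: "real \<Rightarrow> real \<Rightarrow> point \<Rightarrow> 4 \<Rightarrow> 4 \<Rightarrow> real" where
  "eps_inv M a p i j = harea M a p (hsharp M a p (axis i 1)) (hsharp M a p (axis j 1))"

section \<open>Horizontal calculus\<close>

definition horizontal_form :: "real \<Rightarrow> real \<Rightarrow> (point \<Rightarrow> covec) \<Rightarrow> bool" where
  "horizontal_form M a \<zeta> \<longleftrightarrow>
     (\<forall>p\<in>kerr_exterior M a. \<zeta> p \<bullet> e3 p = 0 \<and> \<zeta> p \<bullet> e4 M a p = 0)"

definition hstar :: "real \<Rightarrow> real \<Rightarrow> point \<Rightarrow> covec \<Rightarrow> covec" where
  "hstar M a p \<xi> = (\<chi> i. harea M a p (axis i 1) (hsharp M a p \<xi>))"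

definition hinner :: "real \<Rightarrow> real \<Rightarrow> point \<Rightarrow> covec \<Rightarrow> covec \<Rightarrow> real" where
  "hinner M a p \<xi> \<xi>' = (\<Sum>i\<in>UNIV. \<Sum>j\<in>UNIV. gamma_inv M a p i j * \<xi> $ i * \<xi>' $ j)"

definition hwedge :: "real \<Rightarrow> real \<Rightarrow> point \<Rightarrow> covec \<Rightarrow> covec \<Rightarrow> real" where
  "hwedge M a p \<xi> \<xi>' = (\<Sum>i\<in>UNIV. \<Sum>j\<in>UNIV. eps_inv M a p i j * \<xi> $ i * \<xi>' $ j)"

text \<open>
  \<open>(D\<^sub>X \<zeta>)(Y) = X (\<zeta>(Y)) - \<zeta>(\<Pi> \<nabla>\<^sub>X Y)\<close> for horizontal fields \<open>Y\<close>.  The expression is tensorial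
  in \<open>Y\<close>, so the components of the one-form \<open>D\<^sub>X \<zeta>\<close> are obtained by taking for \<open>Y\<close> the horizontal
  projections of the coordinate fields; the result annihilates \<open>e3\<close> and \<open>e4\<close>.
\<close>

definition hderiv :: "real \<Rightarrow> real \<Rightarrow> tvec \<Rightarrow> (point \<Rightarrow> covec) \<Rightarrow> point \<Rightarrow> covec" where
  "hderiv M a X \<zeta> p =
     (\<chi> i. let Y = (\<lambda>q. hproj M a q (axis i 1))
           in deriv_along M a X (\<lambda>q. \<zeta> q \<bullet> Y q) p - \<zeta> p \<bullet> hproj M a p (nabla M a X Y p))"

definition D3 :: "real \<Rightarrow> real \<Rightarrow> (point \<Rightarrow> covec) \<Rightarrow> point \<Rightarrow> covec" where
  "D3 M a \<zeta> p = hderiv M a (e3 p) \<zeta> p"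

definition D4 :: "real \<Rightarrow> real \<Rightarrow> (point \<Rightarrow> covec) \<Rightarrow> point \<Rightarrow> covec" where
  "D4 M a \<zeta> p = hderiv M a (e4 M a p) \<zeta> p"

definition D3_fun :: "real \<Rightarrow> real \<Rightarrow> (point \<Rightarrow> real) \<Rightarrow> point \<Rightarrow> real" where
  "D3_fun M a u p = deriv_along M a (e3 p) u p"

definition D4_fun :: "real \<Rightarrow> real \<Rightarrow> (point \<Rightarrow> real) \<Rightarrow> point \<Rightarrow> real" where
  "D4_fun M a u p = deriv_along M a (e4 M a p) u p"

text \<open>\<open>Du\<close> is the restriction of \<open>du\<close> to the distribution, extended by zero to \<open>e3\<close> and \<open>e4\<close>.\<close>

definition hgrad :: "real \<Rightarrow> real \<Rightarrow> (point \<Rightarrow> real) \<Rightarrow> point \<Rightarrow> covec" where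
  "hgrad M a u p = (\<chi> i. deriv_along M a (hproj M a p (axis i 1)) u p)"

text \<open>
  In the contractions \<open>\<gamma>\<^sup>A\<^sup>B (D\<^sub>A \<zeta>)\<^sub>B\<close> and \<open>\<epsilon>\<^sup>A\<^sup>B (D\<^sub>A \<zeta>)\<^sub>B\<close> the indices may run over all coordinate
  directions, because \<open>gamma_inv\<close> and \<open>eps_inv\<close> are bivectors over the distribution.
\<close>

definition hdiv :: "real \<Rightarrow> real \<Rightarrow> (point \<Rightarrow> covec) \<Rightarrow> point \<Rightarrow> real" where
  "hdiv M a \<zeta> p =
     (\<Sum>i\<in>UNIV. \<Sum>j\<in>UNIV. gamma_inv M a p i j * hderiv M a (axis i 1) \<zeta> p $ j)"

definition hcurl :: "real \<Rightarrow> real \<Rightarrow> (point \<Rightarrow> covec) \<Rightarrow> point \<Rightarrow> real" where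
  "hcurl M a \<zeta> p =
     (\<Sum>i\<in>UNIV. \<Sum>j\<in>UNIV. eps_inv M a p i j * hderiv M a (axis i 1) \<zeta> p $ j)"

definition D_plus ::
  "real \<Rightarrow> real \<Rightarrow> (point \<Rightarrow> covec) \<Rightarrow> (point \<Rightarrow> real) \<Rightarrow> point \<Rightarrow> covec" where
  "D_plus M a \<xi> u p = hgrad M a u p + u p *\<^sub>R \<xi> p"

definition star_D_plus ::
  "real \<Rightarrow> real \<Rightarrow> (point \<Rightarrow> covec) \<Rightarrow> (point \<Rightarrow> real) \<Rightarrow> point \<Rightarrow> covec" where
  "star_D_plus M a \<xi> u p = hstar M a p (D_plus M a \<xi> u p)"

text \<open>The operators \<open>D\<^sub>3 + f + h \<star>\<close> and \<open>D\<^sub>4 + f + h \<star>\<close> on one-forms, for functions \<open>f\<close> and \<open>h\<close>.\<close>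

definition D3_plus ::
  "real \<Rightarrow> real \<Rightarrow> (point \<Rightarrow> real) \<Rightarrow> (point \<Rightarrow> real) \<Rightarrow> (point \<Rightarrow> covec) \<Rightarrow> point \<Rightarrow> covec" where
  "D3_plus M a f h \<zeta> p = D3 M a \<zeta> p + f p *\<^sub>R \<zeta> p + h p *\<^sub>R hstar M a p (\<zeta> p)"

definition D4_plus ::
  "real \<Rightarrow> real \<Rightarrow> (point \<Rightarrow> real) \<Rightarrow> (point \<Rightarrow> real) \<Rightarrow> (point \<Rightarrow> covec) \<Rightarrow> point \<Rightarrow> covec" where
  "D4_plus M a f h \<zeta> p = D4 M a \<zeta> p + f p *\<^sub>R \<zeta> p + h p *\<^sub>R hstar M a p (\<zeta> p)"

section \<open>Connection coefficients\<close>

definition tr_chi :: "real \<Rightarrow> real \<Rightarrow> point \<Rightarrow> real" where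
  "tr_chi M a p = 2 * radius p * Delta M a p / (Sig a p)\<^sup>2"

definition eps_chi :: "real \<Rightarrow> real \<Rightarrow> point \<Rightarrow> real" where
  "eps_chi M a p = 2 * a * Delta M a p * cos_theta p / (Sig a p)\<^sup>2"

definition tr_chib :: "real \<Rightarrow> point \<Rightarrow> real" where
  "tr_chib a p = - 2 * radius p / Sig a p"

definition eps_chib :: "real \<Rightarrow> point \<Rightarrow> real" where
  "eps_chib a p = 2 * a * cos_theta p / Sig a p"

definition omega_hat :: "real \<Rightarrow> real \<Rightarrow> point \<Rightarrow> real" where
  "omega_hat M a p =
     - 2 * (a\<^sup>2 * (M - radius p) * (cos_theta p)\<^sup>2 + a\<^sup>2 * radius p - M * (radius p)\<^sup>2)
       / (Sig a p)\<^sup>2"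

definition chi_dot :: "real \<Rightarrow> real \<Rightarrow> point \<Rightarrow> covec \<Rightarrow> covec" where
  "chi_dot M a p \<xi> = (tr_chi M a p / 2) *\<^sub>R \<xi> + (eps_chi M a p / 2) *\<^sub>R hstar M a p \<xi>"

definition chib_dot :: "real \<Rightarrow> real \<Rightarrow> point \<Rightarrow> covec \<Rightarrow> covec" where
  "chib_dot M a p \<xi> = (tr_chib a p / 2) *\<^sub>R \<xi> + (eps_chib a p / 2) *\<^sub>R hstar M a p \<xi>"

text \<open>
  Passing from Boyer-Lindquist to ingoing coordinates leaves the components of these two one-forms
  unchanged, since the \<open>dr\<close> contributions of \<open>dt\<close> and \<open>d\<phi>\<close> cancel; moreover
  \<open>- (a\<^sup>2 sin 2\<theta> / (2 \<Sigma>)) d\<theta> = (a\<^sup>2 cos \<theta> / \<Sigma>) d (cos \<theta>)\<close>.  See \<open>eta_boyer_lindquist\<close> and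
  \<open>etab_boyer_lindquist\<close>.
\<close>

definition eta :: "real \<Rightarrow> point \<Rightarrow> covec" where
  "eta a p =
     (- a\<^sup>2 * radius p / (Sig a p)\<^sup>2 * (sin_theta p)\<^sup>2) *\<^sub>R d_t
     + (a\<^sup>2 * cos_theta p / Sig a p) *\<^sub>R d_cos_theta p
     + (a * radius p * ((radius p)\<^sup>2 + a\<^sup>2) / (Sig a p)\<^sup>2) *\<^sub>R sin2_d_phi p"

definition etab :: "real \<Rightarrow> point \<Rightarrow> covec" where
  "etab a p =
     (a\<^sup>2 * radius p / (Sig a p)\<^sup>2 * (sin_theta p)\<^sup>2) *\<^sub>R d_t
     + (a\<^sup>2 * cos_theta p / Sig a p) *\<^sub>R d_cos_theta p
     - (a * radius p * ((radius p)\<^sup>2 + a\<^sup>2) / (Sig a p)\<^sup>2) *\<^sub>R sin2_d_phi p"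

section \<open>Maxwell equations\<close>

definition maxwell_equations ::
  "real \<Rightarrow> real \<Rightarrow> (point \<Rightarrow> covec) \<Rightarrow> (point \<Rightarrow> covec) \<Rightarrow> (point \<Rightarrow> real) \<Rightarrow> (point \<Rightarrow> real) \<Rightarrow> bool"
where
  "maxwell_equations M a \<alpha> \<alpha>b \<rho> \<sigma> \<longleftrightarrow> (\<forall>p\<in>kerr_exterior M a.
     D3_fun M a \<sigma> p + tr_chib a p * \<sigma> p = - hcurl M a \<alpha>b p - eps_chib a p * \<rho> p \<and>
     D3_fun M a \<rho> p + tr_chib a p * \<rho> p = - hdiv M a \<alpha>b p + eps_chib a p * \<sigma> p \<and>
     D4_fun M a \<sigma> p + tr_chi M a p * \<sigma> p =
       - hcurl M a \<alpha> p - hwedge M a p (eta a p + etab a p) (\<alpha> p) + eps_chi M a p * \<rho> p \<and>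
     D4_fun M a \<rho> p + tr_chi M a p * \<rho> p =
       hdiv M a \<alpha> p + hinner M a p (eta a p + etab a p) (\<alpha> p) - eps_chi M a p * \<sigma> p \<and>
     D3 M a \<alpha> p + chib_dot M a p (\<alpha> p) =
       hgrad M a \<rho> p + hstar M a p (hgrad M a \<sigma> p)
       + (2 * \<rho> p) *\<^sub>R eta a p + (2 * \<sigma> p) *\<^sub>R hstar M a p (eta a p) \<and>
     D4 M a \<alpha>b p + chi_dot M a p (\<alpha>b p) + omega_hat M a p *\<^sub>R \<alpha>b p =
       - hgrad M a \<rho> p + hstar M a p (hgrad M a \<sigma> p)
       - (2 * \<rho> p) *\<^sub>R etab a p + (2 * \<sigma> p) *\<^sub>R hstar M a p (etab a p))"

definition smooth_maxwell_solution ::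
  "real \<Rightarrow> real \<Rightarrow> (point \<Rightarrow> covec) \<Rightarrow> (point \<Rightarrow> covec) \<Rightarrow> (point \<Rightarrow> real) \<Rightarrow> (point \<Rightarrow> real) \<Rightarrow> bool"
where
  "smooth_maxwell_solution M a \<alpha> \<alpha>b \<rho> \<sigma> \<longleftrightarrow>
     smooth_on \<alpha> (kerr_exterior M a) \<and> horizontal_form M a \<alpha> \<and>
     smooth_on \<alpha>b (kerr_exterior M a) \<and> horizontal_form M a \<alpha>b \<and>
     smooth_on \<rho> (kerr_exterior M a) \<and> smooth_on \<sigma> (kerr_exterior M a) \<and>
     maxwell_equations M a \<alpha> \<alpha>b \<rho> \<sigma>"

section \<open>Comparison with the coordinate expressions\<close>

lemma vector_4 [simp]:
  "(vector [w, x, y, z] :: real^4) $ 1 = w"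
  "(vector [w, x, y, z] :: real^4) $ 2 = x"
  "(vector [w, x, y, z] :: real^4) $ 3 = y"
  "(vector [w, x, y, z] :: real^4) $ 4 = z"
  unfolding vector_def by simp_all

lemma vector_4_row [simp]:
  "(vector [w, x, y, z] :: real^4^4) $ 1 = w"
  "(vector [w, x, y, z] :: real^4^4) $ 2 = x"
  "(vector [w, x, y, z] :: real^4^4) $ 3 = y"
  "(vector [w, x, y, z] :: real^4^4) $ 4 = z"
  unfolding vector_def by simp_all

lemma inner_4: "(u::real^4) \<bullet> v = u$1 * v$1 + u$2 * v$2 + u$3 * v$3 + u$4 * v$4"
  by (simp add: inner_vec_def sum_4)

lemma axis_4 [simp]:
  "(axis 1 c :: real^4) $ 1 = c" "(axis 1 c :: real^4) $ 2 = 0"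
  "(axis 1 c :: real^4) $ 3 = 0" "(axis 1 c :: real^4) $ 4 = 0"
  "(axis 2 c :: real^4) $ 1 = 0" "(axis 2 c :: real^4) $ 2 = c"
  "(axis 2 c :: real^4) $ 3 = 0" "(axis 2 c :: real^4) $ 4 = 0"
  "(axis 3 c :: real^4) $ 1 = 0" "(axis 3 c :: real^4) $ 2 = 0"
  "(axis 3 c :: real^4) $ 3 = c" "(axis 3 c :: real^4) $ 4 = 0"
  "(axis 4 c :: real^4) $ 1 = 0" "(axis 4 c :: real^4) $ 2 = 0"
  "(axis 4 c :: real^4) $ 3 = 0" "(axis 4 c :: real^4) $ 4 = c"
  by (simp_all add: axis_def)

lemma Delta_r_eq:
  assumes "\<bar>a\<bar> \<le> M"
  shows "Delta_r M a r = r\<^sup>2 + a\<^sup>2 - 2 * M * r"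
proof -
  have "a\<^sup>2 \<le> M\<^sup>2"
    using assms by (rule abs_le_square_iff[THEN iffD1, OF order_trans[OF _ abs_ge_self]])
  then have "sqrt (M\<^sup>2 - a\<^sup>2) * sqrt (M\<^sup>2 - a\<^sup>2) = M\<^sup>2 - a\<^sup>2"
    by simp
  then show ?thesis
    unfolding Delta_r_def r_plus_def r_minus_def by algebra
qed

text \<open>Ingoing coordinates \<open>(t, r, \<theta>, \<phi>)\<close> and their remaining coordinate field.\<close>

definition ingoing :: "real \<Rightarrow> real \<Rightarrow> real \<Rightarrow> real \<Rightarrow> point" where
  "ingoing t r \<theta> \<phi> = vector [t, r * sin \<theta> * cos \<phi>, r * sin \<theta> * sin \<phi>, r * cos \<theta>]"

lemma ingoing_axis:
  "ingoing t r \<theta> \<phi> = t *\<^sub>R axis 1 1 + (r * sin \<theta> * cos \<phi>) *\<^sub>R axis 2 1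
     + (r * sin \<theta> * sin \<phi>) *\<^sub>R axis 3 1 + (r * cos \<theta>) *\<^sub>R axis 4 1"
  by (simp add: vec_eq_iff forall_4 ingoing_def)

definition del_theta :: "point \<Rightarrow> tvec" where
  "del_theta p = vector [0, cos_theta p * p $ 2 / sin_theta p, cos_theta p * p $ 3 / sin_theta p,
     - sin_theta p * radius p]"

context
  fixes t r \<theta> \<phi> :: real
  assumes r: "r > 0" and \<theta>: "0 < \<theta>" "\<theta> < pi"
begin

lemma sin_pos: "sin \<theta> > 0"
  using \<theta> by (rule sin_gt_zero)

lemma radius_ingoing: "radius (ingoing t r \<theta> \<phi>) = r"
proof -
  have "(r * sin \<theta> * cos \<phi>)\<^sup>2 + (r * sin \<theta> * sin \<phi>)\<^sup>2 + (r * cos \<theta>)\<^sup>2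
      = r\<^sup>2 * ((sin \<theta>)\<^sup>2 * ((cos \<phi>)\<^sup>2 + (sin \<phi>)\<^sup>2) + (cos \<theta>)\<^sup>2)"
    by algebra
  then show ?thesis
    using r by (simp add: radius_def ingoing_def)
qed

lemma cos_theta_ingoing: "cos_theta (ingoing t r \<theta> \<phi>) = cos \<theta>"
  using r unfolding cos_theta_def radius_ingoing by (simp add: ingoing_def)

lemma sin_theta_ingoing: "sin_theta (ingoing t r \<theta> \<phi>) = sin \<theta>"
proof -
  have "(r * sin \<theta> * cos \<phi>)\<^sup>2 + (r * sin \<theta> * sin \<phi>)\<^sup>2
      = (r * sin \<theta>)\<^sup>2 * ((cos \<phi>)\<^sup>2 + (sin \<phi>)\<^sup>2)"
    by algebra
  then show ?thesis
    using r sin_pos unfolding sin_theta_def radius_ingoing by (simp add: ingoing_def)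
qed

lemma Sig_ingoing: "Sig a (ingoing t r \<theta> \<phi>) = r\<^sup>2 + a\<^sup>2 * (cos \<theta>)\<^sup>2"
  by (simp add: Sig_def radius_ingoing cos_theta_ingoing)

lemma coordinate_fields_ingoing:
  "del_t = vector [1, 0, 0, 0]"
  "del_r (ingoing t r \<theta> \<phi>) = vector [0, sin \<theta> * cos \<phi>, sin \<theta> * sin \<phi>, cos \<theta>]"
  "del_theta (ingoing t r \<theta> \<phi>) = vector [0, r * cos \<theta> * cos \<phi>, r * cos \<theta> * sin \<phi>, - r * sin \<theta>]"
  "del_phi (ingoing t r \<theta> \<phi>) = vector [0, - r * sin \<theta> * sin \<phi>, r * sin \<theta> * cos \<phi>, 0]"
  using r sin_pos
  by (simp_all add: vec_eq_iff forall_4 del_t_def del_r_def del_theta_def del_phi_def radius_ingoing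
      cos_theta_ingoing sin_theta_ingoing, simp_all add: ingoing_def)

lemma ingoing_tangent:
  "((\<lambda>s. ingoing s r \<theta> \<phi>) has_vector_derivative del_t) (at t)"
  "((\<lambda>s. ingoing t s \<theta> \<phi>) has_vector_derivative del_r (ingoing t r \<theta> \<phi>)) (at r)"
  "((\<lambda>s. ingoing t r s \<phi>) has_vector_derivative del_theta (ingoing t r \<theta> \<phi>)) (at \<theta>)"
  "((\<lambda>s. ingoing t r \<theta> s) has_vector_derivative del_phi (ingoing t r \<theta> \<phi>)) (at \<phi>)"
  unfolding coordinate_fields_ingoing
  unfolding ingoing_axis
  by (auto intro!: derivative_eq_intros simp: vec_eq_iff forall_4)

lemma forms_ingoing:
  fixes b1 b2 b3 b4 :: real
  defines "p \<equiv> ingoing t r \<theta> \<phi>"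
  defines "v \<equiv> b1 *\<^sub>R del_t + b2 *\<^sub>R del_r p + b3 *\<^sub>R del_theta p + b4 *\<^sub>R del_phi p"
  shows "d_t \<bullet> v = b1" "d_r p \<bullet> v = b2" "d_cos_theta p \<bullet> v = - sin \<theta> * b3"
    "sin2_d_phi p \<bullet> v = (sin \<theta>)\<^sup>2 * b4"
proof -
  define C where "C = cos \<phi>"
  define S where "S = sin \<phi>"
  define x where "x = sin \<theta>"
  define y where "y = cos \<theta>"
  note folds = C_def[symmetric] S_def[symmetric] x_def[symmetric] y_def[symmetric]
  have c: "C\<^sup>2 = 1 - S\<^sup>2" "y\<^sup>2 = 1 - x\<^sup>2"
    by (simp_all add: cos_squared_eq C_def S_def x_def y_def)
  have v: "v = vector [b1, b2 * x * C + b3 * r * y * C - b4 * r * x * S,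
      b2 * x * S + b3 * r * y * S + b4 * r * x * C, b2 * y - b3 * r * x]"
    unfolding v_def p_def coordinate_fields_ingoing folds by (simp add: vec_eq_iff forall_4)
  show "d_t \<bullet> v = b1"
    by (simp add: v d_t_def inner_4)
  have dr: "d_r p = vector [0, x * C, x * S, y]"
    using coordinate_fields_ingoing(2) unfolding folds by (simp add: p_def d_r_def del_r_def)
  show *: "d_r p \<bullet> v = b2"
    using c unfolding dr by (simp add: v inner_4) algebra
  have "d_cos_theta p \<bullet> v = (1 / r) * ((b2 * y - b3 * r * x) - y * b2)"
    using * unfolding d_cos_theta_def p_def radius_ingoing cos_theta_ingoing folds
    by (simp add: inner_diff_left) (simp add: v inner_4)
  then show "d_cos_theta p \<bullet> v = - sin \<theta> * b3"
    using r by (simp add: x_def)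
  have "sin2_d_phi p \<bullet> v = (1 / r\<^sup>2) * (r * x * C * (b2 * x * S + b3 * r * y * S + b4 * r * x * C)
       - r * x * S * (b2 * x * C + b3 * r * y * C - b4 * r * x * S))"
    unfolding sin2_d_phi_def p_def radius_ingoing
    by (simp add: v inner_4 ingoing_def folds diff_divide_distrib)
  also have "r * x * C * (b2 * x * S + b3 * r * y * S + b4 * r * x * C)
       - r * x * S * (b2 * x * C + b3 * r * y * C - b4 * r * x * S) = r\<^sup>2 * (x\<^sup>2 * b4)"
    using c by algebra
  finally show "sin2_d_phi p \<bullet> v = (sin \<theta>)\<^sup>2 * b4"
    using r by (simp add: x_def)
qed

lemma round_metric_ingoing:
  fixes b1 b2 b3 b4 c1 c2 c3 c4 :: real
  defines "p \<equiv> ingoing t r \<theta> \<phi>"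
  defines "u \<equiv> b1 *\<^sub>R del_t + b2 *\<^sub>R del_r p + b3 *\<^sub>R del_theta p + b4 *\<^sub>R del_phi p"
  defines "v \<equiv> c1 *\<^sub>R del_t + c2 *\<^sub>R del_r p + c3 *\<^sub>R del_theta p + c4 *\<^sub>R del_phi p"
  shows "round_metric p u v = b3 * c3 + (sin \<theta>)\<^sup>2 * b4 * c4"
proof -
  define C where "C = cos \<phi>"
  define S where "S = sin \<phi>"
  define x where "x = sin \<theta>"
  define y where "y = cos \<theta>"
  have c: "C\<^sup>2 = 1 - S\<^sup>2" "y\<^sup>2 = 1 - x\<^sup>2"
    by (simp_all add: cos_squared_eq C_def S_def x_def y_def)
  have "u $ 2 * v $ 2 + u $ 3 * v $ 3 + u $ 4 * v $ 4
      = b2 * c2 + r\<^sup>2 * (b3 * c3 + (sin \<theta>)\<^sup>2 * b4 * c4)"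
    unfolding u_def v_def p_def coordinate_fields_ingoing
    using c unfolding C_def[symmetric] S_def[symmetric] x_def[symmetric] y_def[symmetric]
    apply simp
    apply algebra
    done
  moreover have "d_r p \<bullet> u = b2" "d_r p \<bullet> v = c2"
    unfolding u_def v_def p_def by (rule forms_ingoing)+
  ultimately show ?thesis
    using r unfolding round_metric_def p_def radius_ingoing by simp
qed

lemma kerr_metric_components:
  fixes M a b1 b2 b3 b4 c1 c2 c3 c4 :: real
  defines "p \<equiv> ingoing t r \<theta> \<phi>" and "S \<equiv> r\<^sup>2 + a\<^sup>2 * (cos \<theta>)\<^sup>2"
  assumes M: "\<bar>a\<bar> \<le> M"
  shows "kerr_metric M a p
      (b1 *\<^sub>R del_t + b2 *\<^sub>R del_r p + b3 *\<^sub>R del_theta p + b4 *\<^sub>R del_phi p)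
      (c1 *\<^sub>R del_t + c2 *\<^sub>R del_r p + c3 *\<^sub>R del_theta p + c4 *\<^sub>R del_phi p)
    = - (1 - 2 * M * r / S) * b1 * c1 + (b1 * c2 + b2 * c1) + S * b3 * c3
      + ((r\<^sup>2 + a\<^sup>2)\<^sup>2 - Delta_r M a r * a\<^sup>2 * (sin \<theta>)\<^sup>2) / S * (sin \<theta>)\<^sup>2 * b4 * c4
      - a * (sin \<theta>)\<^sup>2 * (b2 * c4 + b4 * c2)
      - 2 * a * M * r / S * (sin \<theta>)\<^sup>2 * (b1 * c4 + b4 * c1)"
proof -
  define s where "s = (sin \<theta>)\<^sup>2"
  have S: "S > 0" using r by (simp add: S_def add_pos_nonneg)
  have S': "S = r\<^sup>2 + a\<^sup>2 - a\<^sup>2 * s"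
    by (simp add: S_def s_def cos_squared_eq algebra_simps)
  have D: "Delta_r M a r = r\<^sup>2 + a\<^sup>2 - 2 * M * r"
    by (rule Delta_r_eq[OF M])
  have "(r\<^sup>2 + a\<^sup>2)\<^sup>2 - (r\<^sup>2 + a\<^sup>2 - 2 * M * r) * a\<^sup>2 * s = S * S + a\<^sup>2 * s * (S + 2 * M * r)"
    unfolding S' by algebra
  then have "((r\<^sup>2 + a\<^sup>2)\<^sup>2 - Delta_r M a r * a\<^sup>2 * s) / S = S + a\<^sup>2 * s * (1 + 2 * M * r / S)"
    using S unfolding D by (simp add: field_simps)
  then show ?thesis
    unfolding kerr_metric_def Let_def p_def forms_ingoing round_metric_ingoing radius_ingoing
      Sig_ingoing S_def[symmetric] s_def[symmetric]
    by (simp add: algebra_simps power2_eq_square)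
qed

end

text \<open>
  Boyer-Lindquist coordinates on \<open>r > r\<^sub>+\<close>, normalised at \<open>r = 9 M / 4\<close>.  The fields \<open>\<partial>\<^sub>t\<close>, \<open>\<partial>\<^sub>\<theta>\<close>
  and \<open>\<partial>\<^sub>\<phi>\<close> agree with the ingoing ones.
\<close>

definition boyer_lindquist :: "real \<Rightarrow> real \<Rightarrow> real \<Rightarrow> real \<Rightarrow> real \<Rightarrow> real \<Rightarrow> point" where
  "boyer_lindquist M a t r \<theta> \<phi> =
     ingoing (t + (LBINT s=9*M/4..r. (s\<^sup>2 + a\<^sup>2) / Delta_r M a s)) r \<theta>
       (\<phi> + (LBINT s=9*M/4..r. a / Delta_r M a s))"

definition bl_del_r :: "real \<Rightarrow> real \<Rightarrow> point \<Rightarrow> tvec" where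
  "bl_del_r M a p = del_r p + (((radius p)\<^sup>2 + a\<^sup>2) / Delta M a p) *\<^sub>R del_t
     + (a / Delta M a p) *\<^sub>R del_phi p"

lemma r_plus_pos:
  assumes "M > 0" "\<bar>a\<bar> \<le> M"
  shows "r_plus M a > 0"
proof -
  have "a\<^sup>2 \<le> M\<^sup>2"
    using assms abs_le_square_iff[of a M] by linarith
  then have "sqrt (M\<^sup>2 - a\<^sup>2) \<ge> 0"
    by simp
  then show ?thesis
    using assms(1) unfolding r_plus_def by linarith
qed

lemma Delta_r_pos:
  assumes "\<bar>a\<bar> \<le> M" "r > r_plus M a"
  shows "Delta_r M a r > 0"
proof -
  have "a\<^sup>2 \<le> M\<^sup>2"
    using assms(1) abs_le_square_iff[of a M] by linarith
  then have "r_minus M a \<le> r_plus M a"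
    by (simp add: r_minus_def r_plus_def)
  then show ?thesis
    using assms(2) by (simp add: Delta_r_def)
qed

lemma FTC_bl:
  fixes f :: "real \<Rightarrow> real"
  assumes M: "M > 0" "\<bar>a\<bar> \<le> M" and r: "r > r_plus M a"
    and f: "continuous_on {r_plus M a<..} f"
  shows "((\<lambda>s. LBINT u=9*M/4..s. f u) has_real_derivative f r) (at r)"
proof -
  have "sqrt (M\<^sup>2 - a\<^sup>2) \<le> M"
    using M by (intro real_le_lsqrt) auto
  then have rp: "r_plus M a < 9*M/4"
    using M by (simp add: r_plus_def)
  define l where "l = (r_plus M a + min r (9*M/4)) / 2"
  define h where "h = max r (9*M/4) + 1"
  have l: "r_plus M a < l" "l < r" "l < 9*M/4" and h: "r < h" "9*M/4 < h"
    using r rp by (auto simp: l_def h_def min_def max_def)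
  have "((\<lambda>s. LBINT u=9*M/4..s. f u) has_vector_derivative f r) (at r within {l..h})"
    using l h by (intro interval_integral_FTC2 continuous_on_subset[OF f]) auto
  then show ?thesis
    using l h by (simp add: at_within_Icc_at has_real_derivative_iff_has_vector_derivative)
qed

lemma boyer_lindquist_tangent:
  fixes t \<phi> :: real
  assumes M: "M > 0" "\<bar>a\<bar> \<le> M" and r: "r > r_plus M a" and \<theta>: "0 < \<theta>" "\<theta> < pi"
  defines "p \<equiv> boyer_lindquist M a t r \<theta> \<phi>"
  shows
    "((\<lambda>s. boyer_lindquist M a s r \<theta> \<phi>) has_vector_derivative del_t) (at t)"
    "((\<lambda>s. boyer_lindquist M a t s \<theta> \<phi>) has_vector_derivative bl_del_r M a p) (at r)"
    "((\<lambda>s. boyer_lindquist M a t r s \<phi>) has_vector_derivative del_theta p) (at \<theta>)"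
    "((\<lambda>s. boyer_lindquist M a t r \<theta> s) has_vector_derivative del_phi p) (at \<phi>)"
proof -
  have r0: "r > 0" using r_plus_pos[OF M] r by linarith
  define T where "T = (\<lambda>r. LBINT s=9*M/4..r. (s\<^sup>2 + a\<^sup>2) / Delta_r M a s)"
  define P where "P = (\<lambda>r. LBINT s=9*M/4..r. a / Delta_r M a s)"
  have bl: "boyer_lindquist M a t r \<theta> \<phi> = ingoing (t + T r) r \<theta> (\<phi> + P r)" for t r \<theta> \<phi>
    by (simp add: boyer_lindquist_def T_def P_def)
  have nz: "Delta_r M a s \<noteq> 0" if "s > r_plus M a" for s
    using Delta_r_pos[OF M(2) that] by simp
  have cont: "continuous_on A (Delta_r M a)" for A
    unfolding Delta_r_def by (intro continuous_intros)
  have T: "(T has_real_derivative (r\<^sup>2 + a\<^sup>2) / Delta_r M a r) (at r)"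
    unfolding T_def by (intro FTC_bl[OF M r] continuous_intros cont) (use nz in auto)
  have P: "(P has_real_derivative a / Delta_r M a r) (at r)"
    unfolding P_def by (intro FTC_bl[OF M r] continuous_intros cont) (use nz in auto)
  note fields = coordinate_fields_ingoing[OF r0 \<theta>]
  show "((\<lambda>s. boyer_lindquist M a s r \<theta> \<phi>) has_vector_derivative del_t) (at t)"
    unfolding bl unfolding fields unfolding ingoing_axis
    by (auto intro!: derivative_eq_intros simp: vec_eq_iff forall_4)
  show "((\<lambda>s. boyer_lindquist M a t s \<theta> \<phi>) has_vector_derivative bl_del_r M a p) (at r)"
    unfolding bl p_def bl_del_r_def radius_ingoing[OF r0 \<theta>] Delta_def unfolding fields
    unfolding ingoing_axis
    by (auto intro!: derivative_eq_intros T P simp: vec_eq_iff forall_4 algebra_simps)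
  show "((\<lambda>s. boyer_lindquist M a t r s \<phi>) has_vector_derivative del_theta p) (at \<theta>)"
    unfolding bl p_def using ingoing_tangent(3)[OF r0 \<theta>] by simp
  show "((\<lambda>s. boyer_lindquist M a t r \<theta> s) has_vector_derivative del_phi p) (at \<phi>)"
    unfolding bl p_def unfolding fields unfolding ingoing_axis
    by (auto intro!: derivative_eq_intros simp: vec_eq_iff forall_4 algebra_simps)
qed

lemma e3_boyer_lindquist:
  "e3 p = (((radius p)\<^sup>2 + a\<^sup>2) / Delta M a p) *\<^sub>R del_t - bl_del_r M a p
     + (a / Delta M a p) *\<^sub>R del_phi p"
  by (simp add: e3_def bl_del_r_def)

lemma e4_boyer_lindquist:
  assumes "\<bar>a\<bar> \<le> M" "radius p > r_plus M a"
  shows "e4 M a p = (((radius p)\<^sup>2 + a\<^sup>2) / Sig a p) *\<^sub>R del_t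
     + (Delta M a p / Sig a p) *\<^sub>R bl_del_r M a p + (a / Sig a p) *\<^sub>R del_phi p"
proof -
  have "Delta M a p \<noteq> 0"
    using Delta_r_pos[OF assms] by (simp add: Delta_def)
  then show ?thesis
    unfolding e4_def bl_del_r_def by (simp add: vec_eq_iff add_divide_distrib algebra_simps)
qed

lemma eta_boyer_lindquist:
  fixes t \<phi> :: real
  assumes M: "M > 0" "\<bar>a\<bar> \<le> M" and r: "r > r_plus M a" and \<theta>: "0 < \<theta>" "\<theta> < pi"
  defines "p \<equiv> boyer_lindquist M a t r \<theta> \<phi>" and "S \<equiv> r\<^sup>2 + a\<^sup>2 * (cos \<theta>)\<^sup>2"
  shows "eta a p \<bullet> del_t = - a\<^sup>2 * r / S\<^sup>2 * (sin \<theta>)\<^sup>2"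
    "eta a p \<bullet> bl_del_r M a p = 0"
    "eta a p \<bullet> del_theta p = - a\<^sup>2 * sin (2 * \<theta>) / (2 * S)"
    "eta a p \<bullet> del_phi p = a * r * (r\<^sup>2 + a\<^sup>2) / S\<^sup>2 * (sin \<theta>)\<^sup>2"
proof -
  have r0: "r > 0" using r_plus_pos[OF M] r by linarith
  obtain t' \<phi>' where p: "p = ingoing t' r \<theta> \<phi>'"
    by (auto simp: p_def boyer_lindquist_def)
  note f = forms_ingoing[where t = t' and \<phi> = \<phi>', OF r0 \<theta>, folded p]
  note rad = radius_ingoing[OF r0 \<theta>, of t' \<phi>', folded p]
  have *: "eta a p \<bullet> (b1 *\<^sub>R del_t + b2 *\<^sub>R del_r p + b3 *\<^sub>R del_theta p + b4 *\<^sub>R del_phi p)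
      = (- a\<^sup>2 * r / S\<^sup>2 * (sin \<theta>)\<^sup>2) * b1 + (- a\<^sup>2 * sin (2 * \<theta>) / (2 * S)) * b3
        + (a * r * (r\<^sup>2 + a\<^sup>2) / S\<^sup>2 * (sin \<theta>)\<^sup>2) * b4" for b1 b2 b3 b4
    unfolding eta_def inner_add_left inner_diff_left inner_scaleR_left f rad
    using Sig_ingoing[OF r0 \<theta>, of a t' \<phi>', folded p] cos_theta_ingoing[OF r0 \<theta>, of t' \<phi>', folded p]
      sin_theta_ingoing[OF r0 \<theta>, of t' \<phi>', folded p]
    unfolding S_def[symmetric] by (simp add: sin_double) (simp add: mult_ac)
  show "eta a p \<bullet> del_t = - a\<^sup>2 * r / S\<^sup>2 * (sin \<theta>)\<^sup>2"
    using *[of 1 0 0 0] by simp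
  show "eta a p \<bullet> bl_del_r M a p = 0"
    using *[of "(r\<^sup>2 + a\<^sup>2) / Delta_r M a r" 1 0 "a / Delta_r M a r"]
    by (simp add: bl_del_r_def Delta_def rad add.commute mult.commute power2_eq_square)
  show "eta a p \<bullet> del_theta p = - a\<^sup>2 * sin (2 * \<theta>) / (2 * S)"
    using *[of 0 0 1 0] by simp
  show "eta a p \<bullet> del_phi p = a * r * (r\<^sup>2 + a\<^sup>2) / S\<^sup>2 * (sin \<theta>)\<^sup>2"
    using *[of 0 0 0 1] by simp
qed

lemma etab_boyer_lindquist:
  fixes t \<phi> :: real
  assumes M: "M > 0" "\<bar>a\<bar> \<le> M" and r: "r > r_plus M a" and \<theta>: "0 < \<theta>" "\<theta> < pi"
  defines "p \<equiv> boyer_lindquist M a t r \<theta> \<phi>" and "S \<equiv> r\<^sup>2 + a\<^sup>2 * (cos \<theta>)\<^sup>2"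
  shows "etab a p \<bullet> del_t = a\<^sup>2 * r / S\<^sup>2 * (sin \<theta>)\<^sup>2"
    "etab a p \<bullet> bl_del_r M a p = 0"
    "etab a p \<bullet> del_theta p = - a\<^sup>2 * sin (2 * \<theta>) / (2 * S)"
    "etab a p \<bullet> del_phi p = - a * r * (r\<^sup>2 + a\<^sup>2) / S\<^sup>2 * (sin \<theta>)\<^sup>2"
proof -
  have r0: "r > 0" using r_plus_pos[OF M] r by linarith
  obtain t' \<phi>' where p: "p = ingoing t' r \<theta> \<phi>'"
    by (auto simp: p_def boyer_lindquist_def)
  note f = forms_ingoing[where t = t' and \<phi> = \<phi>', OF r0 \<theta>, folded p]
  note rad = radius_ingoing[OF r0 \<theta>, of t' \<phi>', folded p]
  have *: "etab a p \<bullet> (b1 *\<^sub>R del_t + b2 *\<^sub>R del_r p + b3 *\<^sub>R del_theta p + b4 *\<^sub>R del_phi p)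
      = (a\<^sup>2 * r / S\<^sup>2 * (sin \<theta>)\<^sup>2) * b1 + (- a\<^sup>2 * sin (2 * \<theta>) / (2 * S)) * b3
        + (- a * r * (r\<^sup>2 + a\<^sup>2) / S\<^sup>2 * (sin \<theta>)\<^sup>2) * b4" for b1 b2 b3 b4
    unfolding etab_def inner_add_left inner_diff_left inner_scaleR_left f rad
    using Sig_ingoing[OF r0 \<theta>, of a t' \<phi>', folded p] cos_theta_ingoing[OF r0 \<theta>, of t' \<phi>', folded p]
      sin_theta_ingoing[OF r0 \<theta>, of t' \<phi>', folded p]
    unfolding S_def[symmetric] by (simp add: sin_double) (simp add: mult_ac)
  show "etab a p \<bullet> del_t = a\<^sup>2 * r / S\<^sup>2 * (sin \<theta>)\<^sup>2"
    using *[of 1 0 0 0] by simp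
  show "etab a p \<bullet> bl_del_r M a p = 0"
    using *[of "(r\<^sup>2 + a\<^sup>2) / Delta_r M a r" 1 0 "a / Delta_r M a r"]
    by (simp add: bl_del_r_def Delta_def rad add.commute mult.commute power2_eq_square)
  show "etab a p \<bullet> del_theta p = - a\<^sup>2 * sin (2 * \<theta>) / (2 * S)"
    using *[of 0 0 1 0] by simp
  show "etab a p \<bullet> del_phi p = - a * r * (r\<^sup>2 + a\<^sup>2) / S\<^sup>2 * (sin \<theta>)\<^sup>2"
    using *[of 0 0 0 1] by simp
qed

text \<open>The frame of the horizontal distribution away from the axis.\<close>

definition e1 :: "real \<Rightarrow> point \<Rightarrow> tvec" where
  "e1 a p = (a\<^sup>2 * sin_theta p * cos_theta p / Sig a p) *\<^sub>R del_t
     + (radius p / Sig a p) *\<^sub>R del_theta p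
     + (a * cos_theta p / (Sig a p * sin_theta p)) *\<^sub>R del_phi p"

definition e2 :: "real \<Rightarrow> point \<Rightarrow> tvec" where
  "e2 a p = (a * radius p * sin_theta p / Sig a p) *\<^sub>R del_t
     - (a * cos_theta p / Sig a p) *\<^sub>R del_theta p
     + (radius p / (Sig a p * sin_theta p)) *\<^sub>R del_phi p"

lemma kerr_frame:
  fixes t \<phi> :: real
  assumes r: "r > 0" and \<theta>: "0 < \<theta>" "\<theta> < pi" and M: "\<bar>a\<bar> \<le> M"
  defines "p \<equiv> ingoing t r \<theta> \<phi>"
  shows "kerr_metric M a p (e3 p) (e3 p) = 0" "kerr_metric M a p (e4 M a p) (e4 M a p) = 0"
    "kerr_metric M a p (e3 p) (e4 M a p) = - 2"
    "kerr_metric M a p (e1 a p) (e1 a p) = 1" "kerr_metric M a p (e2 a p) (e2 a p) = 1"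
    "kerr_metric M a p (e1 a p) (e2 a p) = 0"
    "e1 a p \<in> horizontal M a p" "e2 a p \<in> horizontal M a p"
proof -
  define x where "x = sin \<theta>"
  define y where "y = cos \<theta>"
  define S where "S = r\<^sup>2 + a\<^sup>2 * y\<^sup>2"
  define D where "D = Delta_r M a r"
  define A where "A = r\<^sup>2 + a\<^sup>2"
  have x: "x \<noteq> 0" using sin_gt_zero[OF \<theta>] by (simp add: x_def)
  have S0: "S \<noteq> 0" using r by (simp add: S_def add_pos_nonneg less_imp_neq[symmetric])
  have y: "y\<^sup>2 = 1 - x\<^sup>2" by (simp add: x_def y_def cos_squared_eq)
  have D: "D = r\<^sup>2 + a\<^sup>2 - 2 * M * r" unfolding D_def by (rule Delta_r_eq[OF M])
  have S: "S = A - a\<^sup>2 * x\<^sup>2" by (simp add: S_def A_def y algebra_simps)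
  have S2: "S = r\<^sup>2 + a\<^sup>2 * y\<^sup>2" by (simp add: S_def)
  have MD: "2 * M * r = A - D" by (simp add: D A_def)
  have g: "kerr_metric M a p
      (b1 *\<^sub>R del_t + b2 *\<^sub>R del_r p + b3 *\<^sub>R del_theta p + b4 *\<^sub>R del_phi p)
      (c1 *\<^sub>R del_t + c2 *\<^sub>R del_r p + c3 *\<^sub>R del_theta p + c4 *\<^sub>R del_phi p)
    = - (1 - (A - D) / S) * b1 * c1 + (b1 * c2 + b2 * c1) + S * b3 * c3
      + (A\<^sup>2 - D * a\<^sup>2 * x\<^sup>2) / S * x\<^sup>2 * b4 * c4
      - a * x\<^sup>2 * (b2 * c4 + b4 * c2) - a * (A - D) / S * x\<^sup>2 * (b1 * c4 + b4 * c1)"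
    for b1 b2 b3 b4 c1 c2 c3 c4
    using kerr_metric_components[OF r \<theta> M, of t \<phi> b1 b2 b3 b4 c1 c2 c3 c4] MD
    by (simp add: p_def x_def y_def S_def D_def A_def mult.assoc mult.left_commute[of _ a])
  have v: "e3 p = 0 *\<^sub>R del_t + (-1) *\<^sub>R del_r p + 0 *\<^sub>R del_theta p + 0 *\<^sub>R del_phi p"
    "e4 M a p = (2 * A / S) *\<^sub>R del_t + (D / S) *\<^sub>R del_r p + 0 *\<^sub>R del_theta p + (2 * a / S) *\<^sub>R del_phi p"
    "e1 a p = (a\<^sup>2 * x * y / S) *\<^sub>R del_t + 0 *\<^sub>R del_r p + (r / S) *\<^sub>R del_theta p + (a * y / (S * x)) *\<^sub>R del_phi p"
    "e2 a p = (a * r * x / S) *\<^sub>R del_t + 0 *\<^sub>R del_r p + (- a * y / S) *\<^sub>R del_theta p + (r / (S * x)) *\<^sub>R del_phi p"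
    unfolding e1_def e2_def e3_def e4_def Delta_def
    by (simp_all add: p_def radius_ingoing[OF r \<theta>] Sig_ingoing[OF r \<theta>] cos_theta_ingoing[OF r \<theta>]
        sin_theta_ingoing[OF r \<theta>] x_def y_def S_def D_def A_def)
  show "kerr_metric M a p (e3 p) (e3 p) = 0"
    unfolding v g by simp
  show "kerr_metric M a p (e3 p) (e4 M a p) = - 2"
    unfolding v g using S0 by (simp add: field_simps) (simp add: S algebra_simps power2_eq_square)
  show "kerr_metric M a p (e4 M a p) (e4 M a p) = 0"
    unfolding v g using S0 apply (simp add: divide_simps) using S apply algebra done
  show "kerr_metric M a p (e1 a p) (e1 a p) = 1"
    unfolding v g using S0 x apply (simp add: divide_simps) using S S2 y apply algebra done
  show "kerr_metric M a p (e2 a p) (e2 a p) = 1"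
    unfolding v g using S0 x apply (simp add: divide_simps) using S S2 y apply algebra done
  show "kerr_metric M a p (e1 a p) (e2 a p) = 0"
    unfolding v g using S0 x apply (simp add: divide_simps) using S S2 y apply algebra done
  have "kerr_metric M a p (e1 a p) (e3 p) = 0" "kerr_metric M a p (e2 a p) (e3 p) = 0"
    unfolding v g using S0 x by (simp_all add: divide_simps power2_eq_square)
  moreover have "kerr_metric M a p (e1 a p) (e4 M a p) = 0"
    unfolding v g using S0 x apply (simp add: divide_simps) using S S2 y apply algebra done
  moreover have "kerr_metric M a p (e2 a p) (e4 M a p) = 0"
    unfolding v g using S0 x apply (simp add: divide_simps) using S S2 y apply algebra done
  ultimately show "e1 a p \<in> horizontal M a p" "e2 a p \<in> horizontal M a p"
    by (simp_all add: horizontal_def)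
qed

lemma det_4:
  "det (A::real^4^4) =
     A$1$1 * (A$2$2 * (A$3$3 * A$4$4 - A$3$4 * A$4$3) - A$2$3 * (A$3$2 * A$4$4 - A$3$4 * A$4$2)
       + A$2$4 * (A$3$2 * A$4$3 - A$3$3 * A$4$2))
   - A$1$2 * (A$2$1 * (A$3$3 * A$4$4 - A$3$4 * A$4$3) - A$2$3 * (A$3$1 * A$4$4 - A$3$4 * A$4$1)
       + A$2$4 * (A$3$1 * A$4$3 - A$3$3 * A$4$1))
   + A$1$3 * (A$2$1 * (A$3$2 * A$4$4 - A$3$4 * A$4$2) - A$2$2 * (A$3$1 * A$4$4 - A$3$4 * A$4$1)
       + A$2$4 * (A$3$1 * A$4$2 - A$3$2 * A$4$1))
   - A$1$4 * (A$2$1 * (A$3$2 * A$4$3 - A$3$3 * A$4$2) - A$2$2 * (A$3$1 * A$4$3 - A$3$3 * A$4$1)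
       + A$2$3 * (A$3$1 * A$4$2 - A$3$2 * A$4$1))"
proof -
  have f: "finite {2::4, 3, 4}" "1 \<notin> {2::4, 3, 4}" "finite {3::4, 4}" "2 \<notin> {3::4, 4}"
    "finite {4::4}" "3 \<notin> {4::4}"
    by auto
  show ?thesis
    unfolding det_def UNIV_4
    unfolding sum_over_permutations_insert[OF f(1,2)]
    unfolding sum_over_permutations_insert[OF f(3,4)]
    unfolding sum_over_permutations_insert[OF f(5,6)]
    unfolding permutes_sing
    apply (simp add: sign_swap_id sign_compose permutation_compose permutation_swap_id sign_id
      swap_id_eq)
    apply (simp add: algebra_simps)
    done
qed

lemma bilinear_kerr_metric: "bilinear (kerr_metric M a p)"
  unfolding bilinear_def linear_iff kerr_metric_def Let_def round_metric_def
  by (simp add: inner_add_right algebra_simps add_divide_distrib diff_divide_distrib)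

lemma kerr_metric_matrix: "kerr_metric M a p u v = u \<bullet> (metric_matrix M a p *v v)"
proof -
  note lin = bilinear_ladd[OF bilinear_kerr_metric] bilinear_radd[OF bilinear_kerr_metric]
    bilinear_lmul[OF bilinear_kerr_metric] bilinear_rmul[OF bilinear_kerr_metric]
  have *: "w = w$1 *\<^sub>R axis 1 1 + w$2 *\<^sub>R axis 2 1 + w$3 *\<^sub>R axis 3 1 + w$4 *\<^sub>R axis 4 1"
    for w :: "real^4"
    by (simp add: vec_eq_iff forall_4)
  show ?thesis
    by (subst *[of u], subst *[of v])
      (simp add: lin inner_4 matrix_vector_mult_def sum_4 metric_matrix_def algebra_simps)
qed

lemma harea_frame:
  fixes t \<phi> :: real
  assumes r: "r > 0" and \<theta>: "0 < \<theta>" "\<theta> < pi" and M: "\<bar>a\<bar> \<le> M"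
  defines "p \<equiv> ingoing t r \<theta> \<phi>"
  shows "harea M a p (e1 a p) (e2 a p) = 1"
proof -
  define x where "x = sin \<theta>"
  define y where "y = cos \<theta>"
  define S where "S = r\<^sup>2 + a\<^sup>2 * y\<^sup>2"
  have x: "x > 0" using sin_gt_zero[OF \<theta>] by (simp add: x_def)
  have S0: "S > 0" using r by (simp add: S_def add_pos_nonneg)
  have y: "y\<^sup>2 = 1 - x\<^sup>2" by (simp add: x_def y_def cos_squared_eq)
  define G where "G = metric_matrix M a p"
  define F where "F = (vector [e3 p, e4 M a p, e1 a p, e2 a p] :: real^4^4)"
  define J where "J = (vector [del_t, del_r p, del_theta p, del_phi p] :: real^4^4)"
  define K where "K = (vector [vector [0, -1, 0, 0],
      vector [2 * (r\<^sup>2 + a\<^sup>2) / S, Delta_r M a r / S, 0, 2 * a / S],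
      vector [a\<^sup>2 * x * y / S, 0, r / S, a * y / (S * x)],
      vector [a * r * x / S, 0, - a * y / S, r / (S * x)]] :: real^4^4)"
  have gram: "(F ** G ** transpose F) $ i $ j = kerr_metric M a p (F $ i) (F $ j)" for i j
    unfolding kerr_metric_matrix G_def[symmetric]
    by (simp add: matrix_matrix_mult_def transpose_def matrix_vector_mult_def inner_vec_def sum_4
        algebra_simps)
  have sym: "kerr_metric M a p u v = kerr_metric M a p v u" for u v
    by (simp add: kerr_metric_def round_metric_def Let_def algebra_simps)
  note fr = kerr_frame[OF r \<theta> M, of t \<phi>, folded p_def]
  have hor: "kerr_metric M a p v (e3 p) = 0" "kerr_metric M a p v (e4 M a p) = 0"
    "kerr_metric M a p (e3 p) v = 0" "kerr_metric M a p (e4 M a p) v = 0"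
    if "v \<in> horizontal M a p" for v
    using that sym by (auto simp: horizontal_def)
  have "det (F ** G ** transpose F) = - 4"
    unfolding det_4 gram
    by (simp add: F_def fr hor sym[of "e4 M a p" "e3 p"] sym[of "e2 a p" "e1 a p"])
  then have dG: "(det F)\<^sup>2 * (- det G) = 4"
    by (simp add: det_mul det_transpose power2_eq_square mult.commute mult.left_commute)
  have "F = K ** J"
    unfolding F_def K_def J_def e3_def e4_def e1_def e2_def Delta_def
    by (simp add: vec_eq_iff forall_4 matrix_matrix_mult_def sum_4 p_def radius_ingoing[OF r \<theta>]
        Sig_ingoing[OF r \<theta>] cos_theta_ingoing[OF r \<theta>] sin_theta_ingoing[OF r \<theta>] x_def y_def S_def)
  moreover have "det K = 2 / (S * x)"
  proof -
    have "det K * (S ^ 3 * x) = 2 * ((r\<^sup>2 + a\<^sup>2) - a\<^sup>2 * x\<^sup>2) * S"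
      unfolding K_def det_4 using S0 x apply (simp add: divide_simps)
      using S_def y apply algebra done
    also have "(r\<^sup>2 + a\<^sup>2) - a\<^sup>2 * x\<^sup>2 = S"
      by (simp add: S_def y algebra_simps)
    finally have "det K * (S ^ 3 * x) = 2 * S\<^sup>2"
      by (simp add: power2_eq_square)
    then show ?thesis
      using S0 x by (simp add: field_simps power2_eq_square power3_eq_cube)
  qed
  moreover have "det J = r\<^sup>2 * x"
  proof -
    have c: "(cos \<phi>)\<^sup>2 = 1 - (sin \<phi>)\<^sup>2"
      by (simp add: cos_squared_eq)
    show ?thesis
      unfolding J_def det_4 p_def coordinate_fields_ingoing[OF r \<theta>]
        x_def[symmetric] y_def[symmetric]
      using c y apply simp apply algebra done
  qed
  ultimately have "det F > 0"
    using r S0 x by (simp add: det_mul)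
  then have "sqrt (- det G) * det F = sqrt ((det F)\<^sup>2 * (- det G))"
    by (simp only: real_sqrt_mult real_sqrt_abs abs_of_pos mult.commute)
  also have "\<dots> = 2"
    unfolding dG by simp
  finally show ?thesis
    unfolding harea_def G_def[symmetric] F_def[symmetric] by simp
qed

end

theory Submission
  imports Defs
begin

text \<open>
  The fields \<open>e3\<close> and \<open>\<Sigma> e4\<close> are both of the form
  \<open>X = l ((r\<^sup>2 + a\<^sup>2) \<partial>\<^sub>t + a \<partial>\<^sub>\<phi>) + Q(r) \<partial>\<^sub>r\<close> with \<open>l\<close> constant, namely \<open>(l, Q) = (0, -1)\<close> and
  \<open>(2, \<Delta>)\<close>.  The horizontal distribution is the common kernel of \<open>dr\<close> and
  \<open>tau = dt - a sin\<^sup>2 \<theta> d\<phi>\<close>: it consists of the tangent vectors of the spheres, lifted by a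
  multiple of \<open>\<partial>\<^sub>t\<close>, and the metric restricted to it is \<open>\<Sigma>\<close> times the round metric.  The flow of
  \<open>X\<close> therefore preserves the distribution and its conformal structure.  Two things follow.  The Lie
  derivative along \<open>X\<close> of horizontal forms commutes with \<open>\<star>\<close> (\<open>lie_form_hstar\<close>) and satisfies
  \<open>L\<^sub>X (D u) = D (X u)\<close> (\<open>lie_form_hgrad\<close>).  And it differs from \<open>D\<^sub>X\<close> only by the second fundamental
  form of the distribution, which has no shear: \<open>D\<^sub>X = L\<^sub>X - t/2 - (e/2) \<star>\<close>, where the expansion \<open>t\<close>
  and the twist \<open>e\<close> of \<open>X\<close> are \<open>tr \<chi>\<close> and \<open>\<epsilon> \<cdot> \<chi>\<close>, underlined for \<open>e3\<close> and multiplied by \<open>\<Sigma>\<close>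
  for \<open>\<Sigma> e4\<close> (\<open>hderiv_X\<close>).

  Put \<open>T u = D u + 2 \<eta> u\<close>.  The Maxwell equation for \<open>\<alpha>\<close> says that the inner bracket of the first
  identity is \<open>\<Sigma> (T \<rho> + \<star> T \<sigma>)\<close>, and the outer operator is \<open>L\<^sub>X + e \<star>\<close>.  Since \<open>X \<Sigma> = t \<Sigma>\<close>, moving
  this operator past \<open>\<Sigma> T\<close> costs nothing but the identity \<open>2 L\<^sub>X \<eta> = D t + \<star> D e\<close> between explicit
  functions (\<open>lie_form_eta\<close>), and the result (\<open>commuted_equation\<close>) is
  \<open>\<Sigma> (T (X \<rho> + t \<rho> - e \<sigma>) + \<star> T (X \<sigma> + t \<sigma> + e \<rho>))\<close>.  By the other two Maxwell equations along \<open>X\<close>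
  the scalars in it are minus the divergence and minus the curl on the right-hand side.  The second
  identity is the same computation for \<open>\<Sigma> e4\<close>, with \<open>-\<rho>\<close> in place of \<open>\<rho>\<close>; there the lower order
  terms of the scalar equations turn \<open>\<Sigma> div \<alpha>\<close> into \<open>div (\<Sigma> \<alpha>)\<close>, because \<open>D \<Sigma>\<close> is \<open>\<Sigma>\<close> times the
  sum of the two torsion forms (\<open>hdiv_Sig\<close>, \<open>hcurl_Sig\<close>).

  Two points need care globally.  At the horizon derivatives are one-sided, so the symmetry of second
  derivatives behind \<open>L\<^sub>X (D u) = D (X u)\<close> is proved with squares that point outwards
  (\<open>second_symmetric\<close>).  On the axis the frame \<open>e1\<close>, \<open>e2\<close> degenerates; the horizontal lifts of the
  rotations of the spheres are used as test fields instead (\<open>rfield\<close>).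
\<close>

section \<open>Differentiation in the closed exterior\<close>

locale kerr =
  fixes M a :: real
  assumes M_pos: "M > 0" and a_le: "\<bar>a\<bar> \<le> M"
begin

abbreviation ext :: "point set" where
  "ext \<equiv> kerr_exterior M a"

abbreviation along :: "tvec \<Rightarrow> (point \<Rightarrow> 'b::real_normed_vector) \<Rightarrow> point \<Rightarrow> 'b" where
  "along \<equiv> deriv_along M a"

lemma radius_pos: "p \<in> ext \<Longrightarrow> radius p > 0"
  using r_plus_pos[OF M_pos a_le] by (simp add: kerr_exterior_def)

text \<open>The exterior is the complement of an open ball times \<open>\<real>\<close>, so outward steps of any length stay in
  it.  For every direction either the vector or its negative is outward, which makes one-sided
  derivatives at the horizon unique and computable.\<close>

lemma outward_step:
  assumes p: "p \<in> ext" and v: "0 \<le> d_r p \<bullet> v"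
  shows "p + v \<in> ext"
proof -
  have r: "radius p > 0" by (rule radius_pos[OF p])
  have "d_r p \<bullet> v = (p$2 * v$2 + p$3 * v$3 + p$4 * v$4) / radius p"
    by (simp add: d_r_def inner_4 add_divide_distrib)
  then have "0 \<le> p$2 * v$2 + p$3 * v$3 + p$4 * v$4"
    using v r by (simp add: zero_le_divide_iff)
  moreover have "(p$2 + v$2)\<^sup>2 + (p$3 + v$3)\<^sup>2 + (p$4 + v$4)\<^sup>2
    = ((p$2)\<^sup>2 + (p$3)\<^sup>2 + (p$4)\<^sup>2) + 2 * (p$2 * v$2 + p$3 * v$3 + p$4 * v$4)
      + ((v$2)\<^sup>2 + (v$3)\<^sup>2 + (v$4)\<^sup>2)"
    by algebra
  ultimately have "radius p \<le> radius (p + v)"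
    unfolding radius_def vector_add_component
    by (intro real_sqrt_le_mono)
      (smt (verit) zero_le_power2)
  then show ?thesis
    using p by (simp add: kerr_exterior_def)
qed

lemma along_unique:
  assumes p: "p \<in> ext" and f: "(f has_derivative f') (at p within ext)"
  shows "along X f p = f' X"
proof -
  have "frechet_derivative f (at p within ext) = f'"
  proof (rule frechet_derivative_unique_within)
    show "(f has_derivative frechet_derivative f (at p within ext)) (at p within ext)"
      using f by (meson differentiableI frechet_derivative_works)
    show "(f has_derivative f') (at p within ext)" by (rule f)
    fix i :: "real^4" and e :: real
    assume "e > 0"
    \<comment> \<open>the sign makes the step outward\<close>
    define d where "d = (if 0 \<le> d_r p \<bullet> i then e/2 else - e/2)"
    have "0 \<le> d_r p \<bullet> (d *\<^sub>R i)"
      using \<open>e > 0\<close> by (auto simp: d_def mult_nonneg_nonneg mult_nonneg_nonpos)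
    then have "p + d *\<^sub>R i \<in> ext"
      by (rule outward_step[OF p])
    moreover have "0 < \<bar>d\<bar>" "\<bar>d\<bar> < e"
      using \<open>e > 0\<close> by (auto simp: d_def)
    ultimately show "\<exists>d. 0 < \<bar>d\<bar> \<and> \<bar>d\<bar> < e \<and> p + d *\<^sub>R i \<in> ext"
      by blast
  qed
  then show ?thesis
    by (simp add: deriv_along_def)
qed

lemma along_works:
  "f differentiable (at p within ext) \<Longrightarrow>
     (f has_derivative (\<lambda>X. along X f p)) (at p within ext)"
  unfolding deriv_along_def by (simp add: frechet_derivative_works)

lemma along_cong:
  assumes p: "p \<in> ext" and eq: "\<And>q. q \<in> ext \<Longrightarrow> f q = g q"
  shows "along X f p = along X g p"
proof -
  have "(f has_derivative F) (at p within ext) \<longleftrightarrow> (g has_derivative F) (at p within ext)" for F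
    using has_derivative_transform[OF p, of f g] has_derivative_transform[OF p, of g f] eq by metis
  then show ?thesis
    by (simp add: deriv_along_def frechet_derivative_def)
qed

lemma differentiable_cong_ext:
  assumes p: "p \<in> ext" and eq: "\<And>q. q \<in> ext \<Longrightarrow> f q = g q"
    and f: "f differentiable (at p within ext)"
  shows "g differentiable (at p within ext)"
  using f p eq unfolding differentiable_def by (metis has_derivative_transform)

lemma along_linear:
  assumes "f differentiable (at p within ext)"
  shows "along (X + Y) f p = along X f p + along Y f p"
    "along (c *\<^sub>R X) f p = c *\<^sub>R along X f p"
    "along (- X) f p = - along X f p"
    "along (X - Y) f p = along X f p - along Y f p"
    "along 0 f p = 0"
proof -
  interpret bounded_linear "\<lambda>X. along X f p"
    using along_works[OF assms] by (rule has_derivative_bounded_linear)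
  show "along (X + Y) f p = along X f p + along Y f p"
    "along (c *\<^sub>R X) f p = c *\<^sub>R along X f p"
    "along (- X) f p = - along X f p"
    "along (X - Y) f p = along X f p - along Y f p"
    "along 0 f p = 0"
    by (rule add scaleR neg diff zero)+
qed

lemma along_sum_axis:
  assumes "f differentiable (at p within ext)"
  shows "along X f p = (\<Sum>i\<in>UNIV. X $ i *\<^sub>R along (axis i 1) f p)"
proof -
  interpret bounded_linear "\<lambda>X. along X f p"
    using along_works[OF assms] by (rule has_derivative_bounded_linear)
  have "along X f p = along (\<Sum>i\<in>UNIV. X $ i *\<^sub>R axis i 1) f p"
    using basis_expansion[of X] by (simp add: scalar_mult_eq_scaleR)
  then show ?thesis
    by (simp add: sum scaleR)
qed

lemma along_scaleR:
  assumes "p \<in> ext" "f differentiable (at p within ext)" "g differentiable (at p within ext)"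
  shows "along X (\<lambda>q. f q *\<^sub>R g q) p = f p *\<^sub>R along X g p + along X f p *\<^sub>R g p"
  by (rule along_unique[OF assms(1)])
    (rule has_derivative_scaleR[OF along_works[OF assms(2)] along_works[OF assms(3)]])

lemma along_mult:
  fixes f g :: "point \<Rightarrow> real"
  assumes "p \<in> ext" "f differentiable (at p within ext)" "g differentiable (at p within ext)"
  shows "along X (\<lambda>q. f q * g q) p = f p * along X g p + along X f p * g p"
  using along_scaleR[OF assms] by simp

lemma along_add:
  assumes "p \<in> ext" "f differentiable (at p within ext)" "g differentiable (at p within ext)"
  shows "along X (\<lambda>q. f q + g q) p = along X f p + along X g p"
  by (rule along_unique[OF assms(1)])
    (rule has_derivative_add[OF along_works[OF assms(2)] along_works[OF assms(3)]])

lemma along_minus: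
  assumes "p \<in> ext" "f differentiable (at p within ext)"
  shows "along X (\<lambda>q. - f q) p = - along X f p"
  by (rule along_unique[OF assms(1)]) (rule has_derivative_minus[OF along_works[OF assms(2)]])

lemma along_diff:
  assumes "p \<in> ext" "f differentiable (at p within ext)" "g differentiable (at p within ext)"
  shows "along X (\<lambda>q. f q - g q) p = along X f p - along X g p"
  by (rule along_unique[OF assms(1)])
    (rule has_derivative_diff[OF along_works[OF assms(2)] along_works[OF assms(3)]])

lemma along_inner:
  fixes f g :: "point \<Rightarrow> real^4"
  assumes "p \<in> ext" "f differentiable (at p within ext)" "g differentiable (at p within ext)"
  shows "along X (\<lambda>q. f q \<bullet> g q) p = f p \<bullet> along X g p + along X f p \<bullet> g p"
  by (rule along_unique[OF assms(1)])
    (rule has_derivative_inner[OF along_works[OF assms(2)] along_works[OF assms(3)]])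

lemma along_const: "p \<in> ext \<Longrightarrow> along X (\<lambda>q. c) p = 0"
  by (rule along_unique) (auto intro: derivative_eq_intros)

subsection \<open>Symmetry of second derivatives up to the horizon\<close>

definition second :: "(point \<Rightarrow> real) \<Rightarrow> tvec \<Rightarrow> tvec \<Rightarrow> point \<Rightarrow> real" where
  "second u v w p = along w (along v u) p"

lemma Ck2:
  assumes "Ck_on 2 (u :: point \<Rightarrow> real) ext" "p \<in> ext"
  shows "u differentiable (at p within ext)" "along v u differentiable (at p within ext)"
    "continuous_on ext (second u v w)"
proof -
  have D: "along v u = (\<lambda>x. frechet_derivative u (at x within ext) v)"
    "second u v w = (\<lambda>x. frechet_derivative (along v u) (at x within ext) w)" for v w
    by (auto simp: deriv_along_def second_def fun_eq_iff)
  show "u differentiable (at p within ext)" "along v u differentiable (at p within ext)"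
    "continuous_on ext (second u v w)"
    using assms unfolding D(2) unfolding D(1) numeral_2_eq_2 by (auto simp: differentiable_on_def)
qed

text \<open>A second difference quotient over a square with corner \<open>p\<close> is a value of the second
  derivative, by two applications of the mean value theorem.  If both edges point outwards, the
  square stays in the exterior even when \<open>p\<close> lies on the horizon.\<close>

lemma second_difference:
  assumes u: "Ck_on 2 (u :: point \<Rightarrow> real) ext" and p: "p \<in> ext"
    and v: "0 \<le> d_r p \<bullet> v" and w: "0 \<le> d_r p \<bullet> w" and h: "h > 0"
  obtains s t where "0 \<le> s" "s \<le> h" "0 \<le> t" "t \<le> h"
    "u (p + h *\<^sub>R v + h *\<^sub>R w) - u (p + h *\<^sub>R v) - u (p + h *\<^sub>R w) + u p
      = h * h * second u v w (p + s *\<^sub>R v + t *\<^sub>R w)"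
proof -
  have mem: "p + s *\<^sub>R v + t *\<^sub>R w \<in> ext" if "0 \<le> s" "0 \<le> t" for s t
    using outward_step[OF p, of "s *\<^sub>R v + t *\<^sub>R w"] that v w
    by (simp add: inner_add_right add.assoc)
  have curve_v: "((\<lambda>s. f (p + s *\<^sub>R v + t *\<^sub>R w)) has_derivative
        (\<lambda>x. x * along v f (p + s *\<^sub>R v + t *\<^sub>R w))) (at s within {0..h})"
    if f: "\<And>q. q \<in> ext \<Longrightarrow> f differentiable (at q within ext)" and st: "0 \<le> s" "0 \<le> t"
    for f :: "point \<Rightarrow> real" and s t
  proof -
    let ?q = "p + s *\<^sub>R v + t *\<^sub>R w"
    have f': "(f has_derivative (\<lambda>X. along X f ?q)) (at ?q within ext)"
      by (rule along_works[OF f[OF mem[OF st]]])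
    have "((f \<circ> (\<lambda>s. p + s *\<^sub>R v + t *\<^sub>R w)) has_derivative
        ((\<lambda>X. along X f ?q) \<circ> (\<lambda>x. x *\<^sub>R v))) (at s within {0..h})"
    proof (rule diff_chain_within)
      show "((\<lambda>s. p + s *\<^sub>R v + t *\<^sub>R w) has_derivative (\<lambda>x. x *\<^sub>R v)) (at s within {0..h})"
        by (auto intro!: derivative_eq_intros)
      show "(f has_derivative (\<lambda>X. along X f ?q))
          (at ?q within (\<lambda>s. p + s *\<^sub>R v + t *\<^sub>R w) ` {0..h})"
        by (rule has_derivative_subset[OF f']) (use mem st in auto)
    qed
    then show ?thesis
      by (simp add: o_def along_linear[OF f[OF mem[OF st]]])
  qed
  have curve_w: "((\<lambda>t. f (p + s *\<^sub>R v + t *\<^sub>R w)) has_derivative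
        (\<lambda>x. x * along w f (p + s *\<^sub>R v + t *\<^sub>R w))) (at t within {0..h})"
    if f: "\<And>q. q \<in> ext \<Longrightarrow> f differentiable (at q within ext)" and st: "0 \<le> s" "0 \<le> t"
    for f :: "point \<Rightarrow> real" and s t
  proof -
    let ?q = "p + s *\<^sub>R v + t *\<^sub>R w"
    have f': "(f has_derivative (\<lambda>X. along X f ?q)) (at ?q within ext)"
      by (rule along_works[OF f[OF mem[OF st]]])
    have "((f \<circ> (\<lambda>t. p + s *\<^sub>R v + t *\<^sub>R w)) has_derivative
        ((\<lambda>X. along X f ?q) \<circ> (\<lambda>x. x *\<^sub>R w))) (at t within {0..h})"
    proof (rule diff_chain_within)
      show "((\<lambda>t. p + s *\<^sub>R v + t *\<^sub>R w) has_derivative (\<lambda>x. x *\<^sub>R w)) (at t within {0..h})"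
        by (auto intro!: derivative_eq_intros)
      show "(f has_derivative (\<lambda>X. along X f ?q))
          (at ?q within (\<lambda>t. p + s *\<^sub>R v + t *\<^sub>R w) ` {0..h})"
        by (rule has_derivative_subset[OF f']) (use mem st in auto)
    qed
    then show ?thesis
      by (simp add: o_def along_linear[OF f[OF mem[OF st]]])
  qed
  have ud: "\<And>q. q \<in> ext \<Longrightarrow> u differentiable (at q within ext)"
    and ud': "\<And>q. q \<in> ext \<Longrightarrow> along v u differentiable (at q within ext)"
    using Ck2[OF u] by auto
  define \<phi> where "\<phi> = (\<lambda>s. u (p + s *\<^sub>R v + h *\<^sub>R w) - u (p + s *\<^sub>R v + 0 *\<^sub>R w))"
  have "\<exists>s\<in>{0<..<h}. \<phi> h - \<phi> 0
      = (h - 0) * along v u (p + s *\<^sub>R v + h *\<^sub>R w) - (h - 0) * along v u (p + s *\<^sub>R v + 0 *\<^sub>R w)"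
    unfolding \<phi>_def
    by (rule mvt_simple[OF h]) (intro has_derivative_diff curve_v ud, use h in auto)
  then obtain s where s: "0 < s" "s < h" "\<phi> h - \<phi> 0
      = h * (along v u (p + s *\<^sub>R v + h *\<^sub>R w) - along v u (p + s *\<^sub>R v + 0 *\<^sub>R w))"
    by (auto simp: algebra_simps)
  have "\<exists>t\<in>{0<..<h}. along v u (p + s *\<^sub>R v + h *\<^sub>R w) - along v u (p + s *\<^sub>R v + 0 *\<^sub>R w)
      = (h - 0) * along w (along v u) (p + s *\<^sub>R v + t *\<^sub>R w)"
    by (rule mvt_simple[OF h]) (intro curve_w ud', use s in auto)
  then obtain t where t: "0 < t" "t < h"
    "along v u (p + s *\<^sub>R v + h *\<^sub>R w) - along v u (p + s *\<^sub>R v + 0 *\<^sub>R w)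
      = h * second u v w (p + s *\<^sub>R v + t *\<^sub>R w)"
    by (auto simp: second_def)
  show ?thesis
  proof (rule that[of s t])
    show "u (p + h *\<^sub>R v + h *\<^sub>R w) - u (p + h *\<^sub>R v) - u (p + h *\<^sub>R w) + u p
      = h * h * second u v w (p + s *\<^sub>R v + t *\<^sub>R w)"
      using s(3) unfolding t(3) by (simp add: \<phi>_def)
  qed (use s t in auto)
qed

lemma second_symmetric_outward:
  assumes u: "Ck_on 2 (u :: point \<Rightarrow> real) ext" and p: "p \<in> ext"
    and v: "0 \<le> d_r p \<bullet> v" and w: "0 \<le> d_r p \<bullet> w"
  shows "second u v w p = second u w v p"
proof -
  define h where "h = (\<lambda>n. 1 / real (Suc n))"
  have h: "h n > 0" for n by (simp add: h_def)
  have h0: "h \<longlonglongrightarrow> 0"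
    unfolding h_def by (rule LIMSEQ_Suc[OF lim_1_over_n])
  have "\<exists>z z'. fst z \<in> {0..h n} \<and> snd z \<in> {0..h n} \<and> fst z' \<in> {0..h n} \<and> snd z' \<in> {0..h n}
      \<and> second u v w (p + fst z *\<^sub>R v + snd z *\<^sub>R w)
        = second u w v (p + fst z' *\<^sub>R v + snd z' *\<^sub>R w)" for n
  proof -
    obtain s t where st: "0 \<le> s" "s \<le> h n" "0 \<le> t" "t \<le> h n"
      "u (p + h n *\<^sub>R v + h n *\<^sub>R w) - u (p + h n *\<^sub>R v) - u (p + h n *\<^sub>R w) + u p
      = h n * h n * second u v w (p + s *\<^sub>R v + t *\<^sub>R w)"
      by (rule second_difference[OF u p v w h])
    obtain t' s' where st': "0 \<le> t'" "t' \<le> h n" "0 \<le> s'" "s' \<le> h n"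
      "u (p + h n *\<^sub>R w + h n *\<^sub>R v) - u (p + h n *\<^sub>R w) - u (p + h n *\<^sub>R v) + u p
      = h n * h n * second u w v (p + t' *\<^sub>R w + s' *\<^sub>R v)"
      by (rule second_difference[OF u p w v h])
    have "p + h n *\<^sub>R w + h n *\<^sub>R v = p + h n *\<^sub>R v + h n *\<^sub>R w"
      by simp
    then have "h n * h n * second u v w (p + s *\<^sub>R v + t *\<^sub>R w)
        = h n * h n * second u w v (p + t' *\<^sub>R w + s' *\<^sub>R v)"
      using st(5) st'(5) by (simp add: algebra_simps)
    then have "second u v w (p + s *\<^sub>R v + t *\<^sub>R w) = second u w v (p + s' *\<^sub>R v + t' *\<^sub>R w)"
      using h[of n] by (simp add: add.commute add.left_commute)
    with st st' show ?thesis
      by (intro exI[of _ "(s, t)"] exI[of _ "(s', t')"]) simp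
  qed
  then obtain z z' where
    b: "\<And>n. fst (z n) \<in> {0..h n} \<and> snd (z n) \<in> {0..h n}"
      "\<And>n. fst (z' n) \<in> {0..h n} \<and> snd (z' n) \<in> {0..h n}"
    and eq: "\<And>n. second u v w (p + fst (z n) *\<^sub>R v + snd (z n) *\<^sub>R w)
        = second u w v (p + fst (z' n) *\<^sub>R v + snd (z' n) *\<^sub>R w)"
    by metis
  have sq: "f \<longlonglongrightarrow> 0" if "\<And>n. f n \<in> {0..h n}" for f
    by (rule tendsto_sandwich[OF _ _ tendsto_const h0]) (use that in auto)
  have lim: "(\<lambda>n. second u v' w' (p + fst (y n) *\<^sub>R v + snd (y n) *\<^sub>R w)) \<longlonglongrightarrow> second u v' w' p"
    if y: "\<And>n. fst (y n) \<in> {0..h n} \<and> snd (y n) \<in> {0..h n}" for y v' w'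
  proof (rule continuous_on_tendsto_compose[OF Ck2(3)[OF u p] _ p])
    have "(\<lambda>n. p + fst (y n) *\<^sub>R v + snd (y n) *\<^sub>R w) \<longlonglongrightarrow> p + 0 *\<^sub>R v + 0 *\<^sub>R w"
      by (intro tendsto_intros sq) (use y in blast)+
    then show "(\<lambda>n. p + fst (y n) *\<^sub>R v + snd (y n) *\<^sub>R w) \<longlonglongrightarrow> p" by simp
    have "p + fst (y n) *\<^sub>R v + snd (y n) *\<^sub>R w \<in> ext" for n
      using outward_step[OF p, of "fst (y n) *\<^sub>R v + snd (y n) *\<^sub>R w"] y[of n] v w
      by (simp add: inner_add_right add.assoc)
    then show "\<forall>\<^sub>F n in sequentially. p + fst (y n) *\<^sub>R v + snd (y n) *\<^sub>R w \<in> ext"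
      by simp
  qed
  show ?thesis
    using lim[OF b(1), of v w] lim[OF b(2), of w v] unfolding eq by (rule LIMSEQ_unique)
qed

text \<open>Both sides are odd in each direction, so every direction may be replaced by an outward one.\<close>

lemma second_symmetric:
  assumes u: "Ck_on 2 (u :: point \<Rightarrow> real) ext" and p: "p \<in> ext"
  shows "second u v w p = second u w v p"
proof -
  have left: "second u (- v) w p = - second u v w p" for v w
  proof -
    have "second u (- v) w p = along w (\<lambda>q. - along v u q) p"
      unfolding second_def by (rule along_cong[OF p]) (simp add: along_linear Ck2[OF u])
    then show ?thesis
      by (simp add: second_def along_minus[OF p Ck2(2)[OF u p]])
  qed
  have right: "second u v (- w) p = - second u v w p" for v w
    by (simp add: second_def along_linear(3)[OF Ck2(2)[OF u p]])
  define c d where "c = (if 0 \<le> d_r p \<bullet> v then v else - v)" and "d = (if 0 \<le> d_r p \<bullet> w then w else - w)"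
  have "second u c d p = second u d c p"
    by (rule second_symmetric_outward[OF u p]) (auto simp: c_def d_def)
  then show ?thesis
    by (auto simp: c_def d_def left right split: if_splits)
qed

text \<open>The second-order part of \<open>X (Y u)\<close> is the Hessian of \<open>u\<close> on \<open>X\<close> and \<open>Y\<close>; its symmetry is the
  formula \<open>X (Y u) - Y (X u) = [X, Y] u\<close> in \<open>commutator\<close>.\<close>

lemma along_along:
  fixes u :: "point \<Rightarrow> real"
  assumes u: "Ck_on 2 u ext" and p: "p \<in> ext" and Y: "Y differentiable (at p within ext)"
  shows "(\<lambda>q. along (Y q) u q) differentiable (at p within ext)"
    "along X (\<lambda>q. along (Y q) u q) p
      = along (along X Y p) u p + (\<Sum>i\<in>UNIV. \<Sum>j\<in>UNIV. Y p $ i * X $ j * second u (axis i 1) (axis j 1) p)"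
proof -
  have Yi: "((\<lambda>q. Y q $ i) has_derivative (\<lambda>X. along X Y p $ i)) (at p within ext)" for i
    by (rule bounded_linear.has_derivative[OF bounded_linear_vec_nth along_works[OF Y]])
  have eq: "along (Y q) u q = (\<Sum>i\<in>UNIV. Y q $ i * along (axis i 1) u q)" if "q \<in> ext" for q
    using along_sum_axis[OF Ck2(1)[OF u that], of "Y q"] by simp
  have "((\<lambda>q. \<Sum>i\<in>UNIV. Y q $ i * along (axis i 1) u q) has_derivative
      (\<lambda>X. \<Sum>i\<in>UNIV. Y p $ i * along X (along (axis i 1) u) p + along X Y p $ i * along (axis i 1) u p))
      (at p within ext)"
    by (intro has_derivative_sum has_derivative_mult Yi along_works Ck2(2)[OF u p])
  then have D: "((\<lambda>q. along (Y q) u q) has_derivative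
      (\<lambda>X. \<Sum>i\<in>UNIV. Y p $ i * along X (along (axis i 1) u) p + along X Y p $ i * along (axis i 1) u p))
      (at p within ext)"
    by (rule has_derivative_transform[OF p eq, rotated])
  then show "(\<lambda>q. along (Y q) u q) differentiable (at p within ext)"
    by (rule differentiableI)
  have "along X (along (axis i 1) u) p = (\<Sum>j\<in>UNIV. X $ j * second u (axis i 1) (axis j 1) p)" for i
    using along_sum_axis[OF Ck2(2)[OF u p], of X "axis i 1"] by (simp add: second_def)
  then show "along X (\<lambda>q. along (Y q) u q) p
      = along (along X Y p) u p + (\<Sum>i\<in>UNIV. \<Sum>j\<in>UNIV. Y p $ i * X $ j * second u (axis i 1) (axis j 1) p)"
    unfolding along_unique[OF p D]
    using along_sum_axis[OF Ck2(1)[OF u p], of "along X Y p"]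
    by (simp add: sum.distrib sum_distrib_left mult.assoc)
qed

lemma commutator:
  fixes u :: "point \<Rightarrow> real"
  assumes u: "Ck_on 2 u ext" and p: "p \<in> ext"
    and X: "X differentiable (at p within ext)" and Y: "Y differentiable (at p within ext)"
  shows "along (X p) (\<lambda>q. along (Y q) u q) p - along (along (X p) Y p) u p
    = along (Y p) (\<lambda>q. along (X q) u q) p - along (along (Y p) X p) u p"
proof -
  have "(\<Sum>i\<in>UNIV. \<Sum>j\<in>UNIV. Y p $ i * X p $ j * second u (axis i 1) (axis j 1) p)
      = (\<Sum>j\<in>UNIV. \<Sum>i\<in>UNIV. Y p $ i * X p $ j * second u (axis i 1) (axis j 1) p)"
    by (rule sum.swap)
  also have "\<dots> = (\<Sum>j\<in>UNIV. \<Sum>i\<in>UNIV. X p $ j * Y p $ i * second u (axis j 1) (axis i 1) p)"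
  proof (intro sum.cong refl)
    fix i j :: 4
    show "Y p $ i * X p $ j * second u (axis i 1) (axis j 1) p
        = X p $ j * Y p $ i * second u (axis j 1) (axis i 1) p"
      using second_symmetric[OF u p, of "axis i 1" "axis j 1"] by simp
  qed
  finally show ?thesis
    unfolding along_along(2)[OF u p X] along_along(2)[OF u p Y] by simp
qed

end

section \<open>Coordinate fields and forms\<close>

definition spatial :: "tvec \<Rightarrow> tvec" where
  "spatial v = v - v $ 1 *\<^sub>R axis 1 1"

definition rotz :: "tvec \<Rightarrow> tvec" where
  "rotz v = vector [0, - (v $ 3), v $ 2, 0]"

lemma spatial_nth [simp]:
  "spatial v $ 1 = 0" "spatial v $ 2 = v $ 2" "spatial v $ 3 = v $ 3" "spatial v $ 4 = v $ 4"
  by (simp_all add: spatial_def)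

lemma rotz_nth [simp]:
  "rotz v $ 1 = 0" "rotz v $ 2 = - (v $ 3)" "rotz v $ 3 = v $ 2" "rotz v $ 4 = 0"
  by (simp_all add: rotz_def)

lemma bounded_linear_spatial: "bounded_linear spatial"
  unfolding linear_conv_bounded_linear[symmetric] by (rule linearI) (simp_all add: vec_eq_iff forall_4)

lemma bounded_linear_rotz: "bounded_linear rotz"
  unfolding linear_conv_bounded_linear[symmetric] by (rule linearI) (simp_all add: vec_eq_iff forall_4)

lemmas spatial_has_derivative = bounded_linear_imp_has_derivative[OF bounded_linear_spatial]
lemmas rotz_has_derivative = bounded_linear_imp_has_derivative[OF bounded_linear_rotz]

lemma d_r_eq: "d_r p = (1 / radius p) *\<^sub>R spatial p"
  by (simp add: d_r_def vec_eq_iff forall_4)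

lemma del_r_eq: "del_r p = d_r p"
  by (simp add: d_r_def del_r_def)

lemma del_phi_eq: "del_phi p = rotz p"
  by (simp add: del_phi_def rotz_def)

lemma sin2_d_phi_eq: "sin2_d_phi p = (1 / (radius p)\<^sup>2) *\<^sub>R rotz p"
  by (simp add: sin2_d_phi_def rotz_def)

text \<open>In terms of the radius and the unit radial vector, vector identities at a point become polynomial
  identities subject to one relation.\<close>

lemma polar:
  assumes r: "radius p > 0"
  shows "p $ 2 = radius p * d_r p $ 2" "p $ 3 = radius p * d_r p $ 3" "p $ 4 = radius p * d_r p $ 4"
    "d_r p $ 1 = 0" "cos_theta p = d_r p $ 4"
    "(d_r p $ 2)\<^sup>2 + (d_r p $ 3)\<^sup>2 + (d_r p $ 4)\<^sup>2 = 1"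
    "(sin_theta p)\<^sup>2 = 1 - (d_r p $ 4)\<^sup>2"
proof -
  have s: "(p $ 2)\<^sup>2 + (p $ 3)\<^sup>2 + (p $ 4)\<^sup>2 = (radius p)\<^sup>2"
    by (simp add: radius_def)
  show "p $ 2 = radius p * d_r p $ 2" "p $ 3 = radius p * d_r p $ 3" "p $ 4 = radius p * d_r p $ 4"
    "d_r p $ 1 = 0" "cos_theta p = d_r p $ 4"
    using r by (simp_all add: d_r_eq cos_theta_def)
  show *: "(d_r p $ 2)\<^sup>2 + (d_r p $ 3)\<^sup>2 + (d_r p $ 4)\<^sup>2 = 1"
    using r s by (simp add: d_r_eq power_divide flip: add_divide_distrib)
  have "(sin_theta p)\<^sup>2 = (d_r p $ 2)\<^sup>2 + (d_r p $ 3)\<^sup>2"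
    using r by (simp add: d_r_eq sin_theta_def power_divide add_divide_distrib)
  then show "(sin_theta p)\<^sup>2 = 1 - (d_r p $ 4)\<^sup>2"
    using * by linarith
qed

lemma forms_polar:
  assumes r: "radius p > 0"
  shows "sin2_d_phi p = (1 / radius p) *\<^sub>R rotz (d_r p)"
    "del_phi p = radius p *\<^sub>R rotz (d_r p)"
    "d_cos_theta p = (1 / radius p) *\<^sub>R (axis 4 1 - d_r p $ 4 *\<^sub>R d_r p)"
  using r polar[OF r]
  by (simp_all add: vec_eq_iff forall_4 sin2_d_phi_eq del_phi_eq d_cos_theta_def power2_eq_square)

lemma Sig_pos: "radius p > 0 \<Longrightarrow> Sig a p > 0"
  by (simp add: Sig_def add_pos_nonneg)

subsection \<open>Their derivatives\<close>

lemma radius_has_derivative: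
  assumes r: "radius p > 0"
  shows "(radius has_derivative (\<lambda>v. d_r p \<bullet> v)) (at p within S)"
proof -
  have 0: "0 < (p $ 2)\<^sup>2 + (p $ 3)\<^sup>2 + (p $ 4)\<^sup>2"
    using r by (simp add: radius_def)
  show ?thesis
    unfolding radius_def[abs_def]
    apply (rule derivative_eq_intros bounded_linear.has_derivative[OF bounded_linear_vec_nth] has_derivative_ident refl 0)+
    using 0 by (auto simp: d_r_eq inner_4 radius_def divide_simps)
qed

lemma d_r_has_derivative:
  assumes r: "radius p > 0"
  shows "(d_r has_derivative (\<lambda>v. (1 / radius p) *\<^sub>R (spatial v - (d_r p \<bullet> v) *\<^sub>R d_r p))) (at p within S)"
  unfolding d_r_eq[abs_def]
  by (rule derivative_eq_intros radius_has_derivative spatial_has_derivative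
      has_derivative_ident refl r)+
    (use r in \<open>auto simp: spatial_has_derivative d_r_eq vec_eq_iff forall_4 field_simps power2_eq_square\<close>)

lemma cos_theta_has_derivative:
  assumes r: "radius p > 0"
  shows "(cos_theta has_derivative (\<lambda>v. d_cos_theta p \<bullet> v)) (at p within S)"
  unfolding cos_theta_def[abs_def]
  by (rule derivative_eq_intros radius_has_derivative bounded_linear.has_derivative[OF bounded_linear_vec_nth]
      has_derivative_ident refl r)+
    (use r in \<open>auto simp: d_cos_theta_def cos_theta_def inner_4 field_simps power2_eq_square\<close>)

lemma sin2_d_phi_has_derivative:
  assumes r: "radius p > 0"
  shows "(sin2_d_phi has_derivative
      (\<lambda>v. (1 / (radius p)\<^sup>2) *\<^sub>R rotz v - (2 * (d_r p \<bullet> v) / radius p) *\<^sub>R sin2_d_phi p)) (at p within S)"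
  unfolding sin2_d_phi_eq[abs_def]
  by (rule derivative_eq_intros radius_has_derivative rotz_has_derivative
      has_derivative_ident refl r)+
    (use r in \<open>auto simp: rotz_has_derivative vec_eq_iff forall_4 field_simps power2_eq_square\<close>)

lemma del_phi_has_derivative: "(del_phi has_derivative rotz) (at p within S)"
  unfolding del_phi_eq[abs_def]
  by (rule rotz_has_derivative)

lemma d_cos_theta_has_derivative:
  assumes r: "radius p > 0"
  shows "(d_cos_theta has_derivative (\<lambda>v. - ((d_r p \<bullet> v) / radius p) *\<^sub>R d_cos_theta p
      - (1 / radius p) *\<^sub>R ((d_cos_theta p \<bullet> v) *\<^sub>R d_r p
        + (cos_theta p / radius p) *\<^sub>R (spatial v - (d_r p \<bullet> v) *\<^sub>R d_r p)))) (at p within S)"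
proof -
  have inv: "((\<lambda>q. 1 / radius q) has_derivative (\<lambda>v. - (d_r p \<bullet> v) / (radius p)\<^sup>2)) (at p within S)"
    by (rule derivative_eq_intros radius_has_derivative refl r)+
      (use r in \<open>auto simp: power2_eq_square\<close>)
  note d = has_derivative_scaleR[OF inv has_derivative_diff[OF has_derivative_const[of "axis 4 1"]
    has_derivative_scaleR[OF cos_theta_has_derivative[OF r] d_r_has_derivative[OF r]]]]
  show ?thesis
    unfolding d_cos_theta_def[abs_def]
    by (rule has_derivative_eq_rhs[OF d])
      (use r in \<open>auto simp: d_cos_theta_def vec_eq_iff field_simps power2_eq_square\<close>)
qed

lemma Sig_has_derivative:
  assumes r: "radius p > 0"
  shows "(Sig a has_derivative
      (\<lambda>v. 2 * radius p * (d_r p \<bullet> v) + 2 * a\<^sup>2 * cos_theta p * (d_cos_theta p \<bullet> v))) (at p within S)"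
  unfolding Sig_def[abs_def]
  by (rule derivative_eq_intros radius_has_derivative cos_theta_has_derivative refl r)+ auto

text \<open>The vectors of the distribution are the vectors tangent to the spheres, lifted by a multiple
  of \<open>\<partial>\<^sub>t\<close>: the distribution is the common kernel of \<open>dr\<close> and \<open>tau\<close>.\<close>

definition tau :: "real \<Rightarrow> point \<Rightarrow> covec" where
  "tau a p = d_t - a *\<^sub>R sin2_d_phi p"

lemma tau_has_derivative:
  assumes r: "radius p > 0"
  shows "(tau a has_derivative
      (\<lambda>v. - a *\<^sub>R ((1 / (radius p)\<^sup>2) *\<^sub>R rotz v - (2 * (d_r p \<bullet> v) / radius p) *\<^sub>R sin2_d_phi p)))
    (at p within S)"
  unfolding tau_def[abs_def]
  by (rule derivative_eq_intros sin2_d_phi_has_derivative refl r)+ simp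

text \<open>The form that completes \<open>tau\<close> to a factorisation of the metric off the distribution: the metric is
  \<open>\<Sigma>\<close> times the round metric plus the symmetric product \<open>tau kap + kap tau\<close>, so that everything
  involving \<open>kap\<close> drops out on vectors killed by \<open>tau\<close>.\<close>

definition kap :: "real \<Rightarrow> real \<Rightarrow> point \<Rightarrow> covec" where
  "kap M a p = d_r p - (1/2) *\<^sub>R (d_t + a *\<^sub>R sin2_d_phi p) + (M * radius p / Sig a p) *\<^sub>R tau a p"

lemma kap_differentiable:
  assumes r: "radius p > 0"
  shows "kap M a differentiable (at p within S)"
proof -
  have "Sig a p \<noteq> 0" using Sig_pos[OF r, of a] by simp
  note d = radius_has_derivative[OF r, of S] Sig_has_derivative[OF r, of a S]
    d_r_has_derivative[OF r, of S] sin2_d_phi_has_derivative[OF r, of S] tau_has_derivative[OF r, of a S]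
  note d' = d[THEN differentiableI]
  show ?thesis
    unfolding kap_def[abs_def]
    by (intro differentiable_add differentiable_diff differentiable_scaleR differentiable_divide
        differentiable_mult differentiable_const d' \<open>Sig a p \<noteq> 0\<close>)
qed

lemma kerr_metric_eq:
  "kerr_metric M a p u v = Sig a p * round_metric p u v
    + (tau a p \<bullet> u) * (kap M a p \<bullet> v) + (kap M a p \<bullet> u) * (tau a p \<bullet> v)"
proof -
  define m where "m = M * radius p / Sig a p"
  have m: "2 * M * radius p / Sig a p = 2 * m" "2 * a * M * radius p / Sig a p = 2 * a * m"
    by (simp_all add: m_def)
  show ?thesis
    unfolding kerr_metric_def Let_def tau_def kap_def m m_def[symmetric]
    by (simp add: inner_add_left inner_diff_left field_simps power2_eq_square)
qed

section \<open>The distribution, its projection and its rotation\<close>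

text \<open>The projection onto the distribution along \<open>e3\<close> and \<open>e4\<close>, in a form in which it is visibly
  independent of the mass.\<close>

definition hpr :: "real \<Rightarrow> point \<Rightarrow> tvec \<Rightarrow> tvec" where
  "hpr a p v = v - (tau a p \<bullet> v) *\<^sub>R axis 1 1 - (d_r p \<bullet> v) *\<^sub>R d_r p
     - (a * (tau a p \<bullet> v) / Sig a p) *\<^sub>R (del_phi p + (a * (1 - (cos_theta p)\<^sup>2)) *\<^sub>R axis 1 1)"

text \<open>The other projection onto the distribution, along \<open>\<partial>\<^sub>t\<close> and \<open>\<partial>\<^sub>r\<close>.  On vectors tangent to the
  spheres it is the horizontal lift.\<close>

definition hlift :: "real \<Rightarrow> point \<Rightarrow> tvec \<Rightarrow> tvec" where
  "hlift a p v = spatial v - (d_r p \<bullet> v) *\<^sub>R d_r p + (a * (sin2_d_phi p \<bullet> v)) *\<^sub>R axis 1 1"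

text \<open>The quarter turn of the distribution: the cross product with the unit normal of the sphere, lifted
  by a multiple of \<open>\<partial>\<^sub>t\<close>.\<close>

definition rot :: "real \<Rightarrow> point \<Rightarrow> tvec \<Rightarrow> tvec" where
  "rot a p v = vector [- a * (d_cos_theta p \<bullet> v),
     d_r p $ 3 * v $ 4 - d_r p $ 4 * v $ 3, d_r p $ 4 * v $ 2 - d_r p $ 2 * v $ 4,
     d_r p $ 2 * v $ 3 - d_r p $ 3 * v $ 2]"

lemma linear_hpr: "linear (hpr a p)"
  unfolding hpr_def
  by (rule linearI) (simp_all add: inner_add_right algebra_simps add_divide_distrib)

lemma linear_rot: "linear (rot a p)"
  unfolding rot_def
  by (rule linearI) (simp_all add: vec_eq_iff forall_4 inner_add_right algebra_simps)

text \<open>Laplace expansion along the last two rows, which are the ones in the distribution below.\<close>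

lemma det_minors:
  "det (vector [x, y, u, v] :: real^4^4) =
    (x$1 * y$2 - x$2 * y$1) * (u$3 * v$4 - u$4 * v$3) - (x$1 * y$3 - x$3 * y$1) * (u$2 * v$4 - u$4 * v$2)
  + (x$1 * y$4 - x$4 * y$1) * (u$2 * v$3 - u$3 * v$2) + (x$2 * y$3 - x$3 * y$2) * (u$1 * v$4 - u$4 * v$1)
  - (x$2 * y$4 - x$4 * y$2) * (u$1 * v$3 - u$3 * v$1) + (x$3 * y$4 - x$4 * y$3) * (u$1 * v$2 - u$2 * v$1)"
  by (simp add: det_4 algebra_simps)

context kerr
begin

lemma covector_values:
  assumes p: "p \<in> ext"
  shows "d_r p \<bullet> d_r p = 1" "d_r p \<bullet> axis 1 1 = 0" "d_r p \<bullet> del_phi p = 0"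
    "sin2_d_phi p \<bullet> d_r p = 0" "sin2_d_phi p \<bullet> axis 1 1 = 0"
    "sin2_d_phi p \<bullet> del_phi p = 1 - (cos_theta p)\<^sup>2"
    "tau a p \<bullet> d_r p = 0" "tau a p \<bullet> axis 1 1 = 1"
    "tau a p \<bullet> del_phi p = - a * (1 - (cos_theta p)\<^sup>2)"
    "d_cos_theta p \<bullet> d_r p = 0" "d_cos_theta p \<bullet> axis 1 1 = 0" "d_cos_theta p \<bullet> del_phi p = 0"
proof -
  have r: "radius p > 0" by (rule radius_pos[OF p])
  note c = polar(6)[OF r]
  have c': "d_r p $ 2 * d_r p $ 2 + d_r p $ 3 * d_r p $ 3 + d_r p $ 4 * d_r p $ 4 = 1"
    using c by (simp add: power2_eq_square)
  have z: "d_r p $ 1 = 0" by (rule polar(4)[OF r])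
  show 1: "d_r p \<bullet> d_r p = 1" "d_r p \<bullet> axis 1 1 = 0" "d_r p \<bullet> del_phi p = 0"
    "sin2_d_phi p \<bullet> d_r p = 0" "sin2_d_phi p \<bullet> axis 1 1 = 0"
    using c' z r by (simp_all add: inner_4 forms_polar[OF r])
  have "sin2_d_phi p \<bullet> del_phi p = (d_r p $ 2)\<^sup>2 + (d_r p $ 3)\<^sup>2"
    using r by (simp add: inner_4 forms_polar[OF r] power2_eq_square)
  then show 2: "sin2_d_phi p \<bullet> del_phi p = 1 - (cos_theta p)\<^sup>2"
    using c polar(5)[OF r] by simp
  show "tau a p \<bullet> d_r p = 0" "tau a p \<bullet> axis 1 1 = 1"
    "tau a p \<bullet> del_phi p = - a * (1 - (cos_theta p)\<^sup>2)"
    unfolding tau_def inner_diff_left inner_scaleR_left 1 2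
    by (simp_all add: d_t_def inner_4 z del_phi_def)
  show "d_cos_theta p \<bullet> d_r p = 0" "d_cos_theta p \<bullet> axis 1 1 = 0" "d_cos_theta p \<bullet> del_phi p = 0"
    unfolding forms_polar(3)[OF r] inner_diff_left inner_scaleR_left 1
    by (simp_all add: inner_4 del_phi_def)
qed

lemma frame_values:
  assumes p: "p \<in> ext"
  shows "d_r p \<bullet> e3 p = - 1" "tau a p \<bullet> e3 p = 0" "sin2_d_phi p \<bullet> e3 p = 0" "d_cos_theta p \<bullet> e3 p = 0"
    "d_t \<bullet> e3 p = 0"
    "d_r p \<bullet> e4 M a p = Delta M a p / Sig a p" "tau a p \<bullet> e4 M a p = 2"
    "sin2_d_phi p \<bullet> e4 M a p = 2 * a * (1 - (cos_theta p)\<^sup>2) / Sig a p" "d_cos_theta p \<bullet> e4 M a p = 0"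
    "d_t \<bullet> e4 M a p = 2 * ((radius p)\<^sup>2 + a\<^sup>2) / Sig a p"
proof -
  have r: "radius p > 0" by (rule radius_pos[OF p])
  have S: "Sig a p \<noteq> 0" using Sig_pos[OF r, of a] by simp
  have t: "d_t \<bullet> d_r p = 0" "d_t \<bullet> axis 1 1 = 1" "d_t \<bullet> del_phi p = 0"
    by (simp_all add: d_t_def inner_4 polar(4)[OF r] del_phi_def)
  note v = covector_values[OF p] t
  show "d_r p \<bullet> e3 p = - 1" "tau a p \<bullet> e3 p = 0" "sin2_d_phi p \<bullet> e3 p = 0" "d_cos_theta p \<bullet> e3 p = 0"
    "d_t \<bullet> e3 p = 0"
    "d_r p \<bullet> e4 M a p = Delta M a p / Sig a p"
    "sin2_d_phi p \<bullet> e4 M a p = 2 * a * (1 - (cos_theta p)\<^sup>2) / Sig a p" "d_cos_theta p \<bullet> e4 M a p = 0"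
    "d_t \<bullet> e4 M a p = 2 * ((radius p)\<^sup>2 + a\<^sup>2) / Sig a p"
    unfolding e3_def e4_def del_r_eq del_t_def inner_add_right inner_scaleR_right inner_minus_right v
    by simp_all
  have "tau a p \<bullet> e4 M a p = (2 * ((radius p)\<^sup>2 + a\<^sup>2) - 2 * a * a * (1 - (cos_theta p)\<^sup>2)) / Sig a p"
    unfolding e4_def del_r_eq del_t_def inner_add_right inner_scaleR_right v
    by (simp add: diff_divide_distrib)
  also have "2 * ((radius p)\<^sup>2 + a\<^sup>2) - 2 * a * a * (1 - (cos_theta p)\<^sup>2) = 2 * Sig a p"
    by (simp add: Sig_def power2_eq_square algebra_simps)
  finally show "tau a p \<bullet> e4 M a p = 2"
    using S by simp
qed

lemma round_metric_eq:
  "round_metric p u v = (spatial u \<bullet> spatial v - (d_r p \<bullet> u) * (d_r p \<bullet> v)) / (radius p)\<^sup>2"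
  by (simp add: round_metric_def inner_4)

lemma metric_e3:
  assumes p: "p \<in> ext"
  shows "kerr_metric M a p v (e3 p) = - (tau a p \<bullet> v)"
proof -
  have r: "radius p > 0" by (rule radius_pos[OF p])
  have "spatial v \<bullet> spatial (e3 p) = - (d_r p \<bullet> v)"
    by (simp add: inner_4 e3_def del_r_eq polar(4)[OF r])
  then show ?thesis
    unfolding kerr_metric_eq round_metric_eq
    by (simp add: frame_values[OF p] kap_def inner_add_left inner_diff_left)
qed

lemma metric_e4:
  assumes p: "p \<in> ext"
  shows "kerr_metric M a p v (e4 M a p)
    = 2 * (d_r p \<bullet> v) - Delta M a p / Sig a p * (tau a p \<bullet> v)"
proof -
  have r: "radius p > 0" by (rule radius_pos[OF p])
  have S: "Sig a p \<noteq> 0" using Sig_pos[OF r, of a] by simp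
  have "spatial v \<bullet> spatial (e4 M a p)
      = Delta M a p / Sig a p * (d_r p \<bullet> v) + 2 * a / Sig a p * (radius p)\<^sup>2 * (sin2_d_phi p \<bullet> v)"
    unfolding e4_def del_r_eq del_t_def forms_polar[OF r] using r
    by (simp add: inner_4 polar(4)[OF r] algebra_simps power2_eq_square)
  then have rd: "round_metric p v (e4 M a p) = 2 * a / Sig a p * (sin2_d_phi p \<bullet> v)"
    unfolding round_metric_eq using r by (simp add: frame_values[OF p])
  have D: "Delta M a p = (radius p)\<^sup>2 + a\<^sup>2 - 2 * M * radius p"
    unfolding Delta_def by (rule Delta_r_eq[OF a_le])
  have \<Sigma>: "Sig a p = (radius p)\<^sup>2 + a\<^sup>2 * (cos_theta p)\<^sup>2"
    by (simp add: Sig_def)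
  have "Sig a p * (kap M a p \<bullet> e4 M a p) = Delta M a p - ((radius p)\<^sup>2 + a\<^sup>2)
      - a\<^sup>2 * (1 - (cos_theta p)\<^sup>2) + 2 * M * radius p"
    unfolding kap_def inner_add_left inner_diff_left inner_scaleR_left frame_values[OF p]
    using S by (simp add: field_simps power2_eq_square)
  also have "\<dots> = Sig a p - 2 * M * radius p - Delta M a p"
    unfolding D \<Sigma> by algebra
  finally have "kap M a p \<bullet> e4 M a p = (Sig a p - 2 * M * radius p - Delta M a p) / Sig a p"
    using S by (simp add: eq_divide_eq mult.commute)
  then have k: "kap M a p \<bullet> e4 M a p = 1 - 2 * M * radius p / Sig a p - Delta M a p / Sig a p"
    using S by (simp add: diff_divide_distrib)
  define m where "m = M * radius p / Sig a p"
  have t: "d_t \<bullet> v = tau a p \<bullet> v + a * (sin2_d_phi p \<bullet> v)"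
    by (simp add: tau_def inner_diff_left)
  have k': "2 * (kap M a p \<bullet> v)
      = 2 * (d_r p \<bullet> v) - (tau a p \<bullet> v) - 2 * a * (sin2_d_phi p \<bullet> v) + 2 * m * (tau a p \<bullet> v)"
    unfolding kap_def m_def[symmetric] by (simp add: inner_add_left inner_diff_left t field_simps)
  have "kerr_metric M a p v (e4 M a p) = 2 * a * (sin2_d_phi p \<bullet> v)
      + (tau a p \<bullet> v) * (1 - 2 * m - Delta M a p / Sig a p) + 2 * (kap M a p \<bullet> v)"
    unfolding kerr_metric_eq rd k frame_values[OF p] m_def using S by simp
  then show ?thesis
    unfolding k' by (simp add: algebra_simps)
qed

lemma horizontal_iff:
  assumes p: "p \<in> ext"
  shows "v \<in> horizontal M a p \<longleftrightarrow> d_r p \<bullet> v = 0 \<and> tau a p \<bullet> v = 0"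
  unfolding horizontal_def by (auto simp: metric_e3[OF p] metric_e4[OF p])

lemma metric_horizontal:
  assumes p: "p \<in> ext" and u: "u \<in> horizontal M a p"
    and v: "v \<in> horizontal M a p"
  shows "kerr_metric M a p u v = Sig a p / (radius p)\<^sup>2 * (spatial u \<bullet> spatial v)"
  using u v unfolding horizontal_iff[OF p] kerr_metric_eq round_metric_eq by simp

lemma metric_sym: "kerr_metric M a p u v = kerr_metric M a p v u"
  by (simp add: kerr_metric_def round_metric_def Let_def algebra_simps)

lemmas metric_bilinear = bilinear_ladd[OF bilinear_kerr_metric] bilinear_radd[OF bilinear_kerr_metric]
    bilinear_lmul[OF bilinear_kerr_metric] bilinear_rmul[OF bilinear_kerr_metric]
    bilinear_lsub[OF bilinear_kerr_metric] bilinear_rsub[OF bilinear_kerr_metric]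

lemma horizontal_nth1:
  assumes p: "p \<in> ext" and v: "v \<in> horizontal M a p"
  shows "v $ 1 = a * (sin2_d_phi p \<bullet> v)"
proof -
  have "d_t \<bullet> v = v $ 1" by (simp add: d_t_def inner_4)
  then show ?thesis using v by (simp add: horizontal_iff[OF p] tau_def inner_diff_left)
qed

text \<open>The \<open>\<partial>\<^sub>t\<close>-component of a horizontal vector is determined by the spatial ones.\<close>

lemma horizontal_eqI:
  assumes p: "p \<in> ext" and u: "u \<in> horizontal M a p" and v: "v \<in> horizontal M a p"
    and eq: "spatial u = spatial v"
  shows "u = v"
proof -
  have "sin2_d_phi p \<bullet> w = sin2_d_phi p \<bullet> spatial w" for w
    by (simp add: inner_4 sin2_d_phi_eq)
  then have "u $ 1 = v $ 1"
    unfolding horizontal_nth1[OF p u] horizontal_nth1[OF p v] using eq by metis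
  then show ?thesis
    using eq by (simp add: vec_eq_iff forall_4)
qed

lemma horizontal_subspace:
  assumes p: "p \<in> ext"
  shows "subspace (horizontal M a p)"
  by (auto simp: subspace_def horizontal_iff[OF p] inner_add_right)

lemma horizontal_definite:
  assumes p: "p \<in> ext" and v: "v \<in> horizontal M a p" and 0: "kerr_metric M a p v v = 0"
  shows "v = 0"
proof -
  have r: "radius p > 0" by (rule radius_pos[OF p])
  have "spatial v \<bullet> spatial v = 0"
    using 0 Sig_pos[OF r, of a] r unfolding metric_horizontal[OF p v v] by simp
  then have "spatial v = 0" by simp
  then have "v $ 2 = 0" "v $ 3 = 0" "v $ 4 = 0"
    unfolding vec_eq_iff forall_4 by simp_all
  moreover from this have "v $ 1 = 0"
    unfolding horizontal_nth1[OF p v] by (simp add: sin2_d_phi_def inner_4)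
  ultimately show ?thesis by (simp add: vec_eq_iff forall_4)
qed

lemma hpr_horizontal:
  assumes p: "p \<in> ext"
  shows "hpr a p v \<in> horizontal M a p"
  unfolding horizontal_iff[OF p] hpr_def
  by (simp add: inner_diff_right inner_add_right covector_values[OF p] algebra_simps diff_divide_distrib)

lemma hpr_split:
  assumes p: "p \<in> ext"
  shows "v = hpr a p v + ((tau a p \<bullet> v) / 2 * (Delta M a p / Sig a p) - d_r p \<bullet> v) *\<^sub>R e3 p
    + ((tau a p \<bullet> v) / 2) *\<^sub>R e4 M a p"
proof -
  have S: "Sig a p \<noteq> 0" using Sig_pos[OF radius_pos[OF p], of a] by simp
  define t where "t = tau a p \<bullet> v"
  have "(radius p)\<^sup>2 + a\<^sup>2 = Sig a p + a\<^sup>2 * (1 - (cos_theta p)\<^sup>2)"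
    by (simp add: Sig_def algebra_simps)
  then have e: "2 * ((radius p)\<^sup>2 + a\<^sup>2) / Sig a p = 2 + 2 * a\<^sup>2 * (1 - (cos_theta p)\<^sup>2) / Sig a p"
    using S by (simp add: field_simps)
  show ?thesis
    unfolding hpr_def e3_def e4_def e del_r_eq del_t_def t_def[symmetric] vec_eq_iff
    by (simp add: algebra_simps power2_eq_square add_divide_distrib diff_divide_distrib)
qed

lemma hpr_id:
  assumes p: "p \<in> ext" and v: "v \<in> horizontal M a p"
  shows "hpr a p v = v"
  using v unfolding horizontal_iff[OF p] hpr_def by simp

lemma hproj_eq:
  assumes p: "p \<in> ext"
  shows "hproj M a p v = hpr a p v"
  unfolding hproj_def
proof (rule the_equality)
  define A B where "A = (tau a p \<bullet> v) / 2 * (Delta M a p / Sig a p) - d_r p \<bullet> v"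
    and "B = (tau a p \<bullet> v) / 2"
  have *: "x - y = s + t" if "x = y + s + t" for x y s t :: tvec
    using that by simp
  have "v - hpr a p v = A *\<^sub>R e3 p + B *\<^sub>R e4 M a p"
    unfolding A_def B_def by (rule *[OF hpr_split[OF p]])
  moreover have "A *\<^sub>R e3 p + B *\<^sub>R e4 M a p \<in> span {e3 p, e4 M a p}"
    by (intro span_add span_scale span_base) auto
  ultimately show "hpr a p v \<in> horizontal M a p \<and> v - hpr a p v \<in> span {e3 p, e4 M a p}"
    using hpr_horizontal[OF p] by simp
next
  fix w assume w: "w \<in> horizontal M a p \<and> v - w \<in> span {e3 p, e4 M a p}"
  then obtain A B where "v - w - A *\<^sub>R e3 p = B *\<^sub>R e4 M a p"
    by (auto simp: span_insert)
  then have v: "v = w + A *\<^sub>R e3 p + B *\<^sub>R e4 M a p"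
    by (simp add: diff_eq_eq add_ac)
  have "tau a p \<bullet> v = 2 * B" "d_r p \<bullet> v = B * (Delta M a p / Sig a p) - A"
    using w unfolding v horizontal_iff[OF p] inner_add_right inner_scaleR_right frame_values[OF p]
    by simp_all
  then have "hpr a p v + A *\<^sub>R e3 p + B *\<^sub>R e4 M a p = v"
    by (subst (2) hpr_split[OF p, of v]) simp
  then show "w = hpr a p v"
    unfolding v by simp
qed

lemma hsharp_works:
  assumes p: "p \<in> ext"
  shows "hsharp M a p \<xi> \<in> horizontal M a p"
    "v \<in> horizontal M a p \<Longrightarrow> kerr_metric M a p (hsharp M a p \<xi>) v = \<xi> \<bullet> v"
proof -
  have r: "radius p > 0" by (rule radius_pos[OF p])
  have S: "Sig a p \<noteq> 0" using Sig_pos[OF r, of a] by simp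
  define \<zeta> where "\<zeta> = \<xi> + (a * \<xi> $ 1) *\<^sub>R sin2_d_phi p"
  define w where "w = ((radius p)\<^sup>2 / Sig a p) *\<^sub>R hlift a p \<zeta>"
  have l: "d_r p \<bullet> spatial v = d_r p \<bullet> v" "sin2_d_phi p \<bullet> spatial v = sin2_d_phi p \<bullet> v" for v
    by (simp_all add: inner_4 polar(4)[OF r] sin2_d_phi_def)
  have w: "w \<in> horizontal M a p"
    unfolding w_def hlift_def
    by (intro subspace_scale horizontal_subspace p)
      (simp add: horizontal_iff[OF p] inner_add_right inner_diff_right covector_values[OF p] l,
       simp add: tau_def inner_diff_left inner_diff_right covector_values[OF p] l d_t_def inner_4 polar(4)[OF r],
       simp add: sin2_d_phi_eq algebra_simps)
  have g: "kerr_metric M a p w v = \<xi> \<bullet> v" if v: "v \<in> horizontal M a p" for v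
  proof -
    have 0: "d_r p \<bullet> v = 0" using v by (simp add: horizontal_iff[OF p])
    have "kerr_metric M a p w v = spatial (hlift a p \<zeta>) \<bullet> spatial v"
      unfolding metric_horizontal[OF p w v] using r S
      by (simp add: w_def inner_4 field_simps)
    also have "\<dots> = spatial \<zeta> \<bullet> spatial v - (d_r p \<bullet> \<zeta>) * (d_r p \<bullet> v)"
      by (simp add: hlift_def inner_4 polar(4)[OF r] algebra_simps)
    also have "\<dots> = spatial \<xi> \<bullet> spatial v + \<xi> $ 1 * (a * (sin2_d_phi p \<bullet> v))"
      unfolding 0 by (simp add: \<zeta>_def inner_4 sin2_d_phi_def algebra_simps)
    also have "\<dots> = \<xi> \<bullet> v"
      unfolding horizontal_nth1[OF p v, symmetric] by (simp add: inner_4)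
    finally show ?thesis .
  qed
  have "hsharp M a p \<xi> = w"
    unfolding hsharp_def
  proof (rule the_equality)
    show "w \<in> horizontal M a p \<and> (\<forall>v\<in>horizontal M a p. kerr_metric M a p w v = \<xi> \<bullet> v)"
      using w g by blast
    fix u assume u: "u \<in> horizontal M a p \<and> (\<forall>v\<in>horizontal M a p. kerr_metric M a p u v = \<xi> \<bullet> v)"
    then have d: "u - w \<in> horizontal M a p"
      using w by (intro subspace_diff horizontal_subspace p) auto
    then have "kerr_metric M a p (u - w) (u - w) = 0"
      using u g by (subst metric_bilinear(5)) simp
    then show "u = w"
      using horizontal_definite[OF p d] by simp
  qed
  then show "hsharp M a p \<xi> \<in> horizontal M a p"
    "v \<in> horizontal M a p \<Longrightarrow> kerr_metric M a p (hsharp M a p \<xi>) v = \<xi> \<bullet> v"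
    using w g by auto
qed

lemma rot_horizontal:
  assumes p: "p \<in> ext"
  shows "rot a p v \<in> horizontal M a p"
proof -
  have r: "radius p > 0" by (rule radius_pos[OF p])
  note c = polar(6)[OF r]
  have "d_r p \<bullet> rot a p v = 0"
    by (simp add: rot_def inner_4 polar(4)[OF r] algebra_simps)
  moreover have "radius p * (tau a p \<bullet> rot a p v) = 0"
    unfolding tau_def rot_def forms_polar[OF r] using r polar(4)[OF r]
    apply (simp add: d_t_def inner_4 field_simps)
    using c apply algebra done
  ultimately show ?thesis
    using r by (simp add: horizontal_iff[OF p])
qed

lemma rot_rot:
  assumes p: "p \<in> ext" and v: "v \<in> horizontal M a p"
  shows "rot a p (rot a p v) = - v"
proof -
  have r: "radius p > 0" by (rule radius_pos[OF p])
  note c = polar(6)[OF r]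
  have o: "d_r p $ 2 * v $ 2 + d_r p $ 3 * v $ 3 + d_r p $ 4 * v $ 4 = 0"
    using v by (simp add: horizontal_iff[OF p] inner_4 polar(4)[OF r])
  have "rot a p (rot a p v) \<in> horizontal M a p" "- v \<in> horizontal M a p"
    using v by (auto intro: rot_horizontal p subspace_neg horizontal_subspace)
  moreover have "spatial (rot a p (rot a p v)) = spatial (- v)"
    unfolding rot_def vec_eq_iff forall_4 apply simp using c o by algebra
  ultimately show ?thesis
    by (rule horizontal_eqI[OF p])
qed

text \<open>The area form is the metric composed with the quarter turn.  The determinant is evaluated
  from the minors of the rows \<open>u\<close>, \<open>v\<close>, whose spatial parts have a radial cross product; the
  Gram determinant then supplies the volume density \<open>\<Sigma> / r\<^sup>2\<close>.\<close>

lemma harea_horizontal: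
  assumes p: "p \<in> ext" and u: "u \<in> horizontal M a p" and v: "v \<in> horizontal M a p"
  shows "harea M a p u v = kerr_metric M a p (rot a p u) v"
proof -
  define r S N2 N3 N4 where "r = radius p" and "S = Sig a p"
    and "N2 = d_r p $ 2" and "N3 = d_r p $ 3" and "N4 = d_r p $ 4"
  note N = N2_def[symmetric] N3_def[symmetric] N4_def[symmetric]
  have r: "r > 0" by (simp add: r_def radius_pos[OF p])
  note r' = r[unfolded r_def]
  have S: "S > 0" by (simp add: S_def Sig_pos[OF r'])
  have S_eq: "S = r\<^sup>2 + a\<^sup>2 * N4\<^sup>2"
    by (simp add: S_def Sig_def polar(5)[OF r'] r_def N)
  have c: "N2\<^sup>2 + N3\<^sup>2 + N4\<^sup>2 = 1" using polar(6)[OF r'] by (simp add: N)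
  have \<phi>: "sin2_d_phi p \<bullet> w = (N2 * w $ 3 - N3 * w $ 2) / r" for w
    unfolding forms_polar[OF r'] by (simp add: inner_4 N r_def diff_divide_distrib)
  have o: "N2 * w $ 2 + N3 * w $ 3 + N4 * w $ 4 = 0" "w $ 1 = a / r * (N2 * w $ 3 - N3 * w $ 2)"
    if "w \<in> horizontal M a p" for w
  proof -
    show "N2 * w $ 2 + N3 * w $ 3 + N4 * w $ 4 = 0"
      using that by (simp add: horizontal_iff[OF p] inner_4 polar(4)[OF r'] N)
    show "w $ 1 = a / r * (N2 * w $ 3 - N3 * w $ 2)"
      unfolding horizontal_nth1[OF p that] \<phi> by simp
  qed
  define y where "y = N2 * (u $ 3 * v $ 4 - u $ 4 * v $ 3) + N3 * (u $ 4 * v $ 2 - u $ 2 * v $ 4)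
      + N4 * (u $ 2 * v $ 3 - u $ 3 * v $ 2)"
  have g: "kerr_metric M a p (rot a p u) v = S / r\<^sup>2 * y"
    unfolding metric_horizontal[OF p rot_horizontal[OF p] v]
    by (simp add: inner_4 rot_def y_def N r_def S_def algebra_simps)
  have m: "u $ 3 * v $ 4 - u $ 4 * v $ 3 = y * N2" "u $ 4 * v $ 2 - u $ 2 * v $ 4 = y * N3"
    "u $ 2 * v $ 3 - u $ 3 * v $ 2 = y * N4"
    unfolding y_def using c o(1)[OF u] o(1)[OF v] by algebra+
  have m1: "u $ 1 * v $ 2 - v $ 1 * u $ 2 = - (a / r) * N2 * N4 * y"
    "u $ 1 * v $ 3 - v $ 1 * u $ 3 = - (a / r) * N3 * N4 * y"
    "u $ 1 * v $ 4 - v $ 1 * u $ 4 = (a / r) * (1 - N4\<^sup>2) * y"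
    unfolding o(2)[OF u] o(2)[OF v] using m c by algebra+
  define D where "D = Delta M a p"
  have e3: "e3 p $ 1 = 0" "e3 p $ 2 = - N2" "e3 p $ 3 = - N3" "e3 p $ 4 = - N4"
    by (simp_all add: e3_def del_r_eq N polar(4)[OF r'])
  have e4: "e4 M a p $ 1 = 2 * (r\<^sup>2 + a\<^sup>2) / S" "e4 M a p $ 2 = (D * N2 - 2 * a * r * N3) / S"
    "e4 M a p $ 3 = (D * N3 + 2 * a * r * N2) / S" "e4 M a p $ 4 = D * N4 / S"
    using polar[OF r'] by (simp_all add: e4_def del_r_eq del_t_def del_phi_def N D_def r_def S_def
      diff_divide_distrib add_divide_distrib)
  define F where "F = (vector [e3 p, e4 M a p, u, v] :: real^4^4)"
  have "det F = 2 * y"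
  proof -
    have x: "e3 p $ 2 * e4 M a p $ 3 - e3 p $ 3 * e4 M a p $ 2 = - (2 * a * r / S) * (N2\<^sup>2 + N3\<^sup>2)"
      "e3 p $ 2 * e4 M a p $ 4 - e3 p $ 4 * e4 M a p $ 2 = - (2 * a * r / S) * N3 * N4"
      "e3 p $ 3 * e4 M a p $ 4 - e3 p $ 4 * e4 M a p $ 3 = (2 * a * r / S) * N2 * N4"
      unfolding e3 e4 using S by (simp_all add: field_simps power2_eq_square)
    have m': "u $ 2 * v $ 4 - u $ 4 * v $ 2 = - (y * N3)"
      "u $ 1 * v $ 2 - u $ 2 * v $ 1 = - (a / r) * N2 * N4 * y"
      "u $ 1 * v $ 3 - u $ 3 * v $ 1 = - (a / r) * N3 * N4 * y"
      "u $ 1 * v $ 4 - u $ 4 * v $ 1 = (a / r) * (1 - N4\<^sup>2) * y"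
      using m(2) m1 by (simp_all add: mult.commute)
    define E where "E = 2 * (r\<^sup>2 + a\<^sup>2) / S"
    define k h where "k = 2 * a * r / S" and "h = a / r"
    have kh: "k * h = 2 * a\<^sup>2 / S"
      using r by (simp add: k_def h_def power2_eq_square)
    have "det F = E * y * (N2\<^sup>2 + N3\<^sup>2 + N4\<^sup>2)
        - k * h * y * ((N2\<^sup>2 + N3\<^sup>2) * (1 - N4\<^sup>2) + (N2\<^sup>2 + N3\<^sup>2) * N4\<^sup>2)"
      unfolding F_def det_minors m m' x
      unfolding e3 e4(1) E_def[symmetric] k_def[symmetric] h_def[symmetric]
      by algebra
    also have "\<dots> = y * (E - 2 * a\<^sup>2 / S * (1 - N4\<^sup>2))"
      unfolding kh[symmetric] using c by algebra
    also have "E - 2 * a\<^sup>2 / S * (1 - N4\<^sup>2) = 2 * S / S"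
      unfolding E_def S_eq by (simp add: algebra_simps flip: diff_divide_distrib)
    finally show ?thesis using S by simp
  qed
  define G where "G = metric_matrix M a p"
  have gram: "(F ** G ** transpose F) $ i $ j = kerr_metric M a p (F $ i) (F $ j)" for i j
    unfolding kerr_metric_matrix G_def[symmetric]
    by (simp add: matrix_matrix_mult_def transpose_def matrix_vector_mult_def inner_vec_def sum_4
        algebra_simps)
  have hor: "kerr_metric M a p w (e3 p) = 0" "kerr_metric M a p w (e4 M a p) = 0"
    "kerr_metric M a p (e3 p) w = 0" "kerr_metric M a p (e4 M a p) w = 0"
    if "w \<in> horizontal M a p" for w
    using that metric_sym by (auto simp: horizontal_def)
  have e: "kerr_metric M a p (e3 p) (e3 p) = 0" "kerr_metric M a p (e3 p) (e4 M a p) = - 2"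
    "kerr_metric M a p (e4 M a p) (e3 p) = - 2" "kerr_metric M a p (e4 M a p) (e4 M a p) = 0"
    unfolding metric_e3[OF p] metric_e4[OF p] frame_values[OF p] by simp_all
  have "(spatial u \<bullet> spatial u) * (spatial v \<bullet> spatial v) - (spatial u \<bullet> spatial v)\<^sup>2
      = (u $ 3 * v $ 4 - u $ 4 * v $ 3)\<^sup>2 + (u $ 4 * v $ 2 - u $ 2 * v $ 4)\<^sup>2
        + (u $ 2 * v $ 3 - u $ 3 * v $ 2)\<^sup>2"
    unfolding inner_4 spatial_nth by algebra
  also have "\<dots> = y\<^sup>2"
    unfolding m using c by algebra
  finally have L: "(spatial u \<bullet> spatial u) * (spatial v \<bullet> spatial v) - (spatial u \<bullet> spatial v)\<^sup>2 = y\<^sup>2" .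
  have "det (F ** G ** transpose F)
      = - 4 * (kerr_metric M a p u u * kerr_metric M a p v v - (kerr_metric M a p u v)\<^sup>2)"
    unfolding det_4 gram
    by (simp add: F_def e hor u v metric_sym[of p v u] power2_eq_square)
  also have "\<dots> = - 4 * (S / r\<^sup>2 * y)\<^sup>2"
    unfolding metric_horizontal[OF p u u] metric_horizontal[OF p v v] metric_horizontal[OF p u v]
      r_def[symmetric] S_def[symmetric] power_mult_distrib L[symmetric]
    by (simp add: algebra_simps power2_eq_square)
  finally have "det F * det G * det F = - 4 * (S / r\<^sup>2 * y)\<^sup>2"
    unfolding det_mul det_transpose .
  then have "(2 * y) * (det G * (2 * y)) = - 4 * (S / r\<^sup>2 * y)\<^sup>2"
    unfolding \<open>det F = 2 * y\<close> by (simp only: mult.assoc)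
  moreover have "y\<^sup>2 * (- d) = y\<^sup>2 * k\<^sup>2" if "(2 * y) * (d * (2 * y)) = - 4 * (k * y)\<^sup>2" for d k :: real
    using that by algebra
  ultimately have dG: "y\<^sup>2 * (- det G) = y\<^sup>2 * (S / r\<^sup>2)\<^sup>2"
    by blast
  have "sqrt (- det G) * y = S / r\<^sup>2 * y"
  proof (cases "y = 0")
    case False
    then have "- det G = (S / r\<^sup>2)\<^sup>2"
      using dG mult_left_cancel[of "y\<^sup>2" "- det G" "(S / r\<^sup>2)\<^sup>2"] by simp
    then have "sqrt (- det G) = S / r\<^sup>2"
      using S r by (simp only: real_sqrt_abs) simp
    then show ?thesis by simp
  qed simp
  then show ?thesis
    unfolding harea_def g F_def[symmetric] G_def[symmetric] \<open>det F = 2 * y\<close> by simp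
qed

text \<open>Adding multiples of the rows \<open>e3\<close>, \<open>e4\<close> leaves the determinant unchanged.\<close>

lemma harea_split:
  "harea M a p (u + A *\<^sub>R e3 p + B *\<^sub>R e4 M a p) w = harea M a p u w"
  unfolding harea_def by (simp add: det_4 algebra_simps)

text \<open>The duality operator is the transpose of the quarter turn and does not involve the metric any more,
  an expression of its conformal invariance.\<close>

lemma hstar_inner:
  assumes p: "p \<in> ext"
  shows "hstar M a p \<xi> \<bullet> v = \<xi> \<bullet> rot a p (hpr a p v)"
proof -
  have "harea M a p u (hsharp M a p \<xi>) = \<xi> \<bullet> rot a p (hpr a p u)" for u
  proof -
    have "harea M a p u (hsharp M a p \<xi>) = harea M a p (hpr a p u) (hsharp M a p \<xi>)"
      by (subst hpr_split[OF p, of u], rule harea_split)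
    then show ?thesis
      by (simp add: harea_horizontal p hpr_horizontal hsharp_works rot_horizontal
        metric_sym[of p _ "hsharp M a p \<xi>"])
  qed
  then have "hstar M a p \<xi> \<bullet> v = (\<Sum>i\<in>UNIV. v $ i * (\<xi> \<bullet> rot a p (hpr a p (axis i 1))))"
    by (simp add: hstar_def inner_vec_def mult.commute)
  also have "\<dots> = \<xi> \<bullet> rot a p (hpr a p (\<Sum>i\<in>UNIV. v $ i *\<^sub>R axis i 1))"
    by (simp add: linear_sum[OF linear_hpr] linear_sum[OF linear_rot] linear_cmul[OF linear_hpr]
      linear_cmul[OF linear_rot] inner_sum_right)
  also have "(\<Sum>i\<in>UNIV. v $ i *\<^sub>R axis i 1) = v"
    using basis_expansion[of v] by (simp add: scalar_mult_eq_scaleR)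
  finally show ?thesis .
qed

end

section \<open>The Levi-Civita connection and the horizontal derivative\<close>

lemma linear_expand:
  fixes f :: "real^4 \<Rightarrow> 'b::real_vector"
  assumes "linear f"
  shows "f v = (\<Sum>i\<in>UNIV. v $ i *\<^sub>R f (axis i 1))"
proof -
  have "f v = f (\<Sum>i\<in>UNIV. v $ i *\<^sub>R axis i 1)"
    using basis_expansion[of v] by (simp add: scalar_mult_eq_scaleR)
  then show ?thesis
    by (simp add: linear_sum[OF assms] linear_cmul[OF assms])
qed

lemma mult_matrix_inv: "invertible A \<Longrightarrow> A ** matrix_inv A = mat 1"
  unfolding invertible_def matrix_inv_def by (rule someI2_ex) auto

context kerr
begin

lemma differentiable_forms:
  assumes p: "p \<in> ext"
  shows "radius differentiable (at p within ext)" "d_r differentiable (at p within ext)"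
    "cos_theta differentiable (at p within ext)" "d_cos_theta differentiable (at p within ext)"
    "sin2_d_phi differentiable (at p within ext)" "del_phi differentiable (at p within ext)"
    "Sig a differentiable (at p within ext)" "tau a differentiable (at p within ext)"
    "kap M a differentiable (at p within ext)"
  by (rule radius_has_derivative[THEN differentiableI] d_r_has_derivative[THEN differentiableI]
      cos_theta_has_derivative[THEN differentiableI] d_cos_theta_has_derivative[THEN differentiableI]
      sin2_d_phi_has_derivative[THEN differentiableI] del_phi_has_derivative[THEN differentiableI]
      Sig_has_derivative[THEN differentiableI] tau_has_derivative[THEN differentiableI]
      kap_differentiable radius_pos[OF p])+

lemma nonzero:
  assumes p: "p \<in> ext"
  shows "radius p \<noteq> 0" "Sig a p \<noteq> 0"
  using radius_pos[OF p] Sig_pos[OF radius_pos[OF p], of a] by auto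

lemmas differentiable_rules = differentiable_add differentiable_diff differentiable_scaleR
  differentiable_mult differentiable_divide differentiable_const differentiable_inner
  differentiable_minus differentiable_power

definition dmetric :: "point \<Rightarrow> tvec \<Rightarrow> tvec \<Rightarrow> tvec \<Rightarrow> real" where
  "dmetric p W u v = along W (\<lambda>q. kerr_metric M a q u v) p"

lemma metric_differentiable:
  assumes p: "p \<in> ext"
  shows "(\<lambda>q. kerr_metric M a q u v) differentiable (at p within ext)"
proof -
  have "(radius p)\<^sup>2 \<noteq> 0" using nonzero[OF p] by simp
  then show ?thesis
    unfolding kerr_metric_eq round_metric_eq
    by (intro differentiable_rules differentiable_forms p)
qed

lemma dmetric_linear:
  assumes p: "p \<in> ext"
  shows "linear (\<lambda>W. dmetric p W u v)" "linear (\<lambda>u. dmetric p W u v)" "linear (\<lambda>v. dmetric p W u v)"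
proof -
  note d = metric_differentiable[OF p]
  show "linear (\<lambda>W. dmetric p W u v)"
    by (rule linearI) (simp_all add: dmetric_def along_linear d)
  have "(\<lambda>q. kerr_metric M a q (c *\<^sub>R x + y) v) = (\<lambda>q. c *\<^sub>R kerr_metric M a q x v + kerr_metric M a q y v)"
    for c x y v
    by (simp add: metric_bilinear)
  then have *: "dmetric p W (c *\<^sub>R x + y) v = c * dmetric p W x v + dmetric p W y v" for c x y v
    unfolding dmetric_def using p d
    by (simp add: along_add along_mult along_const differentiable_mult)
  have l: "linear f" if "\<And>c x y. f (c *\<^sub>R x + y) = c * f x + f y" for f :: "tvec \<Rightarrow> real"
  proof -
    have "f 0 = 0" using that[of 1 0 0] by simp
    then show ?thesis
      using that[of 1] that[of _ _ 0] by (intro linearI) simp_all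
  qed
  show 1: "linear (\<lambda>u. dmetric p W u v)" for v
    by (rule l) (rule *)
  have "dmetric p W u v = dmetric p W v u" for u v
    unfolding dmetric_def by (simp add: metric_sym)
  then have "(\<lambda>v. dmetric p W u v) = (\<lambda>v. dmetric p W v u)"
    by (rule ext)
  then show "linear (\<lambda>v. dmetric p W u v)"
    using 1 by simp
qed

lemma dmetric_sym: "dmetric p W u v = dmetric p W v u"
  unfolding dmetric_def by (simp add: metric_sym)

text \<open>A vector in the kernel is orthogonal to \<open>e3\<close> and \<open>e4\<close>, hence horizontal, and the metric is definite
  on the distribution.\<close>

lemma metric_matrix_invertible:
  assumes p: "p \<in> ext"
  shows "invertible (metric_matrix M a p)"
proof -
  have "v = 0" if 0: "metric_matrix M a p *v v = 0" for v
  proof -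
    have g: "kerr_metric M a p v u = 0" for u
      by (subst metric_sym) (simp add: kerr_metric_matrix 0)
    have "tau a p \<bullet> v = 0"
      using g[of "e3 p"] by (simp add: metric_e3[OF p])
    moreover from this have "d_r p \<bullet> v = 0"
      using g[of "e4 M a p"] by (simp add: metric_e4[OF p])
    ultimately have "v \<in> horizontal M a p"
      by (simp add: horizontal_iff[OF p])
    then show "v = 0"
      by (rule horizontal_definite[OF p _ g])
  qed
  then show ?thesis
    by (metis matrix_left_invertible_ker invertible_left_inverse)
qed

definition christoffel_term :: "point \<Rightarrow> tvec \<Rightarrow> tvec \<Rightarrow> tvec" where
  "christoffel_term p X Y = (\<chi> k. \<Sum>i\<in>UNIV. \<Sum>j\<in>UNIV. christoffel M a p k i j * X $ i * Y $ j)"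

lemma christoffel_term_linear: "linear (christoffel_term p X)" "linear (\<lambda>X. christoffel_term p X Y)"
  unfolding christoffel_term_def
  by (rule linearI; simp add: vec_eq_iff algebra_simps sum.distrib sum_distrib_left)+

lemma nabla_eq: "nabla M a X Y p = along X Y p + christoffel_term p X (Y p)"
  by (simp add: nabla_def christoffel_term_def)

text \<open>Lowering the index of the Christoffel symbols cancels the inverse matrix in their definition.\<close>

lemma koszul:
  assumes p: "p \<in> ext"
  shows "kerr_metric M a p (christoffel_term p X Y) Z = (dmetric p X Z Y + dmetric p Y Z X - dmetric p Z X Y) / 2"
proof -
  define G where "G = metric_matrix M a p"
  define s where "s = (\<chi> l. (dmetric p X (axis l 1) Y + dmetric p Y (axis l 1) X
    - dmetric p (axis l 1) X Y) / 2)"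
  have ch: "christoffel M a p k i j = (\<Sum>l\<in>UNIV. matrix_inv G $ k $ l *
      ((dmetric p (axis i 1) (axis l 1) (axis j 1) + dmetric p (axis j 1) (axis l 1) (axis i 1)
        - dmetric p (axis l 1) (axis i 1) (axis j 1)) / 2))" for k i j
    unfolding christoffel_def dmetric_def G_def metric_matrix_def by (simp add: sum_distrib_left)
  note lin = dmetric_linear[OF p]
  have ex1: "(\<Sum>i\<in>UNIV. \<Sum>j\<in>UNIV. X $ i * Y $ j * dmetric p (axis i 1) (axis l 1) (axis j 1))
      = dmetric p X (axis l 1) Y" for l X Y
    unfolding linear_expand[OF lin(1), of X "axis l 1" Y]
    unfolding linear_expand[OF lin(3), of _ "axis l 1" Y]
    by (simp add: sum_distrib_left mult.assoc)
  have ex2: "(\<Sum>i\<in>UNIV. \<Sum>j\<in>UNIV. X $ i * Y $ j * dmetric p (axis j 1) (axis l 1) (axis i 1))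
      = dmetric p Y (axis l 1) X" for l
    unfolding ex1[of Y X l, symmetric] by (subst sum.swap) (simp add: mult.commute)
  have ex3: "(\<Sum>i\<in>UNIV. \<Sum>j\<in>UNIV. X $ i * Y $ j * dmetric p (axis l 1) (axis i 1) (axis j 1))
      = dmetric p (axis l 1) X Y" for l
    unfolding linear_expand[OF lin(2), of "axis l 1" X Y]
    unfolding linear_expand[OF lin(3), of "axis l 1" _ Y]
    by (simp add: sum_distrib_left mult.assoc)
  note ex = ex1[of X Y] ex2 ex3
  have "christoffel_term p X Y $ k = (matrix_inv G *v s) $ k" for k
  proof -
    define T where "T = (\<lambda>l i j. (dmetric p (axis i 1) (axis l 1) (axis j 1)
        + dmetric p (axis j 1) (axis l 1) (axis i 1) - dmetric p (axis l 1) (axis i 1) (axis j 1)) / 2)"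
    have "christoffel_term p X Y $ k = (\<Sum>i\<in>UNIV. \<Sum>j\<in>UNIV. \<Sum>l\<in>UNIV. matrix_inv G $ k $ l * (X $ i * Y $ j * T l i j))"
      unfolding christoffel_term_def ch T_def by (simp add: sum_distrib_left sum_distrib_right mult_ac)
    also have "\<dots> = (\<Sum>i\<in>UNIV. \<Sum>l\<in>UNIV. \<Sum>j\<in>UNIV. matrix_inv G $ k $ l * (X $ i * Y $ j * T l i j))"
      by (intro sum.cong refl sum.swap)
    also have "\<dots> = (\<Sum>l\<in>UNIV. \<Sum>i\<in>UNIV. \<Sum>j\<in>UNIV. matrix_inv G $ k $ l * (X $ i * Y $ j * T l i j))"
      by (rule sum.swap)
    also have "\<dots> = (\<Sum>l\<in>UNIV. matrix_inv G $ k $ l * (\<Sum>i\<in>UNIV. \<Sum>j\<in>UNIV. X $ i * Y $ j * T l i j))"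
      by (simp add: sum_distrib_left)
    also have "(\<lambda>l. \<Sum>i\<in>UNIV. \<Sum>j\<in>UNIV. X $ i * Y $ j * T l i j) = (\<lambda>l. s $ l)"
      unfolding T_def s_def vec_lambda_beta ex[symmetric]
      by (simp add: sum.distrib sum_subtractf sum_divide_distrib algebra_simps add_divide_distrib diff_divide_distrib)
    finally show ?thesis
      by (simp add: matrix_vector_mult_def)
  qed
  then have g: "christoffel_term p X Y = matrix_inv G *v s"
    by (simp add: vec_eq_iff)
  have "kerr_metric M a p (christoffel_term p X Y) Z = Z \<bullet> (G *v (matrix_inv G *v s))"
    by (subst metric_sym) (simp add: kerr_metric_matrix g G_def)
  also have "G *v (matrix_inv G *v s) = s"
    using metric_matrix_invertible[OF p]
    by (simp add: matrix_vector_mul_assoc G_def mult_matrix_inv)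
  also have "Z \<bullet> s = (\<Sum>l\<in>UNIV. Z $ l * dmetric p X (axis l 1) Y + Z $ l * dmetric p Y (axis l 1) X
      - Z $ l * dmetric p (axis l 1) X Y) / 2"
    by (simp add: s_def inner_vec_def sum_divide_distrib algebra_simps)
  also have "\<dots> = (dmetric p X Z Y + dmetric p Y Z X - dmetric p Z X Y) / 2"
  proof -
    have "dmetric p W Z U = (\<Sum>l\<in>UNIV. Z $ l * dmetric p W (axis l 1) U)" for W U
      by (subst linear_expand[OF lin(2), where v = Z]) simp
    moreover have "dmetric p Z X Y = (\<Sum>l\<in>UNIV. Z $ l * dmetric p (axis l 1) X Y)"
      by (subst linear_expand[OF lin(1), where v = Z]) simp
    ultimately show ?thesis
      by (simp add: sum.distrib sum_subtractf)
  qed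
  finally show ?thesis .
qed

lemma hpr_differentiable:
  assumes p: "p \<in> ext"
  shows "(\<lambda>q. hpr a q v) differentiable (at p within ext)"
  unfolding hpr_def
  by (intro differentiable_rules differentiable_forms nonzero p)

lemma horizontal_form_hpr:
  assumes p: "p \<in> ext" and \<zeta>: "horizontal_form M a \<zeta>"
  shows "\<zeta> p \<bullet> hpr a p v = \<zeta> p \<bullet> v"
proof -
  have "\<zeta> p \<bullet> v = \<zeta> p \<bullet> (hpr a p v + ((tau a p \<bullet> v) / 2 * (Delta M a p / Sig a p) - d_r p \<bullet> v) *\<^sub>R e3 p
    + ((tau a p \<bullet> v) / 2) *\<^sub>R e4 M a p)"
    using hpr_split[OF p, of v] by (rule arg_cong)
  then show ?thesis
    using \<zeta> p by (simp add: horizontal_form_def inner_add_right)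
qed

text \<open>A horizontal form is represented by its \<open>hsharp\<close> on all vectors, because the latter is orthogonal to
  the two directions in which the form vanishes.  This turns contractions of forms with Christoffel
  symbols into metric expressions that \<open>koszul\<close> evaluates.\<close>

lemma horizontal_form_hsharp:
  assumes p: "p \<in> ext" and \<zeta>: "horizontal_form M a \<zeta>"
  shows "\<zeta> p \<bullet> v = kerr_metric M a p (hsharp M a p (\<zeta> p)) v"
proof -
  note h = hsharp_works(1)[OF p, of "\<zeta> p"]
  have "\<zeta> p \<bullet> v = kerr_metric M a p (hsharp M a p (\<zeta> p)) (hpr a p v)"
    using horizontal_form_hpr[OF p \<zeta>] hsharp_works(2)[OF p hpr_horizontal[OF p]] by simp
  also have "\<dots> = kerr_metric M a p (hsharp M a p (\<zeta> p)) (hpr a p v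
      + ((tau a p \<bullet> v) / 2 * (Delta M a p / Sig a p) - d_r p \<bullet> v) *\<^sub>R e3 p + ((tau a p \<bullet> v) / 2) *\<^sub>R e4 M a p)"
    using h unfolding metric_bilinear(2) metric_bilinear(4) by (simp add: horizontal_def)
  also have "\<dots> = kerr_metric M a p (hsharp M a p (\<zeta> p)) v"
    using hpr_split[OF p, of v, symmetric] by (rule arg_cong)
  finally show ?thesis .
qed

text \<open>The horizontal derivative is the full covariant derivative followed by projection: the derivative
  of the projected coordinate field cancels by the product rule.\<close>

lemma hderiv_nth:
  assumes p: "p \<in> ext" and \<zeta>: "horizontal_form M a \<zeta>" and d: "\<zeta> differentiable (at p within ext)"
  shows "hderiv M a X \<zeta> p $ i
    = along X \<zeta> p \<bullet> hpr a p (axis i 1) - \<zeta> p \<bullet> christoffel_term p X (hpr a p (axis i 1))"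
proof -
  define Y where "Y = (\<lambda>q. hproj M a q (axis i 1))"
  have Y: "Y q = hpr a q (axis i 1)" if "q \<in> ext" for q
    by (simp add: Y_def hproj_eq[OF that])
  have dY: "Y differentiable (at p within ext)"
    by (rule differentiable_cong_ext[OF p _ hpr_differentiable[OF p]]) (simp add: Y)
  have "along X (\<lambda>q. \<zeta> q \<bullet> Y q) p - \<zeta> p \<bullet> hproj M a p (nabla M a X Y p)
      = along X (\<lambda>q. \<zeta> q \<bullet> Y q) p - \<zeta> p \<bullet> (along X Y p + christoffel_term p X (Y p))"
    by (simp add: hproj_eq[OF p] nabla_eq horizontal_form_hpr[OF p \<zeta>])
  also have "\<dots> = along X \<zeta> p \<bullet> Y p - \<zeta> p \<bullet> christoffel_term p X (Y p)"
    by (simp add: along_inner[OF p d dY] inner_add_right)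
  finally show ?thesis
    unfolding Y[OF p] unfolding Y_def by (simp add: hderiv_def Let_def)
qed

lemma hderiv_inner:
  assumes p: "p \<in> ext" and \<zeta>: "horizontal_form M a \<zeta>" and d: "\<zeta> differentiable (at p within ext)"
  shows "hderiv M a X \<zeta> p \<bullet> v = along X \<zeta> p \<bullet> hpr a p v - \<zeta> p \<bullet> christoffel_term p X (hpr a p v)"
proof -
  have l: "linear (\<lambda>v. along X \<zeta> p \<bullet> hpr a p v - \<zeta> p \<bullet> christoffel_term p X (hpr a p v))"
    by (rule linearI)
      (simp_all add: linear_add[OF linear_hpr] linear_cmul[OF linear_hpr] linear_add[OF christoffel_term_linear(1)]
        linear_cmul[OF christoffel_term_linear(1)] inner_add_right algebra_simps)
  show ?thesis
    unfolding linear_expand[OF l, of v] by (simp add: inner_vec_def[of "hderiv M a X \<zeta> p"]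
      hderiv_nth[OF assms] mult.commute)
qed

end

section \<open>Fields whose flow preserves the distribution\<close>

text \<open>The value at \<open>v\<close> of the Lie derivative of a form along a field.\<close>

definition lie_form :: "real \<Rightarrow> real \<Rightarrow> (point \<Rightarrow> tvec) \<Rightarrow> (point \<Rightarrow> covec) \<Rightarrow> point \<Rightarrow> tvec \<Rightarrow> real" where
  "lie_form M a X \<zeta> p v = deriv_along M a (X p) \<zeta> p \<bullet> v + \<zeta> p \<bullet> deriv_along M a v X p"

text \<open>
  The condition on \<open>Q\<close> forces \<open>l \<Delta> = 0\<close> for \<open>s = 1\<close> and \<open>l \<Delta> = 2 Q\<close> for \<open>s = - 1\<close>, so the field is
  a multiple of \<open>e3\<close> or of \<open>e4\<close>.  The sign \<open>s\<close> tells the two families apart, and carrying it along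
  allows one computation for both.
\<close>

locale kerr_null = kerr +
  fixes l s :: real and Q Q' :: "real \<Rightarrow> real"
  assumes Q_deriv: "\<And>r. (Q has_real_derivative Q' r) (at r)"
    and s_square: "s * s = 1"
    and Q_Delta: "\<And>r. Q r - l * Delta_r M a r = s * Q r"
begin

definition X :: "point \<Rightarrow> tvec" where
  "X p = (l * ((radius p)\<^sup>2 + a\<^sup>2)) *\<^sub>R axis 1 1 + Q (radius p) *\<^sub>R d_r p + (l * a) *\<^sub>R del_phi p"

lemma X_has_derivative:
  assumes p: "p \<in> ext"
  shows "(X has_derivative (\<lambda>w. (2 * l * radius p * (d_r p \<bullet> w)) *\<^sub>R axis 1 1
      + (Q' (radius p) * (d_r p \<bullet> w)) *\<^sub>R d_r p
      + (Q (radius p) / radius p) *\<^sub>R (spatial w - (d_r p \<bullet> w) *\<^sub>R d_r p)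
      + (l * a) *\<^sub>R rotz w)) (at p within ext)"
proof -
  note r = radius_pos[OF p]
  have Q: "((\<lambda>q. Q (radius q)) has_derivative (\<lambda>w. Q' (radius p) * (d_r p \<bullet> w))) (at p within ext)"
    using has_derivative_compose[OF radius_has_derivative[OF r] Q_deriv[unfolded has_field_derivative_def]]
    by simp
  have 1: "((\<lambda>q. (l * ((radius q)\<^sup>2 + a\<^sup>2)) *\<^sub>R axis 1 1 :: tvec) has_derivative
      (\<lambda>w. (2 * l * radius p * (d_r p \<bullet> w)) *\<^sub>R axis 1 1)) (at p within ext)"
    by (rule derivative_eq_intros radius_has_derivative r refl)+ (simp add: algebra_simps)
  have 3: "((\<lambda>q. (l * a) *\<^sub>R del_phi q) has_derivative (\<lambda>w. (l * a) *\<^sub>R rotz w)) (at p within ext)"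
    by (rule has_derivative_scaleR_right[OF del_phi_has_derivative])
  have 2: "((\<lambda>q. Q (radius q) *\<^sub>R d_r q) has_derivative (\<lambda>w. (Q' (radius p) * (d_r p \<bullet> w)) *\<^sub>R d_r p
      + (Q (radius p) / radius p) *\<^sub>R (spatial w - (d_r p \<bullet> w) *\<^sub>R d_r p))) (at p within ext)"
    by (rule has_derivative_eq_rhs[OF has_derivative_scaleR[OF Q d_r_has_derivative[OF r]]]) (simp add: fun_eq_iff)
  show ?thesis
    unfolding X_def[abs_def]
    by (rule has_derivative_eq_rhs[OF has_derivative_add[OF has_derivative_add[OF 1 2] 3]]) (simp add: fun_eq_iff add.assoc)
qed

lemma X_differentiable: "p \<in> ext \<Longrightarrow> X differentiable (at p within ext)"
  using X_has_derivative by (blast intro: differentiableI)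

lemma along_X:
  assumes p: "p \<in> ext" and v: "v \<in> horizontal M a p"
  shows "along v X p = (Q (radius p) / radius p) *\<^sub>R spatial v + (l * a) *\<^sub>R rotz v"
  using v unfolding horizontal_iff[OF p] along_unique[OF p X_has_derivative[OF p]] by simp

lemma X_values:
  assumes p: "p \<in> ext"
  shows "d_r p \<bullet> X p = Q (radius p)" "d_cos_theta p \<bullet> X p = 0" "tau a p \<bullet> X p = l * Sig a p"
  unfolding X_def inner_add_right inner_scaleR_right covector_values[OF p]
  by (simp_all add: Sig_def power2_eq_square algebra_simps)

lemma X_frame:
  assumes p: "p \<in> ext"
  shows "X p = (l * Sig a p / 2) *\<^sub>R e4 M a p + (l * Delta M a p / 2 - Q (radius p)) *\<^sub>R e3 p"
proof -
  have S: "Sig a p \<noteq> 0" by (rule nonzero[OF p])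
  have "(l * Sig a p / 2) *\<^sub>R e4 M a p = (l * ((radius p)\<^sup>2 + a\<^sup>2)) *\<^sub>R axis 1 1
      + (l * Delta M a p / 2) *\<^sub>R d_r p + (l * a) *\<^sub>R del_phi p"
    unfolding e4_def del_r_eq del_t_def scaleR_add_right scaleR_scaleR using S by simp
  then show ?thesis
    by (simp add: X_def e3_def del_r_eq algebra_simps)
qed

text \<open>The metric dual of \<open>X\<close> annihilates the distribution, and its coefficient along \<open>tau\<close> is where the
  condition relating \<open>Q\<close>, \<open>l\<close> and \<open>\<Delta>\<close> enters.\<close>

lemma X_flat:
  assumes p: "p \<in> ext"
  shows "kerr_metric M a p (X p) v
    = l * Sig a p * (d_r p \<bullet> v) + s * Q (radius p) * (tau a p \<bullet> v)"
proof -
  have S: "Sig a p \<noteq> 0" by (rule nonzero[OF p])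
  have "kerr_metric M a p (X p) v
      = l * Sig a p * (d_r p \<bullet> v) + (Q (radius p) - l * Delta M a p) * (tau a p \<bullet> v)"
    unfolding X_frame[OF p] metric_bilinear metric_sym[of p _ v] metric_e3[OF p] metric_e4[OF p]
    using S by (simp add: field_simps)
  then show ?thesis
    unfolding Delta_def Q_Delta .
qed

text \<open>The next two lemmas say that \<open>X\<close> preserves \<open>sin\<^sup>2 \<theta> d\<phi>\<close> and \<open>tau\<close> along the distribution: the
  coefficients of \<open>X\<close> depend on \<open>r\<close> only, so the Lie derivatives are multiples of \<open>dr\<close>.\<close>

lemma lie_phi:
  assumes p: "p \<in> ext" and v: "v \<in> horizontal M a p"
  shows "along (X p) sin2_d_phi p \<bullet> v = - (sin2_d_phi p \<bullet> along v X p)"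
proof -
  note r = radius_pos[OF p]
  define N2 N3 N4 where "N2 = d_r p $ 2" and "N3 = d_r p $ 3" and "N4 = d_r p $ 4"
  note N = N2_def[symmetric] N3_def[symmetric] N4_def[symmetric] polar(4)[OF r]
  have x: "X p $ 2 = Q (radius p) * N2 - l * a * radius p * N3"
    "X p $ 3 = Q (radius p) * N3 + l * a * radius p * N2"
    by (simp_all add: X_def forms_polar[OF r] N)
  show ?thesis
    unfolding along_unique[OF p sin2_d_phi_has_derivative[OF r]] X_values[OF p] along_X[OF p v] using r
    by (simp add: inner_4 forms_polar[OF r] N x field_simps power2_eq_square)
qed

lemma lie_tau:
  assumes p: "p \<in> ext" and v: "v \<in> horizontal M a p"
  shows "along (X p) (tau a) p \<bullet> v = - (tau a p \<bullet> along v X p)"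
proof -
  note r = radius_pos[OF p]
  have "along (X p) (tau a) p = - a *\<^sub>R along (X p) sin2_d_phi p"
    unfolding along_unique[OF p tau_has_derivative[OF r]]
      along_unique[OF p sin2_d_phi_has_derivative[OF r]] ..
  moreover have "d_t \<bullet> along v X p = 0"
    unfolding along_X[OF p v] by (simp add: d_t_def inner_4)
  ultimately show ?thesis
    using lie_phi[OF p v] by (simp add: tau_def inner_diff_left)
qed

text \<open>Since \<open>X\<close> preserves \<open>tau\<close> along the distribution, the derivative of the metric in the direction \<open>X\<close>
  sees only the growth of \<open>\<Sigma>\<close> and of the spheres, and terms that the derivative of \<open>X\<close> itself will
  cancel.\<close>

lemma dmetric_X:
  assumes p: "p \<in> ext" and v: "v \<in> horizontal M a p" and z: "z \<in> horizontal M a p"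
  shows "dmetric p (X p) z v = 2 * (radius p * Q (radius p) - Sig a p * Q (radius p) / radius p)
      * ((spatial v \<bullet> spatial z) / (radius p)\<^sup>2)
    - (tau a p \<bullet> along v X p) * (kap M a p \<bullet> z) - (tau a p \<bullet> along z X p) * (kap M a p \<bullet> v)"
proof -
  note r = radius_pos[OF p]
  note d = differentiable_forms[OF p]
  have v0: "d_r p \<bullet> v = 0" "tau a p \<bullet> v = 0" and z0: "d_r p \<bullet> z = 0" "tau a p \<bullet> z = 0"
    using v z by (auto simp: horizontal_iff[OF p])
  have inner: "((\<lambda>q. f q \<bullet> u) has_derivative (\<lambda>w. along w f p \<bullet> u)) (at p within ext)"
    if "f differentiable (at p within ext)" for f :: "point \<Rightarrow> covec" and u
    by (rule has_derivative_inner_left[OF along_works[OF that]])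
  have rd: "((\<lambda>q. round_metric q z v) has_derivative
      (\<lambda>w. - 2 * (d_r p \<bullet> w) * (spatial z \<bullet> spatial v) / (radius p) ^ 3)) (at p within ext)"
    unfolding round_metric_eq
    by (rule derivative_eq_intros inner d radius_has_derivative r refl)+
      (use r in \<open>auto simp: v0 z0 fun_eq_iff field_simps power2_eq_square power3_eq_cube\<close>)
  have "((\<lambda>q. kerr_metric M a q z v) has_derivative (\<lambda>w.
      Sig a p * (- 2 * (d_r p \<bullet> w) * (spatial z \<bullet> spatial v) / (radius p) ^ 3)
      + (2 * radius p * (d_r p \<bullet> w) + 2 * a\<^sup>2 * cos_theta p * (d_cos_theta p \<bullet> w)) * round_metric p z v
      + (along w (tau a) p \<bullet> z) * (kap M a p \<bullet> v) + (kap M a p \<bullet> z) * (along w (tau a) p \<bullet> v)))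
      (at p within ext)"
    unfolding kerr_metric_eq
    by (rule has_derivative_eq_rhs[OF has_derivative_add[OF has_derivative_add[OF
        has_derivative_mult[OF Sig_has_derivative[OF r] rd]
        has_derivative_mult[OF inner[OF d(8)] inner[OF d(9)]]]
        has_derivative_mult[OF inner[OF d(9)] inner[OF d(8)]]]]) (simp add: v0 z0 fun_eq_iff)
  from along_unique[OF p this, of "X p"]
  have "dmetric p (X p) z v = Sig a p * (- 2 * Q (radius p) * (spatial z \<bullet> spatial v) / (radius p) ^ 3)
      + 2 * radius p * Q (radius p) * round_metric p z v
      - (tau a p \<bullet> along z X p) * (kap M a p \<bullet> v) - (kap M a p \<bullet> z) * (tau a p \<bullet> along v X p)"
    unfolding dmetric_def X_values[OF p] lie_tau[OF p v] lie_tau[OF p z] by simp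
  then show ?thesis
    unfolding round_metric_eq v0 using r
    by (simp add: inner_commute[of "spatial z"] field_simps power2_eq_square power3_eq_cube)
qed

text \<open>Differentiating the dual form of \<open>X\<close> avoids the derivatives of the remaining metric components.  The
  part that is antisymmetric in \<open>v\<close> and \<open>z\<close> comes from \<open>d tau\<close> and is the source of the twist.\<close>

lemma dmetric_flat:
  assumes p: "p \<in> ext" and v: "v \<in> horizontal M a p" and z: "z \<in> horizontal M a p"
  shows "dmetric p v z (X p) = l * Sig a p * (spatial v \<bullet> spatial z) / radius p
      - s * Q (radius p) * a / (radius p)\<^sup>2 * (rotz v \<bullet> z) - kerr_metric M a p (along v X p) z"
proof -
  note r = radius_pos[OF p]
  note d = differentiable_forms[OF p]
  have v0: "d_r p \<bullet> v = 0" "tau a p \<bullet> v = 0" and z0: "d_r p \<bullet> z = 0" "tau a p \<bullet> z = 0"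
    using v z by (auto simp: horizontal_iff[OF p])
  note md = metric_differentiable[OF p]
  have lin: "linear (\<lambda>u. kerr_metric M a q u z)" for q
    using bilinear_kerr_metric[of M a q] by (simp add: bilinear_def)
  have "along v (\<lambda>q. kerr_metric M a q (X q) z) p
      = along v (\<lambda>q. \<Sum>i\<in>UNIV. X q $ i * kerr_metric M a q (axis i 1) z) p"
  proof -
    have "kerr_metric M a q (X q) z = (\<Sum>i\<in>UNIV. X q $ i * kerr_metric M a q (axis i 1) z)" for q
      by (subst linear_expand[OF lin[of q], of "X q"]) simp
    then show ?thesis by simp
  qed
  also have "\<dots> = (\<Sum>i\<in>UNIV. X p $ i * dmetric p v (axis i 1) z + along v X p $ i * kerr_metric M a p (axis i 1) z)"
  proof (rule along_unique[OF p])
    show "((\<lambda>q. \<Sum>i\<in>UNIV. X q $ i * kerr_metric M a q (axis i 1) z) has_derivative (\<lambda>v.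
        \<Sum>i\<in>UNIV. X p $ i * dmetric p v (axis i 1) z + along v X p $ i * kerr_metric M a p (axis i 1) z)) (at p within ext)"
      unfolding dmetric_def
      by (intro has_derivative_sum has_derivative_mult along_works md
        bounded_linear.has_derivative[OF bounded_linear_vec_nth along_works[OF X_differentiable[OF p]]])
  qed
  also have "\<dots> = dmetric p v (X p) z + kerr_metric M a p (along v X p) z"
  proof -
    have "dmetric p v (X p) z = (\<Sum>i\<in>UNIV. X p $ i * dmetric p v (axis i 1) z)"
      by (subst linear_expand[OF dmetric_linear(2)[OF p], where v = "X p"]) simp
    moreover have "kerr_metric M a p (along v X p) z
        = (\<Sum>i\<in>UNIV. along v X p $ i * kerr_metric M a p (axis i 1) z)"
      by (subst linear_expand[OF lin[of p], of "along v X p"]) simp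
    ultimately show ?thesis by (simp add: sum.distrib)
  qed
  finally have 1: "along v (\<lambda>q. kerr_metric M a q (X q) z) p
      = dmetric p v (X p) z + kerr_metric M a p (along v X p) z" .
  have Q: "(\<lambda>q. s * Q (radius q)) differentiable (at p within ext)"
    using has_derivative_compose[OF radius_has_derivative[OF r] Q_deriv[unfolded has_field_derivative_def]]
    by (intro differentiable_rules) (blast intro: differentiableI)
  have S: "(\<lambda>q. l * Sig a q) differentiable (at p within ext)"
    by (intro differentiable_rules d)
  have i: "(\<lambda>q. d_r q \<bullet> z) differentiable (at p within ext)" "(\<lambda>q. tau a q \<bullet> z) differentiable (at p within ext)"
    by (intro differentiable_rules d)+
  have a: "along v (\<lambda>q. d_r q \<bullet> z) p = (spatial v \<bullet> spatial z) / radius p"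
    "along v (\<lambda>q. tau a q \<bullet> z) p = - (a / (radius p)\<^sup>2) * (rotz v \<bullet> z)"
    unfolding along_unique[OF p has_derivative_inner_left[OF d_r_has_derivative[OF r]]]
      along_unique[OF p has_derivative_inner_left[OF tau_has_derivative[OF r]]] v0
    by (simp_all add: inner_4 algebra_simps add_divide_distrib diff_divide_distrib)
  have "along v (\<lambda>q. kerr_metric M a q (X q) z) p
      = along v (\<lambda>q. (l * Sig a q) * (d_r q \<bullet> z) + (s * Q (radius q)) * (tau a q \<bullet> z)) p"
    by (rule along_cong[OF p]) (simp add: X_flat)
  also have "\<dots> = l * Sig a p * ((spatial v \<bullet> spatial z) / radius p)
      + s * Q (radius p) * (- (a / (radius p)\<^sup>2) * (rotz v \<bullet> z))"
    unfolding along_add[OF p differentiable_mult[OF S i(1)] differentiable_mult[OF Q i(2)]]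
      along_mult[OF p S i(1)] along_mult[OF p Q i(2)] a z0 by simp
  finally show ?thesis
    using 1 dmetric_sym[of p v "X p" z] by simp
qed

text \<open>The second fundamental form, \<open>g (\<nabla>\<^sub>v X, z) = ((L\<^sub>X g) (v, z) + d X\<^sup>\<flat> (v, z)) / 2\<close>.  The Lie derivative
  of the metric is a multiple of the metric, and the exterior derivative of the dual form is a
  multiple of the area form: there is expansion and twist but no shear.\<close>

lemma second_fundamental_form:
  assumes p: "p \<in> ext" and v: "v \<in> horizontal M a p" and z: "z \<in> horizontal M a p"
  shows "kerr_metric M a p (christoffel_term p (X p) v) z = - kerr_metric M a p (along v X p) z
    + (radius p * Q (radius p) / Sig a p) * kerr_metric M a p v z
    - (s * Q (radius p) * a * cos_theta p / Sig a p) * kerr_metric M a p (rot a p v) z"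
proof -
  note r = radius_pos[OF p]
  have S: "Sig a p \<noteq> 0" by (rule nonzero[OF p])
  have v0: "d_r p \<bullet> v = 0" "tau a p \<bullet> v = 0" and z0: "d_r p \<bullet> z = 0" "tau a p \<bullet> z = 0"
    using v z by (auto simp: horizontal_iff[OF p])
  have al: "kerr_metric M a p (along u X p) w = Sig a p / (radius p)\<^sup>2 * (Q (radius p) / radius p * (spatial u \<bullet> spatial w)
      + l * a * (rotz u \<bullet> w)) + (tau a p \<bullet> along u X p) * (kap M a p \<bullet> w)"
    if u: "u \<in> horizontal M a p" and w: "w \<in> horizontal M a p" for u w
  proof -
    have "d_r p \<bullet> w = 0" "tau a p \<bullet> w = 0" using w by (auto simp: horizontal_iff[OF p])
    moreover have "spatial (along u X p) \<bullet> spatial w = Q (radius p) / radius p * (spatial u \<bullet> spatial w)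
      + l * a * (rotz u \<bullet> w)"
      unfolding along_X[OF p u] by (simp add: inner_4 algebra_simps add_divide_distrib)
    ultimately show ?thesis
      unfolding kerr_metric_eq round_metric_eq by simp
  qed
  have anti: "rotz z \<bullet> v = - (rotz v \<bullet> z)"
    by (simp add: inner_4)
  have c: "spatial z \<bullet> spatial v = spatial v \<bullet> spatial z"
    by (rule inner_commute)
  \<comment> \<open>a rotation about the polar axis turns the tangent plane at colatitude \<open>\<theta>\<close> by the factor \<open>cos \<theta>\<close>\<close>
  have turn: "rotz v \<bullet> z = cos_theta p * (spatial (rot a p v) \<bullet> spatial z)"
  proof -
    define N2 N3 N4 where "N2 = d_r p $ 2" and "N3 = d_r p $ 3" and "N4 = d_r p $ 4"
    note N = N2_def[symmetric] N3_def[symmetric] N4_def[symmetric] polar(4)[OF r]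
    have "N2 * v $ 2 + N3 * v $ 3 + N4 * v $ 4 = 0" "N2 * z $ 2 + N3 * z $ 3 + N4 * z $ 4 = 0"
      "N2\<^sup>2 + N3\<^sup>2 + N4\<^sup>2 = 1"
      using v0 z0 polar(6)[OF r] by (simp_all add: inner_4 N)
    then show ?thesis
      unfolding polar(5)[OF r] by (simp add: inner_4 rot_def N) algebra
  qed
  note dX = dmetric_X[OF p v z]
  define t k where "t = (tau a p \<bullet> along v X p) * (kap M a p \<bullet> z)"
    and "k = (tau a p \<bullet> along z X p) * (kap M a p \<bullet> v)"
  define P R T q \<rho> where "P = spatial v \<bullet> spatial z" and "R = rotz v \<bullet> z"
    and "T = spatial (rot a p v) \<bullet> spatial z" and "q = Q (radius p)" and "\<rho> = radius p"
  have q: "Q \<rho> = q" and turn': "R = cos_theta p * T"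
    using turn by (simp_all add: P_def R_def T_def q_def \<rho>_def)
  have "2 * kerr_metric M a p (christoffel_term p (X p) v) z
      = dmetric p (X p) z v + dmetric p v z (X p) - dmetric p z v (X p)"
    unfolding koszul[OF p] using dmetric_sym[of p z v "X p"] dmetric_sym[of p z "X p" v] by simp
  moreover have e: "Sig a p / \<rho>\<^sup>2 * (q / \<rho> * P + l * a * y) = Sig a p * q / \<rho> * (P / \<rho>\<^sup>2) + l * a * Sig a p * (y / \<rho>\<^sup>2)"
    "\<rho> * q / Sig a p * (Sig a p / \<rho>\<^sup>2 * P) = \<rho> * q * (P / \<rho>\<^sup>2)"
    "s * q * a * cos_theta p / Sig a p * (Sig a p / \<rho>\<^sup>2 * T) = s * q * a * (cos_theta p * T / \<rho>\<^sup>2)"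
    "s * q * a / \<rho>\<^sup>2 * y = s * q * a * (y / \<rho>\<^sup>2)" for y
    using S by (simp_all add: algebra_simps add_divide_distrib)
  ultimately have double: "2 * kerr_metric M a p (christoffel_term p (X p) v) z = 2 * (\<rho> * q - Sig a p * q / \<rho>) * (P / \<rho>\<^sup>2) - t - k
      + (l * Sig a p * P / \<rho> - s * q * a * (R / \<rho>\<^sup>2)
        - (Sig a p * q / \<rho> * (P / \<rho>\<^sup>2) + l * a * Sig a p * (R / \<rho>\<^sup>2) + t))
      - (l * Sig a p * P / \<rho> - s * q * a * (- R / \<rho>\<^sup>2)
        - (Sig a p * q / \<rho> * (P / \<rho>\<^sup>2) + l * a * Sig a p * (- R / \<rho>\<^sup>2) + k))"
    unfolding dX dmetric_flat[OF p v z] dmetric_flat[OF p z v] al[OF v z] al[OF z v] anti c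
      t_def[symmetric] k_def[symmetric] P_def[symmetric] R_def[symmetric] \<rho>_def[symmetric] q
    by (simp only: e)
  have half: "g = A * x - (B * x + C * y + t) - D * y"
    if "2 * g = 2 * (A - B) * x - t - k + (E - D * y - (B * x + C * y + t)) - (E - D * y' - (B * x + C * y' + k))"
      "y' = - y" for g A B C D E x y y' :: real
    using that by algebra
  have "kerr_metric M a p (christoffel_term p (X p) v) z
      = \<rho> * q * (P / \<rho>\<^sup>2) - (Sig a p * q / \<rho> * (P / \<rho>\<^sup>2) + l * a * Sig a p * (R / \<rho>\<^sup>2) + t)
        - s * q * a * (R / \<rho>\<^sup>2)"
    by (rule half[OF double]) simp
  then show ?thesis
    unfolding al[OF v z] metric_horizontal[OF p v z] metric_horizontal[OF p rot_horizontal[OF p] z]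
      t_def[symmetric] P_def[symmetric] R_def[symmetric] T_def[symmetric] \<rho>_def[symmetric] q e turn'
    by simp
qed

text \<open>The Christoffel term, paired with a horizontal form, is the second fundamental form evaluated on
  the vector dual to that form; its first summand completes the derivative of the form to a Lie
  derivative.\<close>

lemma hderiv_X:
  assumes p: "p \<in> ext" and \<zeta>: "horizontal_form M a \<zeta>" and d: "\<zeta> differentiable (at p within ext)"
    and v: "v \<in> horizontal M a p"
  shows "hderiv M a (X p) \<zeta> p \<bullet> v = lie_form M a X \<zeta> p v
    - (radius p * Q (radius p) / Sig a p) * (\<zeta> p \<bullet> v)
    + (s * Q (radius p) * a * cos_theta p / Sig a p) * (\<zeta> p \<bullet> rot a p v)"
proof -
  have *: "\<zeta> p \<bullet> w = kerr_metric M a p w (hsharp M a p (\<zeta> p))" for w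
    using horizontal_form_hsharp[OF p \<zeta>] metric_sym by simp
  show ?thesis
    unfolding hderiv_inner[OF p \<zeta> d] hpr_id[OF p v] lie_form_def
    unfolding * second_fundamental_form[OF p v hsharp_works(1)[OF p]] by simp
qed

end

section \<open>Lie derivatives of gradients, duals and of the torsion form\<close>

lemma vec_differentiable:
  fixes f :: "point \<Rightarrow> real^4"
  assumes "\<And>i. (\<lambda>q. f q $ i) differentiable (at x within S)"
  shows "f differentiable (at x within S)"
proof -
  have "f q = (\<Sum>i\<in>UNIV. f q $ i *\<^sub>R axis i 1)" for q
    using basis_expansion[of "f q"] by (simp add: scalar_mult_eq_scaleR)
  then have "f = (\<lambda>q. \<Sum>i\<in>UNIV. f q $ i *\<^sub>R axis i 1)"
    by (rule ext)
  moreover have "(\<lambda>q. \<Sum>i\<in>UNIV. f q $ i *\<^sub>R axis i 1 :: real^4) differentiable (at x within S)"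
    by (rule differentiable_sum) (auto intro!: differentiable_scaleR assms)
  ultimately show ?thesis by simp
qed

lemma differentiable_nth:
  fixes f :: "point \<Rightarrow> real^4"
  assumes "f differentiable (at x within S)"
  shows "(\<lambda>q. f q $ i) differentiable (at x within S)"
  using assms bounded_linear.has_derivative[OF bounded_linear_vec_nth] unfolding differentiable_def
  by blast

definition cross_with :: "tvec \<Rightarrow> tvec \<Rightarrow> tvec" where
  "cross_with n x = vector [0, n $ 3 * x $ 4 - n $ 4 * x $ 3, n $ 4 * x $ 2 - n $ 2 * x $ 4,
     n $ 2 * x $ 3 - n $ 3 * x $ 2]"

lemma bounded_linear_cross: "bounded_linear (cross_with n)"
  unfolding linear_conv_bounded_linear[symmetric]
  by (rule linearI) (simp_all add: cross_with_def vec_eq_iff forall_4 algebra_simps)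

text \<open>Horizontal lifts of the infinitesimal rotations of the spheres, and their quarter turns.  Both
  families are carried to themselves by the flow of \<open>X\<close> and span the distribution at every
  point, on the axis as well.\<close>

definition rfield :: "real \<Rightarrow> tvec \<Rightarrow> point \<Rightarrow> tvec" where
  "rfield a n q = cross_with n q + (a * (n $ 4 - (d_r q \<bullet> n) * cos_theta q)) *\<^sub>R axis 1 1"

definition gfield :: "real \<Rightarrow> tvec \<Rightarrow> point \<Rightarrow> tvec" where
  "gfield a n q = radius q *\<^sub>R (spatial n - (d_r q \<bullet> n) *\<^sub>R d_r q + (a * (sin2_d_phi q \<bullet> n)) *\<^sub>R axis 1 1)"

context kerr
begin

lemma rfield_has_derivative:
  assumes p: "p \<in> ext"
  shows "(rfield a n has_derivative (\<lambda>w. cross_with n w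
    - (a * ((((1 / radius p) *\<^sub>R (spatial w - (d_r p \<bullet> w) *\<^sub>R d_r p)) \<bullet> n) * cos_theta p
      + (d_r p \<bullet> n) * (d_cos_theta p \<bullet> w))) *\<^sub>R axis 1 1)) (at p within ext)"
proof -
  note r = radius_pos[OF p]
  have 1: "((\<lambda>q. a * (n $ 4 - (d_r q \<bullet> n) * cos_theta q)) has_derivative (\<lambda>w. a * (0 -
      ((d_r p \<bullet> n) * (d_cos_theta p \<bullet> w)
      + (((1 / radius p) *\<^sub>R (spatial w - (d_r p \<bullet> w) *\<^sub>R d_r p)) \<bullet> n) * cos_theta p)))) (at p within ext)"
    by (intro has_derivative_mult_right has_derivative_diff has_derivative_const has_derivative_mult
        has_derivative_inner_left d_r_has_derivative cos_theta_has_derivative r)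
  show ?thesis
    unfolding rfield_def[abs_def]
    by (rule has_derivative_eq_rhs[OF has_derivative_add[OF
        bounded_linear_imp_has_derivative[OF bounded_linear_cross] has_derivative_scaleR_left[OF 1]]])
      (simp add: fun_eq_iff algebra_simps)
qed

lemma gfield_has_derivative:
  assumes p: "p \<in> ext"
  shows "(gfield a n has_derivative (\<lambda>w. ((d_r p \<bullet> w) / radius p) *\<^sub>R gfield a n p
    + radius p *\<^sub>R (- (((1 / radius p) *\<^sub>R (spatial w - (d_r p \<bullet> w) *\<^sub>R d_r p)) \<bullet> n) *\<^sub>R d_r p
      - (d_r p \<bullet> n) *\<^sub>R ((1 / radius p) *\<^sub>R (spatial w - (d_r p \<bullet> w) *\<^sub>R d_r p))
      + (a * (((1 / (radius p)\<^sup>2) *\<^sub>R rotz w - (2 * (d_r p \<bullet> w) / radius p) *\<^sub>R sin2_d_phi p) \<bullet> n)) *\<^sub>R axis 1 1)))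
    (at p within ext)"
proof -
  note r = radius_pos[OF p]
  have 1: "((\<lambda>q. spatial n - (d_r q \<bullet> n) *\<^sub>R d_r q + (a * (sin2_d_phi q \<bullet> n)) *\<^sub>R axis 1 1) has_derivative
    (\<lambda>w. 0 - ((d_r p \<bullet> n) *\<^sub>R ((1 / radius p) *\<^sub>R (spatial w - (d_r p \<bullet> w) *\<^sub>R d_r p))
        + (((1 / radius p) *\<^sub>R (spatial w - (d_r p \<bullet> w) *\<^sub>R d_r p)) \<bullet> n) *\<^sub>R d_r p)
      + (a * (((1 / (radius p)\<^sup>2) *\<^sub>R rotz w - (2 * (d_r p \<bullet> w) / radius p) *\<^sub>R sin2_d_phi p) \<bullet> n)) *\<^sub>R axis 1 1))
    (at p within ext)"
    by (intro has_derivative_add has_derivative_diff has_derivative_const has_derivative_scaleR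
        has_derivative_scaleR_left has_derivative_mult_right
        has_derivative_inner_left d_r_has_derivative sin2_d_phi_has_derivative r)
  show ?thesis
    unfolding gfield_def[abs_def]
    by (rule has_derivative_eq_rhs[OF has_derivative_scaleR[OF radius_has_derivative[OF r] 1]])
      (use r in \<open>simp add: fun_eq_iff\<close>)
qed

lemma rfield_horizontal:
  assumes p: "p \<in> ext"
  shows "rfield a n p \<in> horizontal M a p"
proof -
  note r = radius_pos[OF p]
  define N2 N3 N4 where "N2 = d_r p $ 2" and "N3 = d_r p $ 3" and "N4 = d_r p $ 4"
  note N = N2_def[symmetric] N3_def[symmetric] N4_def[symmetric] polar(4)[OF r]
  have c: "N2\<^sup>2 + N3\<^sup>2 + N4\<^sup>2 = 1" using polar(6)[OF r] by (simp add: N)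
  have x: "p $ 2 = radius p * N2" "p $ 3 = radius p * N3" "p $ 4 = radius p * N4" "cos_theta p = N4"
    using polar[OF r] by (simp_all add: N)
  have "sin2_d_phi p \<bullet> cross_with n p = n $ 4 - (N2 * n $ 2 + N3 * n $ 3 + N4 * n $ 4) * N4"
    unfolding forms_polar[OF r] using r
    apply (simp add: inner_4 cross_with_def x N field_simps) using c by algebra
  then have "tau a p \<bullet> rfield a n p = 0"
    unfolding rfield_def inner_add_right inner_scaleR_right covector_values[OF p] x
    unfolding tau_def by (simp add: d_t_def inner_diff_left) (simp add: inner_4 N cross_with_def)
  moreover have "d_r p \<bullet> rfield a n p = 0"
    unfolding rfield_def inner_add_right inner_scaleR_right covector_values[OF p]
    by (simp add: inner_4 N cross_with_def x algebra_simps)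
  ultimately show ?thesis
    by (simp add: horizontal_iff[OF p])
qed

lemma rot_rfield:
  assumes p: "p \<in> ext"
  shows "rot a p (rfield a n p) = gfield a n p"
proof -
  note r = radius_pos[OF p]
  define N2 N3 N4 where "N2 = d_r p $ 2" and "N3 = d_r p $ 3" and "N4 = d_r p $ 4"
  note N = N2_def[symmetric] N3_def[symmetric] N4_def[symmetric] polar(4)[OF r]
  have c: "N2\<^sup>2 + N3\<^sup>2 + N4\<^sup>2 = 1" using polar(6)[OF r] by (simp add: N)
  have x: "p $ 2 = radius p * N2" "p $ 3 = radius p * N3" "p $ 4 = radius p * N4"
    using polar[OF r] by (simp_all add: N)
  show ?thesis
    unfolding rot_def gfield_def forms_polar[OF r] vec_eq_iff forall_4 N vector_4
    using r apply (simp add: rfield_def inner_4 cross_with_def N x)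
    using c by algebra
qed

text \<open>A tangent vector of a sphere is the value of the rotation about the axis orthogonal to it
  and to the radius.\<close>

lemma horizontal_rfield:
  assumes p: "p \<in> ext" and v: "v \<in> horizontal M a p"
  shows "v = rfield a ((1 / radius p) *\<^sub>R rot a p v) p"
proof (rule horizontal_eqI[OF p v rfield_horizontal[OF p]])
  note r = radius_pos[OF p]
  define N2 N3 N4 where "N2 = d_r p $ 2" and "N3 = d_r p $ 3" and "N4 = d_r p $ 4"
  note N = N2_def[symmetric] N3_def[symmetric] N4_def[symmetric] polar(4)[OF r]
  have c: "N2\<^sup>2 + N3\<^sup>2 + N4\<^sup>2 = 1" using polar(6)[OF r] by (simp add: N)
  have x: "p $ 2 = radius p * N2" "p $ 3 = radius p * N3" "p $ 4 = radius p * N4"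
    using polar[OF r] by (simp_all add: N)
  have "N2 * v $ 2 + N3 * v $ 3 + N4 * v $ 4 = 0"
    using v by (simp add: horizontal_iff[OF p] inner_4 N)
  then show "spatial v = spatial (rfield a ((1 / radius p) *\<^sub>R rot a p v) p)"
    unfolding vec_eq_iff forall_4 spatial_nth rfield_def
    using r apply (simp add: rot_def cross_with_def N x)
    using c by algebra
qed

lemma rot_differentiable:
  assumes p: "p \<in> ext" and w: "w differentiable (at p within ext)"
  shows "(\<lambda>q. rot a q (w q)) differentiable (at p within ext)"
proof (rule vec_differentiable)
  note d = differentiable_rules differentiable_nth w differentiable_forms[OF p]
  have "\<forall>i. (\<lambda>q. rot a q (w q) $ i) differentiable (at p within ext)"
    unfolding forall_4 rot_def vector_4 by (intro conjI d)
  then show "(\<lambda>q. rot a q (w q) $ i) differentiable (at p within ext)" for i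
    by blast
qed

lemma hstar_differentiable:
  assumes p: "p \<in> ext" and d: "\<zeta> differentiable (at p within ext)"
  shows "(\<lambda>q. hstar M a q (\<zeta> q)) differentiable (at p within ext)"
proof (rule vec_differentiable)
  fix i
  have "(\<lambda>q. \<zeta> q \<bullet> rot a q (hpr a q (axis i 1))) differentiable (at p within ext)"
    by (intro differentiable_inner d rot_differentiable hpr_differentiable p)
  then show "(\<lambda>q. hstar M a q (\<zeta> q) $ i) differentiable (at p within ext)"
    by (rule differentiable_cong_ext[OF p, rotated])
      (simp add: hstar_inner[symmetric] inner_axis)
qed

lemma hgrad_inner:
  assumes p: "p \<in> ext" and u: "u differentiable (at p within ext)"
  shows "hgrad M a u p \<bullet> v = along (hpr a p v) u p"
proof -
  have l: "linear (\<lambda>v. along (hpr a p v) u p)"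
    by (rule linearI)
      (simp_all add: linear_add[OF linear_hpr] linear_cmul[OF linear_hpr] along_linear[OF u])
  show ?thesis
    by (subst linear_expand[OF l, of v])
      (simp add: inner_vec_def hgrad_def hproj_eq[OF p] mult.commute)
qed

lemma hgrad_differentiable:
  assumes p: "p \<in> ext" and u: "Ck_on 2 u ext"
  shows "hgrad M a u differentiable (at p within ext)"
proof (rule vec_differentiable)
  fix i
  show "(\<lambda>q. hgrad M a u q $ i) differentiable (at p within ext)"
    by (rule differentiable_cong_ext[OF p _ along_along(1)[OF u p hpr_differentiable[OF p, of "axis i 1"]]])
      (simp add: hgrad_def hproj_eq)
qed

end

context kerr_null
begin

text \<open>The radial part of \<open>X\<close> commutes with rotations and its angular part \<open>l a \<partial>\<^sub>\<phi>\<close> rotates their axis.\<close>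

lemma X_rfield:
  assumes p: "p \<in> ext"
  shows "along (X p) (rfield a n) p = along (rfield a n p) X p - (l * a) *\<^sub>R rfield a (rotz n) p"
proof -
  note r = radius_pos[OF p]
  define N2 N3 N4 where "N2 = d_r p $ 2" and "N3 = d_r p $ 3" and "N4 = d_r p $ 4"
  note N = N2_def[symmetric] N3_def[symmetric] N4_def[symmetric] polar(4)[OF r]
  have x: "p $ 2 = radius p * N2" "p $ 3 = radius p * N3" "p $ 4 = radius p * N4"
    using polar[OF r] by (simp_all add: N)
  have xx: "X p $ 2 = Q (radius p) * N2 - l * a * radius p * N3"
    "X p $ 3 = Q (radius p) * N3 + l * a * radius p * N2" "X p $ 4 = Q (radius p) * N4"
    by (simp_all add: X_def forms_polar[OF r] N)
  show ?thesis
    unfolding along_X[OF p rfield_horizontal[OF p]] along_unique[OF p rfield_has_derivative[OF p]]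
      X_values[OF p] vec_eq_iff forall_4 polar(5)[OF r]
    using r apply (simp add: rfield_def inner_4 cross_with_def N x xx polar(5)[OF r])
    by (simp add: field_simps)
qed

lemma X_gfield:
  assumes p: "p \<in> ext"
  shows "along (X p) (gfield a n) p = along (gfield a n p) X p - (l * a) *\<^sub>R gfield a (rotz n) p"
proof -
  note r = radius_pos[OF p]
  define N2 N3 N4 where "N2 = d_r p $ 2" and "N3 = d_r p $ 3" and "N4 = d_r p $ 4"
  note N = N2_def[symmetric] N3_def[symmetric] N4_def[symmetric] polar(4)[OF r]
  have x: "p $ 2 = radius p * N2" "p $ 3 = radius p * N3" "p $ 4 = radius p * N4"
    using polar[OF r] by (simp_all add: N)
  have xx: "X p $ 2 = Q (radius p) * N2 - l * a * radius p * N3"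
    "X p $ 3 = Q (radius p) * N3 + l * a * radius p * N2" "X p $ 4 = Q (radius p) * N4"
    by (simp_all add: X_def forms_polar[OF r] N)
  have h: "gfield a n p \<in> horizontal M a p"
    using rot_horizontal[OF p, of "rfield a n p"] by (simp add: rot_rfield[OF p])
  show ?thesis
    unfolding along_X[OF p h] along_unique[OF p gfield_has_derivative[OF p]]
      X_values[OF p] vec_eq_iff forall_4
    using r apply (simp add: gfield_def inner_4 forms_polar[OF r] N x xx polar(5)[OF r])
    by (simp add: field_simps power2_eq_square)
qed

text \<open>Because \<open>X\<close> maps the test fields to test fields, Lie derivatives of horizontal forms reduce to
  derivatives of their scalar values on these fields.\<close>

lemma lie_form_rfield:
  assumes p: "p \<in> ext" and d: "\<zeta> differentiable (at p within ext)"
  shows "lie_form M a X \<zeta> p (rfield a n p)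
    = along (X p) (\<lambda>q. \<zeta> q \<bullet> rfield a n q) p + l * a * (\<zeta> p \<bullet> rfield a (rotz n) p)"
  unfolding lie_form_def along_inner[OF p d rfield_has_derivative[OF p, THEN differentiableI]] X_rfield[OF p]
  by (simp add: inner_diff_right)

lemma lie_form_gfield:
  assumes p: "p \<in> ext" and d: "\<zeta> differentiable (at p within ext)"
  shows "lie_form M a X \<zeta> p (gfield a n p)
    = along (X p) (\<lambda>q. \<zeta> q \<bullet> gfield a n q) p + l * a * (\<zeta> p \<bullet> gfield a (rotz n) p)"
  unfolding lie_form_def along_inner[OF p d gfield_has_derivative[OF p, THEN differentiableI]] X_gfield[OF p]
  by (simp add: inner_diff_right)

lemma lie_form_cong:
  assumes p: "p \<in> ext" and v: "v \<in> horizontal M a p"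
    and d: "\<zeta> differentiable (at p within ext)" "\<xi> differentiable (at p within ext)"
    and eq: "\<And>q w. q \<in> ext \<Longrightarrow> w \<in> horizontal M a q \<Longrightarrow> \<zeta> q \<bullet> w = \<xi> q \<bullet> w"
  shows "lie_form M a X \<zeta> p v = lie_form M a X \<xi> p v"
proof -
  obtain n where n: "v = rfield a n p" using horizontal_rfield[OF p v] by blast
  have "along (X p) (\<lambda>q. \<zeta> q \<bullet> rfield a n q) p = along (X p) (\<lambda>q. \<xi> q \<bullet> rfield a n q) p"
    by (rule along_cong[OF p]) (simp add: eq rfield_horizontal)
  then show ?thesis
    unfolding n lie_form_rfield[OF p d(1)] lie_form_rfield[OF p d(2)]
    by (simp add: eq[OF p rfield_horizontal[OF p]])
qed

text \<open>The quarter turn exchanges the two families of test fields, and \<open>X\<close> acts on both in the same way.\<close>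

lemma lie_form_hstar:
  assumes p: "p \<in> ext" and v: "v \<in> horizontal M a p" and d: "\<zeta> differentiable (at p within ext)"
  shows "lie_form M a X (\<lambda>q. hstar M a q (\<zeta> q)) p v = lie_form M a X \<zeta> p (rot a p v)"
proof -
  obtain n where n: "v = rfield a n p" using horizontal_rfield[OF p v] by blast
  have h: "hstar M a q (\<zeta> q) \<bullet> rfield a n q = \<zeta> q \<bullet> gfield a n q" if "q \<in> ext" for q n
    by (simp add: hstar_inner hpr_id rfield_horizontal rot_rfield that)
  have "along (X p) (\<lambda>q. hstar M a q (\<zeta> q) \<bullet> rfield a n q) p = along (X p) (\<lambda>q. \<zeta> q \<bullet> gfield a n q) p"
    by (rule along_cong[OF p h])
  then show ?thesis
    unfolding n lie_form_rfield[OF p hstar_differentiable[OF p d]] rot_rfield[OF p] lie_form_gfield[OF p d]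
    by (simp add: h p)
qed

text \<open>On a test field \<open>Y\<close> the claim is \<open>X (Y u) - [X, Y] u = Y (X u)\<close>.\<close>

lemma lie_form_hgrad:
  assumes p: "p \<in> ext" and v: "v \<in> horizontal M a p" and u: "Ck_on 2 u ext"
  shows "lie_form M a X (hgrad M a u) p v = along v (\<lambda>q. along (X q) u q) p"
proof -
  obtain n where n: "v = rfield a n p" using horizontal_rfield[OF p v] by blast
  note du = Ck2(1)[OF u]
  have h: "hgrad M a u q \<bullet> rfield a n q = along (rfield a n q) u q" if "q \<in> ext" for q n
    by (simp add: hgrad_inner du hpr_id rfield_horizontal that)
  have "along (X p) (\<lambda>q. hgrad M a u q \<bullet> rfield a n q) p = along (X p) (\<lambda>q. along (rfield a n q) u q) p"
    by (rule along_cong[OF p h])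
  then show ?thesis
    unfolding n lie_form_rfield[OF p hgrad_differentiable[OF p u]] h[OF p]
    using commutator[OF u p X_differentiable[OF p] rfield_has_derivative[OF p, THEN differentiableI, of n]]
    by (simp add: X_rfield[OF p] along_linear[OF du[OF p]])
qed

end

section \<open>The commuted equation\<close>

context kerr_null
begin

text \<open>The form \<open>eta\<close> for \<open>s = 1\<close> and \<open>etab\<close> for \<open>s = - 1\<close>.\<close>

definition eta_s :: "point \<Rightarrow> covec" where
  "eta_s p = (- s * a\<^sup>2 * radius p / (Sig a p)\<^sup>2 * (sin_theta p)\<^sup>2) *\<^sub>R d_t
     + (a\<^sup>2 * cos_theta p / Sig a p) *\<^sub>R d_cos_theta p
     + (s * a * radius p * ((radius p)\<^sup>2 + a\<^sup>2) / (Sig a p)\<^sup>2) *\<^sub>R sin2_d_phi p"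

text \<open>A simpler form with the same values on the distribution, where \<open>dt = a sin\<^sup>2 \<theta> d\<phi>\<close>.  Its coefficients
  multiply two forms that \<open>X\<close> preserves.\<close>

definition eta_h :: "point \<Rightarrow> covec" where
  "eta_h p = (a\<^sup>2 * cos_theta p / Sig a p) *\<^sub>R d_cos_theta p + (s * a * radius p / Sig a p) *\<^sub>R sin2_d_phi p"

lemma eta_s_alt:
  assumes p: "p \<in> ext"
  shows "eta_s p = (- s * a\<^sup>2 * radius p / (Sig a p)\<^sup>2 * (1 - (cos_theta p)\<^sup>2)) *\<^sub>R d_t
     + (a\<^sup>2 * cos_theta p / Sig a p) *\<^sub>R d_cos_theta p
     + (s * a * radius p * ((radius p)\<^sup>2 + a\<^sup>2) / (Sig a p)\<^sup>2) *\<^sub>R sin2_d_phi p"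
  unfolding eta_s_def using polar(5,7)[OF radius_pos[OF p]] by simp

lemma eta_s_differentiable:
  assumes p: "p \<in> ext"
  shows "eta_s differentiable (at p within ext)"
proof -
  have S2: "(Sig a p)\<^sup>2 \<noteq> 0" using nonzero[OF p] by simp
  have "(\<lambda>p. (- s * a\<^sup>2 * radius p / (Sig a p)\<^sup>2 * (1 - (cos_theta p)\<^sup>2)) *\<^sub>R d_t
     + (a\<^sup>2 * cos_theta p / Sig a p) *\<^sub>R d_cos_theta p
     + (s * a * radius p * ((radius p)\<^sup>2 + a\<^sup>2) / (Sig a p)\<^sup>2) *\<^sub>R sin2_d_phi p)
    differentiable (at p within ext)"
    by (intro differentiable_rules differentiable_forms p S2 nonzero[OF p])
  then show ?thesis
    by (rule differentiable_cong_ext[OF p, rotated]) (simp add: eta_s_alt)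
qed

lemma eta_h_differentiable:
  assumes p: "p \<in> ext"
  shows "eta_h differentiable (at p within ext)"
  unfolding eta_h_def[abs_def] by (intro differentiable_rules differentiable_forms p nonzero[OF p])

lemma eta_s_form: "horizontal_form M a eta_s"
proof -
  have "eta_s p \<bullet> e3 p = 0 \<and> eta_s p \<bullet> e4 M a p = 0" if p: "p \<in> ext" for p
    unfolding eta_s_alt[OF p] inner_add_left inner_scaleR_left frame_values[OF p]
    using nonzero[OF p] by (simp add: field_simps power2_eq_square)
  then show ?thesis by (simp add: horizontal_form_def)
qed

lemma eta_s_horizontal:
  assumes p: "p \<in> ext" and v: "v \<in> horizontal M a p"
  shows "eta_s p \<bullet> v = eta_h p \<bullet> v"
proof -
  have S: "Sig a p \<noteq> 0" by (rule nonzero[OF p])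
  have t: "d_t \<bullet> v = a * (sin2_d_phi p \<bullet> v)"
    using v by (simp add: horizontal_iff[OF p] tau_def inner_diff_left)
  have A: "(radius p)\<^sup>2 + a\<^sup>2 = Sig a p + a\<^sup>2 * (1 - (cos_theta p)\<^sup>2)"
    by (simp add: Sig_def algebra_simps)
  have c: "- s * a\<^sup>2 * r / S\<^sup>2 * k * (a * x) + s * a * r * (S + a\<^sup>2 * k) / S\<^sup>2 * x = s * a * r / S * x"
    if "S \<noteq> 0" for r S k x :: real
    using that by (simp add: field_simps power2_eq_square)
  show ?thesis
    unfolding eta_s_alt[OF p] eta_h_def inner_add_left inner_scaleR_left t A
    using c[OF S, of "radius p" "1 - (cos_theta p)\<^sup>2" "sin2_d_phi p \<bullet> v"] by simp
qed

lemma lie_cos: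
  assumes p: "p \<in> ext" and v: "v \<in> horizontal M a p"
  shows "along (X p) d_cos_theta p \<bullet> v = - (d_cos_theta p \<bullet> along v X p)"
proof -
  note r = radius_pos[OF p]
  define N2 N3 N4 where "N2 = d_r p $ 2" and "N3 = d_r p $ 3" and "N4 = d_r p $ 4"
  note N = N2_def[symmetric] N3_def[symmetric] N4_def[symmetric] polar(4)[OF r]
  have x: "X p $ 2 = Q (radius p) * N2 - l * a * radius p * N3"
    "X p $ 3 = Q (radius p) * N3 + l * a * radius p * N2" "X p $ 4 = Q (radius p) * N4"
    by (simp_all add: X_def forms_polar[OF r] N)
  show ?thesis
    unfolding along_unique[OF p d_cos_theta_has_derivative[OF r]] X_values[OF p] along_X[OF p v] polar(5)[OF r] using r
    by (simp add: inner_4 forms_polar[OF r] N x field_simps power2_eq_square)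
qed

abbreviation expansion :: "point \<Rightarrow> real" where
  "expansion p \<equiv> 2 * radius p * Q (radius p) / Sig a p"

abbreviation twist :: "point \<Rightarrow> real" where
  "twist p \<equiv> - 2 * s * a * Q (radius p) * cos_theta p / Sig a p"

lemma Q_radius_has_derivative:
  assumes p: "p \<in> ext"
  shows "((\<lambda>q. Q (radius q)) has_derivative (\<lambda>w. Q' (radius p) * (d_r p \<bullet> w))) (at p within ext)"
  using has_derivative_compose[OF radius_has_derivative[OF radius_pos[OF p]] Q_deriv[unfolded has_field_derivative_def]]
  by simp

lemma expansion_twist_differentiable:
  assumes p: "p \<in> ext"
  shows "expansion differentiable (at p within ext)" "twist differentiable (at p within ext)"
  by (intro differentiable_rules differentiable_forms p nonzero[OF p]
      Q_radius_has_derivative[OF p, THEN differentiableI])+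

lemma expansion_twist_along:
  assumes p: "p \<in> ext" and v: "v \<in> horizontal M a p"
  shows "along v expansion p = - 4 * a\<^sup>2 * cos_theta p * radius p * Q (radius p) / (Sig a p)\<^sup>2 * (d_cos_theta p \<bullet> v)"
    "along v twist p = - 2 * s * a * Q (radius p) * ((radius p)\<^sup>2 - a\<^sup>2 * (cos_theta p)\<^sup>2) / (Sig a p)\<^sup>2 * (d_cos_theta p \<bullet> v)"
proof -
  note r = radius_pos[OF p]
  have S: "Sig a p \<noteq> 0" by (rule nonzero[OF p])
  have v0: "d_r p \<bullet> v = 0" using v by (simp add: horizontal_iff[OF p])
  note d = Q_radius_has_derivative[OF p] radius_has_derivative[OF r] Sig_has_derivative[OF r] cos_theta_has_derivative[OF r]
  have 1: "(expansion has_derivative (\<lambda>w. (2 * (d_r p \<bullet> w) * Q (radius p) + 2 * radius p * (Q' (radius p) * (d_r p \<bullet> w))) / Sig a p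
      - 2 * radius p * Q (radius p) / (Sig a p)\<^sup>2 * (2 * radius p * (d_r p \<bullet> w) + 2 * a\<^sup>2 * cos_theta p * (d_cos_theta p \<bullet> w))))
      (at p within ext)"
    by (rule derivative_eq_intros d S refl)+ (use S in \<open>simp add: fun_eq_iff field_simps power2_eq_square\<close>)
  show "along v expansion p = - 4 * a\<^sup>2 * cos_theta p * radius p * Q (radius p) / (Sig a p)\<^sup>2 * (d_cos_theta p \<bullet> v)"
    unfolding along_unique[OF p 1] v0 by simp
  have 2: "(twist has_derivative (\<lambda>w. (- 2 * s * a * (Q' (radius p) * (d_r p \<bullet> w)) * cos_theta p
      - 2 * s * a * Q (radius p) * (d_cos_theta p \<bullet> w)) / Sig a p
      + 2 * s * a * Q (radius p) * cos_theta p / (Sig a p)\<^sup>2 * (2 * radius p * (d_r p \<bullet> w) + 2 * a\<^sup>2 * cos_theta p * (d_cos_theta p \<bullet> w))))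
      (at p within ext)"
    by (rule derivative_eq_intros d S refl)+ (use S in \<open>simp add: fun_eq_iff field_simps power2_eq_square\<close>)
  have "along v twist p = (- 2 * s * a * Q (radius p) * (Sig a p - 2 * a\<^sup>2 * (cos_theta p)\<^sup>2)) / (Sig a p)\<^sup>2 * (d_cos_theta p \<bullet> v)"
    unfolding along_unique[OF p 2] v0 using S by (simp add: field_simps power2_eq_square)
  also have "Sig a p - 2 * a\<^sup>2 * (cos_theta p)\<^sup>2 = (radius p)\<^sup>2 - a\<^sup>2 * (cos_theta p)\<^sup>2"
    by (simp add: Sig_def)
  finally show "along v twist p = - 2 * s * a * Q (radius p) * ((radius p)\<^sup>2 - a\<^sup>2 * (cos_theta p)\<^sup>2) / (Sig a p)\<^sup>2 * (d_cos_theta p \<bullet> v)" .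
qed

text \<open>The forms \<open>d cos \<theta>\<close> and \<open>sin\<^sup>2 \<theta> d\<phi>\<close> are dual to each other on the spheres.\<close>

lemma cos_rot:
  assumes p: "p \<in> ext"
  shows "d_cos_theta p \<bullet> rot a p v = sin2_d_phi p \<bullet> v"
  unfolding forms_polar[OF radius_pos[OF p]] using polar(4)[OF radius_pos[OF p]]
  by (simp add: inner_4 rot_def algebra_simps)

text \<open>The structure equation on which the whole computation rests.  Both sides are combinations of
  \<open>d cos \<theta>\<close> and \<open>sin\<^sup>2 \<theta> d\<phi>\<close>, since \<open>X\<close> preserves these forms and the expansion and the twist depend
  on \<open>r\<close> and \<open>\<theta>\<close> only; it remains to compare the two coefficients.\<close>

lemma lie_form_eta:
  assumes p: "p \<in> ext" and v: "v \<in> horizontal M a p"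
  shows "2 * lie_form M a X eta_s p v = along v expansion p + along (rot a p v) twist p"
proof -
  note r = radius_pos[OF p]
  have S: "Sig a p \<noteq> 0" by (rule nonzero[OF p])
  note d = radius_has_derivative[OF r, of ext] Sig_has_derivative[OF r, of _ ext] cos_theta_has_derivative[OF r, of ext]
  define f where "f = (\<lambda>q. a\<^sup>2 * cos_theta q / Sig a q)"
  define g where "g = (\<lambda>q. s * a * radius q / Sig a q)"
  have f: "(f has_derivative (\<lambda>w. a\<^sup>2 * (d_cos_theta p \<bullet> w) / Sig a p - a\<^sup>2 * cos_theta p / (Sig a p)\<^sup>2 *
      (2 * radius p * (d_r p \<bullet> w) + 2 * a\<^sup>2 * cos_theta p * (d_cos_theta p \<bullet> w)))) (at p within ext)"
    unfolding f_def
    by (rule derivative_eq_intros d S refl)+ (use S in \<open>simp add: fun_eq_iff field_simps power2_eq_square\<close>)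
  have g: "(g has_derivative (\<lambda>w. s * a * (d_r p \<bullet> w) / Sig a p - s * a * radius p / (Sig a p)\<^sup>2 *
      (2 * radius p * (d_r p \<bullet> w) + 2 * a\<^sup>2 * cos_theta p * (d_cos_theta p \<bullet> w)))) (at p within ext)"
    unfolding g_def
    by (rule derivative_eq_intros d S refl)+ (use S in \<open>simp add: fun_eq_iff field_simps power2_eq_square\<close>)
  have f': "along (X p) f p = - 2 * a\<^sup>2 * cos_theta p * radius p * Q (radius p) / (Sig a p)\<^sup>2"
    unfolding along_unique[OF p f] X_values[OF p] by simp
  have "along (X p) g p = s * a * Q (radius p) * (Sig a p - 2 * (radius p)\<^sup>2) / (Sig a p)\<^sup>2"
    unfolding along_unique[OF p g] X_values[OF p] using S by (simp add: field_simps power2_eq_square)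
  also have "Sig a p - 2 * (radius p)\<^sup>2 = a\<^sup>2 * (cos_theta p)\<^sup>2 - (radius p)\<^sup>2"
    by (simp add: Sig_def)
  finally have g': "along (X p) g p = s * a * Q (radius p) * (a\<^sup>2 * (cos_theta p)\<^sup>2 - (radius p)\<^sup>2) / (Sig a p)\<^sup>2" .
  note df = f[THEN differentiableI] and dg = g[THEN differentiableI]
  note dd = differentiable_forms[OF p]
  have "lie_form M a X eta_s p v = lie_form M a X eta_h p v"
    by (rule lie_form_cong[OF p v eta_s_differentiable[OF p] eta_h_differentiable[OF p] eta_s_horizontal])
  also have "eta_h = (\<lambda>q. f q *\<^sub>R d_cos_theta q + g q *\<^sub>R sin2_d_phi q)"
    by (simp add: eta_h_def f_def g_def fun_eq_iff)
  also have "lie_form M a X (\<lambda>q. f q *\<^sub>R d_cos_theta q + g q *\<^sub>R sin2_d_phi q) p v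
      = along (X p) f p * (d_cos_theta p \<bullet> v) + along (X p) g p * (sin2_d_phi p \<bullet> v)"
    unfolding lie_form_def along_add[OF p differentiable_scaleR[OF df dd(4)] differentiable_scaleR[OF dg dd(5)]]
      along_scaleR[OF p df dd(4)] along_scaleR[OF p dg dd(5)]
    by (simp add: inner_add_left lie_cos[OF p v] lie_phi[OF p v])
  finally have L: "lie_form M a X eta_s p v = - 2 * a\<^sup>2 * cos_theta p * radius p * Q (radius p) / (Sig a p)\<^sup>2 * (d_cos_theta p \<bullet> v)
      + s * a * Q (radius p) * (a\<^sup>2 * (cos_theta p)\<^sup>2 - (radius p)\<^sup>2) / (Sig a p)\<^sup>2 * (sin2_d_phi p \<bullet> v)"
    unfolding f' g' .
  have "2 * (- 2 * A * i * x + s * a * q * (B - C) * i * y) = - 4 * A * i * x + - 2 * s * a * q * (C - B) * i * y"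
    for A B C i q x y :: real
    by algebra
  from this[of "a\<^sup>2 * cos_theta p * radius p * Q (radius p)"] show ?thesis
    unfolding L expansion_twist_along(1)[OF p v] expansion_twist_along(2)[OF p rot_horizontal[OF p]] cos_rot[OF p]
    by (simp only: mult.assoc divide_inverse)
qed

abbreviation T :: "(point \<Rightarrow> real) \<Rightarrow> point \<Rightarrow> covec" where
  "T \<equiv> D_plus M a (\<lambda>q. 2 *\<^sub>R eta_s q)"

lemma hpr_frame:
  assumes p: "p \<in> ext"
  shows "hpr a p (e3 p) = 0" "hpr a p (e4 M a p) = 0"
proof -
  have *: "x = 0" if "y = x + A *\<^sub>R e3 p + B *\<^sub>R e4 M a p" "y = A *\<^sub>R e3 p + B *\<^sub>R e4 M a p" for x y A B
    using that by simp
  show "hpr a p (e3 p) = 0"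
    by (rule *[OF hpr_split[OF p]]) (simp add: frame_values[OF p])
  show "hpr a p (e4 M a p) = 0"
    by (rule *[OF hpr_split[OF p]]) (simp add: frame_values[OF p])
qed

lemma covector_eqI:
  assumes p: "p \<in> ext" and h: "\<And>v. v \<in> horizontal M a p \<Longrightarrow> x \<bullet> v = y \<bullet> v"
    and "x \<bullet> e3 p = y \<bullet> e3 p" "x \<bullet> e4 M a p = y \<bullet> e4 M a p"
  shows "x = y"
proof -
  have "x \<bullet> v = y \<bullet> v" for v
    by (subst (1 2) hpr_split[OF p, of v])
      (simp only: inner_add_right inner_scaleR_right h[OF hpr_horizontal[OF p]] assms(3,4))
  then show ?thesis
    using vector_eq_rdot by blast
qed

lemma hgrad_frame:
  assumes p: "p \<in> ext" and u: "u differentiable (at p within ext)"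
  shows "hgrad M a u p \<bullet> e3 p = 0" "hgrad M a u p \<bullet> e4 M a p = 0"
  unfolding hgrad_inner[OF p u] hpr_frame[OF p] by (rule along_linear(5)[OF u])+

lemma hstar_frame:
  assumes p: "p \<in> ext"
  shows "hstar M a p \<xi> \<bullet> e3 p = 0" "hstar M a p \<xi> \<bullet> e4 M a p = 0"
  unfolding hstar_inner[OF p] hpr_frame[OF p] by (simp_all add: linear_0[OF linear_rot])

lemma hderiv_frame:
  assumes p: "p \<in> ext" and \<zeta>: "horizontal_form M a \<zeta>" and d: "\<zeta> differentiable (at p within ext)"
  shows "hderiv M a Y \<zeta> p \<bullet> e3 p = 0" "hderiv M a Y \<zeta> p \<bullet> e4 M a p = 0"
  unfolding hderiv_inner[OF p \<zeta> d] hpr_frame[OF p] by (simp_all add: linear_0[OF christoffel_term_linear(1)])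

lemma T_frame:
  assumes p: "p \<in> ext" and u: "u differentiable (at p within ext)"
  shows "T u p \<bullet> e3 p = 0" "T u p \<bullet> e4 M a p = 0"
  using eta_s_form p unfolding horizontal_form_def
  by (simp_all add: D_plus_def inner_add_left hgrad_frame[OF p u])

lemma T_inner:
  assumes p: "p \<in> ext" and u: "u differentiable (at p within ext)" and v: "v \<in> horizontal M a p"
  shows "T u p \<bullet> v = along v u p + 2 * u p * (eta_s p \<bullet> v)"
  by (simp add: D_plus_def inner_add_left hgrad_inner[OF p u] hpr_id[OF p v])

lemma T_differentiable:
  assumes p: "p \<in> ext" and u: "Ck_on 2 u ext"
  shows "T u differentiable (at p within ext)"
  unfolding D_plus_def[abs_def]
  by (intro differentiable_rules hgrad_differentiable p u eta_s_differentiable Ck2(1)[OF u])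

lemma lie_form_add:
  assumes p: "p \<in> ext" and "\<zeta> differentiable (at p within ext)" "\<xi> differentiable (at p within ext)"
  shows "lie_form M a X (\<lambda>q. \<zeta> q + \<xi> q) p v = lie_form M a X \<zeta> p v + lie_form M a X \<xi> p v"
  by (simp add: lie_form_def along_add assms inner_add_left)

lemma lie_form_scaleR:
  assumes p: "p \<in> ext" and "f differentiable (at p within ext)" "\<zeta> differentiable (at p within ext)"
  shows "lie_form M a X (\<lambda>q. f q *\<^sub>R \<zeta> q) p v = f p * lie_form M a X \<zeta> p v + along (X p) f p * (\<zeta> p \<bullet> v)"
  by (simp add: lie_form_def along_scaleR assms inner_add_left algebra_simps)

lemma lie_form_T:
  assumes p: "p \<in> ext" and u: "Ck_on 2 u ext" and v: "v \<in> horizontal M a p"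
  shows "lie_form M a X (T u) p v = along v (\<lambda>q. along (X q) u q) p
    + 2 * along (X p) u p * (eta_s p \<bullet> v) + u p * (along v expansion p + along (rot a p v) twist p)"
proof -
  note du = Ck2(1)[OF u p] and de = eta_s_differentiable[OF p]
  have 2: "(\<lambda>q. 2 *\<^sub>R eta_s q) differentiable (at p within ext)"
    by (intro differentiable_rules de)
  have "lie_form M a X (\<lambda>q. 2 *\<^sub>R eta_s q) p v = along v expansion p + along (rot a p v) twist p"
    unfolding lie_form_scaleR[OF p differentiable_const de] lie_form_eta[OF p v, symmetric]
    by (simp add: along_const[OF p])
  then show ?thesis
    unfolding D_plus_def[abs_def] lie_form_add[OF p hgrad_differentiable[OF p u] differentiable_scaleR[OF du 2]]
      lie_form_scaleR[OF p du 2] lie_form_hgrad[OF p v u] by simp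
qed

lemma source_regular:
  assumes \<rho>: "Ck_on 2 \<rho> ext" and \<sigma>: "Ck_on 2 \<sigma> ext"
  defines "F \<equiv> \<lambda>q. Sig a q *\<^sub>R (T \<rho> q + hstar M a q (T \<sigma> q))"
  shows "horizontal_form M a F" "p \<in> ext \<Longrightarrow> F differentiable (at p within ext)"
proof -
  show "horizontal_form M a F"
    by (simp add: horizontal_form_def F_def inner_add_left T_frame hstar_frame Ck2(1)[OF \<rho>])
  show "F differentiable (at p within ext)" if p: "p \<in> ext"
    unfolding F_def
    by (intro differentiable_scaleR differentiable_add differentiable_forms(7) T_differentiable
        hstar_differentiable p \<rho> \<sigma>)
qed

lemma scalar_regular:
  assumes p: "p \<in> ext" and \<rho>: "Ck_on 2 \<rho> ext" and \<sigma>: "Ck_on 2 \<sigma> ext"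
  shows "(\<lambda>q. along (X q) \<rho> q + expansion q * \<rho> q - twist q * \<sigma> q) differentiable (at p within ext)"
    "(\<lambda>q. along (X q) \<sigma> q + expansion q * \<sigma> q + twist q * \<rho> q) differentiable (at p within ext)"
  by (intro differentiable_add differentiable_diff differentiable_mult expansion_twist_differentiable
      along_along(1) Ck2(1) X_differentiable p \<rho> \<sigma>)+

text \<open>The operator on the left is \<open>L\<^sub>X + e \<star>\<close> by \<open>hderiv_X\<close>.  It commutes with \<open>\<Sigma> T\<close> up to derivatives of
  coefficients: those of \<open>\<Sigma>\<close> give the expansion, those of \<open>eta_s\<close> are the gradients of the expansion
  and the twist, which is what the product rule asks for inside \<open>T\<close>.\<close>

lemma commuted_equation:
  assumes p: "p \<in> ext" and \<rho>: "Ck_on 2 \<rho> ext" and \<sigma>: "Ck_on 2 \<sigma> ext"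
  defines "F \<equiv> \<lambda>q. Sig a q *\<^sub>R (T \<rho> q + hstar M a q (T \<sigma> q))"
  shows "hderiv M a (X p) F p + (expansion p / 2) *\<^sub>R F p + (3/2 * twist p) *\<^sub>R hstar M a p (F p)
    = Sig a p *\<^sub>R (T (\<lambda>q. along (X q) \<rho> q + expansion q * \<rho> q - twist q * \<sigma> q) p
        + hstar M a p (T (\<lambda>q. along (X q) \<sigma> q + expansion q * \<sigma> q + twist q * \<rho> q) p))"
proof -
  define \<rho>1 where "\<rho>1 = (\<lambda>q. along (X q) \<rho> q + expansion q * \<rho> q - twist q * \<sigma> q)"
  define \<sigma>1 where "\<sigma>1 = (\<lambda>q. along (X q) \<sigma> q + expansion q * \<sigma> q + twist q * \<rho> q)"
  note r = radius_pos[OF p]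
  have S: "Sig a p \<noteq> 0" by (rule nonzero[OF p])
  note d\<rho> = Ck2(1)[OF \<rho>] and d\<sigma> = Ck2(1)[OF \<sigma>]
  note dX\<rho> = along_along(1)[OF \<rho> p X_differentiable[OF p]] and dX\<sigma> = along_along(1)[OF \<sigma> p X_differentiable[OF p]]
  note dt = expansion_twist_differentiable(1)[OF p] and de = expansion_twist_differentiable(2)[OF p]
  note d1 = differentiable_mult[OF dt d\<rho>[OF p]] differentiable_mult[OF dt d\<sigma>[OF p]]
    differentiable_mult[OF de d\<rho>[OF p]] differentiable_mult[OF de d\<sigma>[OF p]]
  have d\<rho>1: "\<rho>1 differentiable (at p within ext)" and d\<sigma>1: "\<sigma>1 differentiable (at p within ext)"
    unfolding \<rho>1_def \<sigma>1_def by (rule scalar_regular[OF p \<rho> \<sigma>])+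
  have a\<rho>: "along v \<rho>1 p = along v (\<lambda>q. along (X q) \<rho> q) p + (expansion p * along v \<rho> p + along v expansion p * \<rho> p)
      - (twist p * along v \<sigma> p + along v twist p * \<sigma> p)" for v
    unfolding \<rho>1_def along_diff[OF p differentiable_add[OF dX\<rho> d1(1)] d1(4)] along_add[OF p dX\<rho> d1(1)]
      along_mult[OF p dt d\<rho>[OF p]] along_mult[OF p de d\<sigma>[OF p]] ..
  have a\<sigma>: "along v \<sigma>1 p = along v (\<lambda>q. along (X q) \<sigma> q) p + (expansion p * along v \<sigma> p + along v expansion p * \<sigma> p)
      + (twist p * along v \<rho> p + along v twist p * \<rho> p)" for v
    unfolding \<sigma>1_def along_add[OF p differentiable_add[OF dX\<sigma> d1(2)] d1(3)] along_add[OF p dX\<sigma> d1(2)]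
      along_mult[OF p dt d\<sigma>[OF p]] along_mult[OF p de d\<rho>[OF p]] ..
  have hF: "horizontal_form M a F" and dF: "F differentiable (at p within ext)"
    unfolding F_def using source_regular[OF \<rho> \<sigma>] p by auto
  note dS = differentiable_forms(7)[OF p]
  note dT\<rho> = T_differentiable[OF p \<rho>] and dT\<sigma> = T_differentiable[OF p \<sigma>]
  note ds = hstar_differentiable[OF p dT\<sigma>]
  have XS: "along (X p) (Sig a) p = expansion p * Sig a p"
    unfolding along_unique[OF p Sig_has_derivative[OF r]] X_values[OF p] using S by simp
  show ?thesis
    unfolding \<rho>1_def[symmetric] \<sigma>1_def[symmetric]
  proof (rule covector_eqI[OF p])
    fix v assume v: "v \<in> horizontal M a p"
    note w = rot_horizontal[OF p, of v]
    have st: "hstar M a p \<xi> \<bullet> v = \<xi> \<bullet> rot a p v" "hstar M a p \<xi> \<bullet> rot a p v = - (\<xi> \<bullet> v)" for \<xi>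
      by (simp_all add: hstar_inner[OF p] hpr_id[OF p] v w rot_rot[OF p v])
    have neg: "along (- v) f p = - along v f p" if "f differentiable (at p within ext)" for f :: "point \<Rightarrow> real"
      by (rule along_linear(3)[OF that])
    have lie: "lie_form M a X F p v = Sig a p * (lie_form M a X (T \<rho>) p v + lie_form M a X (T \<sigma>) p (rot a p v))
        + expansion p * (F p \<bullet> v)"
      unfolding F_def lie_form_scaleR[OF p dS differentiable_add[OF dT\<rho> ds]] lie_form_add[OF p dT\<rho> ds]
        lie_form_hstar[OF p v dT\<sigma>] XS by simp
    have Fv: "F p \<bullet> v = Sig a p * (T \<rho> p \<bullet> v + T \<sigma> p \<bullet> rot a p v)"
      "F p \<bullet> rot a p v = Sig a p * (T \<rho> p \<bullet> rot a p v - T \<sigma> p \<bullet> v)"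
      by (simp_all add: F_def inner_add_left st)
    have "radius p * Q (radius p) / Sig a p = expansion p / 2"
      "s * Q (radius p) * a * cos_theta p / Sig a p = - twist p / 2"
      by simp_all
    then have "(hderiv M a (X p) F p + (expansion p / 2) *\<^sub>R F p + (3/2 * twist p) *\<^sub>R hstar M a p (F p)) \<bullet> v
        = lie_form M a X F p v + twist p * (F p \<bullet> rot a p v)"
      by (simp only: inner_add_left inner_scaleR_left hderiv_X[OF p hF dF v] st) (simp add: field_simps)
    also have "\<dots> = Sig a p * (lie_form M a X (T \<rho>) p v + lie_form M a X (T \<sigma>) p (rot a p v)
        + expansion p * (T \<rho> p \<bullet> v + T \<sigma> p \<bullet> rot a p v) + twist p * (T \<rho> p \<bullet> rot a p v - T \<sigma> p \<bullet> v))"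
      unfolding lie Fv by (simp only: distrib_left mult_ac)
    also have "\<dots> = Sig a p * (T \<rho>1 p \<bullet> v + T \<sigma>1 p \<bullet> rot a p v)"
    proof -
      have 1: "\<rho>1 p = along (X p) \<rho> p + expansion p * \<rho> p - twist p * \<sigma> p" "\<sigma>1 p = along (X p) \<sigma> p + expansion p * \<sigma> p + twist p * \<rho> p"
        by (simp_all add: \<rho>1_def \<sigma>1_def)
      obtain tp ep where te: "expansion p = tp" "twist p = ep" by blast
      show ?thesis
        unfolding lie_form_T[OF p \<rho> v] lie_form_T[OF p \<sigma> w] rot_rot[OF p v] neg[OF de]
          T_inner[OF p d\<rho>[OF p] v] T_inner[OF p d\<sigma>[OF p] v] T_inner[OF p d\<rho>[OF p] w] T_inner[OF p d\<sigma>[OF p] w]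
          T_inner[OF p d\<rho>1 v] T_inner[OF p d\<sigma>1 w] a\<rho> a\<sigma> 1 te
        by algebra
    qed
    also have "\<dots> = (Sig a p *\<^sub>R (T \<rho>1 p + hstar M a p (T \<sigma>1 p))) \<bullet> v"
      by (simp add: inner_add_left st)
    finally show "(hderiv M a (X p) F p + (expansion p / 2) *\<^sub>R F p + (3/2 * twist p) *\<^sub>R hstar M a p (F p)) \<bullet> v
        = (Sig a p *\<^sub>R (T \<rho>1 p + hstar M a p (T \<sigma>1 p))) \<bullet> v" .
  next
    have F0: "F p \<bullet> e3 p = 0" "F p \<bullet> e4 M a p = 0"
      using hF p by (auto simp: horizontal_form_def)
    show "(hderiv M a (X p) F p + (expansion p / 2) *\<^sub>R F p + (3/2 * twist p) *\<^sub>R hstar M a p (F p)) \<bullet> e3 p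
        = (Sig a p *\<^sub>R (T \<rho>1 p + hstar M a p (T \<sigma>1 p))) \<bullet> e3 p"
      "(hderiv M a (X p) F p + (expansion p / 2) *\<^sub>R F p + (3/2 * twist p) *\<^sub>R hstar M a p (F p)) \<bullet> e4 M a p
        = (Sig a p *\<^sub>R (T \<rho>1 p + hstar M a p (T \<sigma>1 p))) \<bullet> e4 M a p"
      unfolding inner_add_left inner_scaleR_left hderiv_frame[OF p hF dF] F0 hstar_frame[OF p]
        T_frame[OF p d\<rho>1] by simp_all
  qed
qed

end

section \<open>The two Maxwell identities\<close>

context kerr
begin

lemma hderiv_cong:
  assumes p: "p \<in> ext" and eq: "\<And>q. q \<in> ext \<Longrightarrow> \<zeta> q = \<xi> q"
  shows "hderiv M a Y \<zeta> p = hderiv M a Y \<xi> p"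
proof -
  have "along Y (\<lambda>q. \<zeta> q \<bullet> Z q) p = along Y (\<lambda>q. \<xi> q \<bullet> Z q) p" for Z
    by (rule along_cong[OF p]) (simp add: eq)
  then show ?thesis
    by (simp add: hderiv_def Let_def eq[OF p])
qed

lemma D_plus_cong:
  assumes p: "p \<in> ext" and eq: "\<And>q. q \<in> ext \<Longrightarrow> u q = w q"
  shows "D_plus M a \<xi> u p = D_plus M a \<xi> w p"
proof -
  have "along Y u p = along Y w p" for Y
    by (rule along_cong[OF p eq])
  then show ?thesis
    by (simp add: D_plus_def hgrad_def eq[OF p])
qed

lemma D_plus_neg:
  assumes p: "p \<in> ext" and u: "u differentiable (at p within ext)"
  shows "D_plus M a \<xi> (\<lambda>q. - u q) p = - D_plus M a \<xi> u p"
  by (simp add: D_plus_def hgrad_def along_minus[OF p u] vec_eq_iff)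

lemma linear_hstar:
  assumes p: "p \<in> ext"
  shows "linear (hstar M a p)"
proof (rule linearI)
  have eq: "x = y" if "\<And>v. x \<bullet> v = y \<bullet> v" for x y :: covec
    using that vector_eq_rdot by blast
  show "hstar M a p (x + y) = hstar M a p x + hstar M a p y" for x y
    by (rule eq) (simp add: hstar_inner[OF p] inner_add_left)
  show "hstar M a p (c *\<^sub>R x) = c *\<^sub>R hstar M a p x" for c x
    by (rule eq) (simp add: hstar_inner[OF p])
qed

lemma hderiv_linear:
  assumes p: "p \<in> ext" and \<zeta>: "horizontal_form M a \<zeta>" and d: "\<zeta> differentiable (at p within ext)"
  shows "hderiv M a (c *\<^sub>R Y) \<zeta> p = c *\<^sub>R hderiv M a Y \<zeta> p"
  by (simp add: vec_eq_iff hderiv_nth[OF assms] along_linear[OF d] linear_cmul[OF christoffel_term_linear(2)] right_diff_distrib)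

lemma Ck2_neg:
  fixes u :: "point \<Rightarrow> real"
  assumes u: "Ck_on 2 u ext"
  shows "Ck_on 2 (\<lambda>q. - u q) ext"
proof -
  note d = Ck2[OF u]
  have D: "along v u = (\<lambda>x. frechet_derivative u (at x within ext) v)" for v and u :: "point \<Rightarrow> real"
    by (auto simp: deriv_along_def)
  have 1: "along v (\<lambda>q. - u q) q = - along v u q" if "q \<in> ext" for v q
    by (rule along_minus[OF that d(1)[OF that]])
  have 2: "along v (\<lambda>q. - u q) differentiable (at q within ext)" if q: "q \<in> ext" for v q
    by (rule differentiable_cong_ext[OF q _ differentiable_minus[OF d(2)[OF q]]]) (simp add: 1)
  have 3: "along w (along v (\<lambda>q. - u q)) q = - second u v w q" if q: "q \<in> ext" for v w q
  proof -
    have "along w (along v (\<lambda>q. - u q)) q = along w (\<lambda>q. - along v u q) q"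
      by (rule along_cong[OF q 1])
    then show ?thesis
      by (simp add: along_minus[OF q d(2)[OF q]] second_def)
  qed
  have 4: "continuous_on ext (along w (along v (\<lambda>q. - u q)))" for v w
  proof (cases "ext = {}")
    case False
    then obtain q where "q \<in> ext" by blast
    then have "continuous_on ext (\<lambda>q. - second u v w q)"
      by (intro continuous_on_minus d(3))
    then show ?thesis
      by (simp add: 3 cong: continuous_on_cong)
  qed simp
  show ?thesis
    unfolding numeral_2_eq_2 Ck_on.simps D[symmetric] using 2 4 d(1)
    by (auto simp: differentiable_on_def intro: differentiable_minus)
qed

lemma commuted_equation_e3:
  assumes p: "p \<in> ext" and \<rho>: "Ck_on 2 \<rho> ext" and \<sigma>: "Ck_on 2 \<sigma> ext"
  defines "T \<equiv> D_plus M a (\<lambda>q. 2 *\<^sub>R eta a q)"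
  defines "\<rho>1 \<equiv> \<lambda>q. D3_fun M a \<rho> q + tr_chib a q * \<rho> q - eps_chib a q * \<sigma> q"
    and "\<sigma>1 \<equiv> \<lambda>q. D3_fun M a \<sigma> q + tr_chib a q * \<sigma> q + eps_chib a q * \<rho> q"
  shows "D3_plus M a (\<lambda>q. 1/2 * tr_chib a q) (\<lambda>q. 3/2 * eps_chib a q)
      (\<lambda>q. Sig a q *\<^sub>R (T \<rho> q + hstar M a q (T \<sigma> q))) p
    = Sig a p *\<^sub>R (T \<rho>1 p + hstar M a p (T \<sigma>1 p))"
    and "\<rho>1 differentiable (at p within ext)" "\<sigma>1 differentiable (at p within ext)"
proof -
  interpret n: kerr_null M a 0 1 "\<lambda>_. - 1" "\<lambda>_. 0"
    by unfold_locales (auto intro: derivative_eq_intros)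
  have X: "n.X = e3"
    by (rule ext) (simp add: n.X_def e3_def del_r_eq)
  have eta: "n.eta_s = eta a"
    by (rule ext) (simp add: n.eta_s_def eta_def)
  have t: "2 * radius q * - 1 / Sig a q = tr_chib a q" for q
    by (simp add: tr_chib_def)
  have e: "- 2 * 1 * a * - 1 * cos_theta q / Sig a q = eps_chib a q" for q
    by (simp add: eps_chib_def)
  note c = n.commuted_equation[OF p \<rho> \<sigma>, unfolded X eta t e]
  show "D3_plus M a (\<lambda>q. 1/2 * tr_chib a q) (\<lambda>q. 3/2 * eps_chib a q)
      (\<lambda>q. Sig a q *\<^sub>R (T \<rho> q + hstar M a q (T \<sigma> q))) p
    = Sig a p *\<^sub>R (T \<rho>1 p + hstar M a p (T \<sigma>1 p))"
    using c unfolding D3_plus_def D3_def T_def \<rho>1_def \<sigma>1_def D3_fun_def by simp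
  show "\<rho>1 differentiable (at p within ext)" "\<sigma>1 differentiable (at p within ext)"
    using n.scalar_regular[OF p \<rho> \<sigma>, unfolded X t e] unfolding \<rho>1_def \<sigma>1_def D3_fun_def by auto
qed

text \<open>The operator along \<open>e4\<close> is recovered from the one along \<open>\<Sigma> e4\<close> by linearity in the direction.\<close>

lemma commuted_equation_e4:
  assumes p: "p \<in> ext" and \<rho>: "Ck_on 2 \<rho> ext" and \<sigma>: "Ck_on 2 \<sigma> ext"
  defines "T \<equiv> D_plus M a (\<lambda>q. 2 *\<^sub>R etab a q)"
  defines "\<rho>1 \<equiv> \<lambda>q. Sig a q * (D4_fun M a \<rho> q + tr_chi M a q * \<rho> q - eps_chi M a q * \<sigma> q)"
    and "\<sigma>1 \<equiv> \<lambda>q. Sig a q * (D4_fun M a \<sigma> q + tr_chi M a q * \<sigma> q + eps_chi M a q * \<rho> q)"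
  shows "D4_plus M a (\<lambda>q. 1/2 * tr_chi M a q) (\<lambda>q. 3/2 * eps_chi M a q)
      (\<lambda>q. Sig a q *\<^sub>R (T \<rho> q + hstar M a q (T \<sigma> q))) p
    = T \<rho>1 p + hstar M a p (T \<sigma>1 p)"
    and "\<rho>1 differentiable (at p within ext)" "\<sigma>1 differentiable (at p within ext)"
proof -
  have D: "(Delta_r M a has_real_derivative 2 * r - 2 * M) (at r)" for r
    unfolding Delta_r_eq[OF a_le, abs_def] by (auto intro!: derivative_eq_intros)
  interpret n: kerr_null M a 2 "-1" "Delta_r M a" "\<lambda>r. 2 * r - 2 * M"
    by unfold_locales (auto intro: D)
  have X: "n.X q = Sig a q *\<^sub>R e4 M a q" if q: "q \<in> ext" for q
    unfolding n.X_def e4_def scaleR_add_right scaleR_scaleR Delta_def del_r_eq del_t_def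
    using nonzero[OF q] by simp
  have eta: "n.eta_s = etab a"
    by (rule ext) (simp add: n.eta_s_def etab_def)
  have t: "2 * radius q * Delta_r M a (radius q) / Sig a q = Sig a q * tr_chi M a q" for q
    by (simp add: tr_chi_def Delta_def power2_eq_square)
  have e: "- 2 * - 1 * a * Delta_r M a (radius q) * cos_theta q / Sig a q = Sig a q * eps_chi M a q" for q
    by (simp add: eps_chi_def Delta_def power2_eq_square)
  define F where "F = (\<lambda>q. Sig a q *\<^sub>R (T \<rho> q + hstar M a q (T \<sigma> q)))"
  note reg = n.source_regular[OF \<rho> \<sigma>, unfolded eta, folded T_def, folded F_def]
  have X1: "along (n.X q) u q = Sig a q * along (e4 M a q) u q"
    if q: "q \<in> ext" and u: "u differentiable (at q within ext)" for q and u :: "point \<Rightarrow> real"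
    by (simp add: X[OF q] along_linear[OF u])
  have r1: "along (n.X q) \<rho> q + Sig a q * tr_chi M a q * \<rho> q - Sig a q * eps_chi M a q * \<sigma> q = \<rho>1 q"
    "along (n.X q) \<sigma> q + Sig a q * tr_chi M a q * \<sigma> q + Sig a q * eps_chi M a q * \<rho> q = \<sigma>1 q" if q: "q \<in> ext" for q
    by (simp_all add: X1[OF q] Ck2(1)[OF \<rho> q] Ck2(1)[OF \<sigma> q] \<rho>1_def \<sigma>1_def D4_fun_def algebra_simps)
  note sc = n.scalar_regular[OF p \<rho> \<sigma>, unfolded t e]
  show "\<rho>1 differentiable (at p within ext)"
    by (rule differentiable_cong_ext[OF p r1(1) sc(1)])
  show "\<sigma>1 differentiable (at p within ext)"
    by (rule differentiable_cong_ext[OF p r1(2) sc(2)])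
  have S: "Sig a p \<noteq> 0" by (rule nonzero[OF p])
  have "Sig a p *\<^sub>R (hderiv M a (e4 M a p) F p + (1/2 * tr_chi M a p) *\<^sub>R F p
      + (3/2 * eps_chi M a p) *\<^sub>R hstar M a p (F p))
    = hderiv M a (n.X p) F p + (Sig a p * tr_chi M a p / 2) *\<^sub>R F p
      + (3/2 * (Sig a p * eps_chi M a p)) *\<^sub>R hstar M a p (F p)"
    by (simp add: X[OF p] hderiv_linear[OF p reg(1) reg(2)[OF p]] scaleR_add_right mult.commute mult.left_commute)
  also have "\<dots> = Sig a p *\<^sub>R (T (\<lambda>q. along (n.X q) \<rho> q + Sig a q * tr_chi M a q * \<rho> q - Sig a q * eps_chi M a q * \<sigma> q) p
        + hstar M a p (T (\<lambda>q. along (n.X q) \<sigma> q + Sig a q * tr_chi M a q * \<sigma> q + Sig a q * eps_chi M a q * \<rho> q) p))"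
    unfolding F_def T_def by (rule n.commuted_equation[OF p \<rho> \<sigma>, unfolded eta t e])
  also have "\<dots> = Sig a p *\<^sub>R (T \<rho>1 p + hstar M a p (T \<sigma>1 p))"
    unfolding T_def using D_plus_cong[OF p r1(1)] D_plus_cong[OF p r1(2)] by simp
  finally show "D4_plus M a (\<lambda>q. 1/2 * tr_chi M a q) (\<lambda>q. 3/2 * eps_chi M a q)
      (\<lambda>q. Sig a q *\<^sub>R (T \<rho> q + hstar M a q (T \<sigma> q))) p = T \<rho>1 p + hstar M a p (T \<sigma>1 p)"
    unfolding F_def[symmetric] D4_plus_def D4_def using S by simp
qed

subsection \<open>Divergence and curl of a weighted form\<close>

text \<open>Contractions of the horizontal derivative with a bivector over the distribution only see the
  horizontal part of \<open>d \<Sigma>\<close>, which is \<open>\<Sigma> (eta + etab)\<close>.\<close>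

lemma contraction_Sig:
  assumes p: "p \<in> ext" and \<zeta>: "horizontal_form M a \<zeta>"
    and d: "\<And>q. q \<in> ext \<Longrightarrow> \<zeta> differentiable (at q within ext)"
    and K: "\<And>i j. K i j = w j $ i" and w: "\<And>j. w j \<in> horizontal M a p"
  shows "(\<Sum>i\<in>UNIV. \<Sum>j\<in>UNIV. K i j * hderiv M a (axis i 1) (\<lambda>q. Sig a q *\<^sub>R \<zeta> q) p $ j)
    = Sig a p * ((\<Sum>i\<in>UNIV. \<Sum>j\<in>UNIV. K i j * hderiv M a (axis i 1) \<zeta> p $ j)
      + (\<Sum>i\<in>UNIV. \<Sum>j\<in>UNIV. K i j * (eta a p + etab a p) $ i * \<zeta> p $ j))"
proof -
  note r = radius_pos[OF p]
  have S: "Sig a p \<noteq> 0" by (rule nonzero[OF p])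
  note dS = differentiable_forms(7)[OF p]
  have form: "horizontal_form M a (\<lambda>q. Sig a q *\<^sub>R \<zeta> q)"
    using \<zeta> by (simp add: horizontal_form_def)
  have diff: "(\<lambda>q. Sig a q *\<^sub>R \<zeta> q) differentiable (at p within ext)"
    by (intro differentiable_scaleR dS d p)
  have h: "hderiv M a (axis i 1) (\<lambda>q. Sig a q *\<^sub>R \<zeta> q) p $ j
      = Sig a p * hderiv M a (axis i 1) \<zeta> p $ j + along (axis i 1) (Sig a) p * \<zeta> p $ j" for i j
    unfolding hderiv_nth[OF p form diff] hderiv_nth[OF p \<zeta> d[OF p]] along_scaleR[OF p dS d[OF p]]
    using horizontal_form_hpr[OF p \<zeta>, of "axis j 1"]
    by (simp add: inner_add_left inner_axis right_diff_distrib)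
  have g: "(\<Sum>i\<in>UNIV. K i j * along (axis i 1) (Sig a) p) = (\<Sum>i\<in>UNIV. K i j * (Sig a p * (eta a p + etab a p) $ i))" for j
  proof -
    have w0: "d_r p \<bullet> w j = 0"
      using w[of j] by (simp add: horizontal_iff[OF p])
    have "(\<Sum>i\<in>UNIV. K i j * along (axis i 1) (Sig a) p) = along (w j) (Sig a) p"
      by (subst along_sum_axis[OF dS, of "w j"]) (simp add: K)
    also have "\<dots> = Sig a p * ((eta a p + etab a p) \<bullet> w j)"
    proof -
      have "(eta a p + etab a p) \<bullet> w j = 2 * a\<^sup>2 * cos_theta p / Sig a p * (d_cos_theta p \<bullet> w j)"
        unfolding eta_def etab_def inner_add_left inner_diff_left inner_scaleR_left by simp
      then show ?thesis
        unfolding along_unique[OF p Sig_has_derivative[OF r]] w0 using S by simp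
    qed
    also have "\<dots> = (\<Sum>i\<in>UNIV. K i j * (Sig a p * (eta a p + etab a p) $ i))"
      by (simp add: K inner_vec_def sum_distrib_left mult_ac)
    finally show ?thesis .
  qed
  have "(\<Sum>i\<in>UNIV. \<Sum>j\<in>UNIV. K i j * along (axis i 1) (Sig a) p * \<zeta> p $ j)
      = (\<Sum>j\<in>UNIV. (\<Sum>i\<in>UNIV. K i j * along (axis i 1) (Sig a) p) * \<zeta> p $ j)"
    by (subst sum.swap) (simp add: sum_distrib_right)
  also have "\<dots> = (\<Sum>i\<in>UNIV. \<Sum>j\<in>UNIV. K i j * (Sig a p * (eta a p + etab a p) $ i) * \<zeta> p $ j)"
    unfolding g sum_distrib_right by (rule sum.swap)
  finally show ?thesis
    unfolding h distrib_left sum.distrib by (simp add: sum_distrib_left mult_ac)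
qed

lemma harea_antisym: "harea M a p u v = - harea M a p v u"
  unfolding harea_def det_minors by (simp add: algebra_simps)

lemma
  assumes p: "p \<in> ext" and \<zeta>: "horizontal_form M a \<zeta>"
    and d: "\<And>q. q \<in> ext \<Longrightarrow> \<zeta> differentiable (at q within ext)"
  shows hdiv_Sig: "hdiv M a (\<lambda>q. Sig a q *\<^sub>R \<zeta> q) p
      = Sig a p * (hdiv M a \<zeta> p + hinner M a p (eta a p + etab a p) (\<zeta> p))"
    and hcurl_Sig: "hcurl M a (\<lambda>q. Sig a q *\<^sub>R \<zeta> q) p
      = Sig a p * (hcurl M a \<zeta> p + hwedge M a p (eta a p + etab a p) (\<zeta> p))"
proof -
  note h = hsharp_works[OF p]
  show "hdiv M a (\<lambda>q. Sig a q *\<^sub>R \<zeta> q) p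
      = Sig a p * (hdiv M a \<zeta> p + hinner M a p (eta a p + etab a p) (\<zeta> p))"
    unfolding hdiv_def hinner_def
    by (rule contraction_Sig[OF p \<zeta> d, where w = "\<lambda>j. hsharp M a p (axis j 1)"])
      (simp_all add: gamma_inv_def inner_axis' h)
  have "eps_inv M a p i j = (- rot a p (hsharp M a p (axis j 1))) $ i" for i j
  proof -
    have "eps_inv M a p i j = - harea M a p (hsharp M a p (axis j 1)) (hsharp M a p (axis i 1))"
      unfolding eps_inv_def by (rule harea_antisym)
    also have "\<dots> = - kerr_metric M a p (hsharp M a p (axis i 1)) (rot a p (hsharp M a p (axis j 1)))"
      by (simp add: harea_horizontal p h metric_sym[of p "rot a p _"])
    finally show ?thesis
      by (simp add: h rot_horizontal p inner_axis')
  qed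
  then show "hcurl M a (\<lambda>q. Sig a q *\<^sub>R \<zeta> q) p
      = Sig a p * (hcurl M a \<zeta> p + hwedge M a p (eta a p + etab a p) (\<zeta> p))"
    unfolding hcurl_def hwedge_def
    by (intro contraction_Sig[OF p \<zeta> d, where w = "\<lambda>j. - rot a p (hsharp M a p (axis j 1))"]
        subspace_neg horizontal_subspace rot_horizontal p)
qed

end

lemma smooth_on_Ck: "smooth_on f S \<Longrightarrow> Ck_on k f S"
  by (simp add: smooth_on_def)

lemma smooth_on_differentiable: "smooth_on f S \<Longrightarrow> p \<in> S \<Longrightarrow> f differentiable (at p within S)"
  using smooth_on_Ck[of f S "Suc 0"] by (simp add: differentiable_on_def)

theorem propositionA1:
  fixes M a :: real
    and \<alpha> \<alpha>b :: "point \<Rightarrow> covec"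
    and \<rho> \<sigma> :: "point \<Rightarrow> real"
  assumes "M > 0"
    and "\<bar>a\<bar> \<le> M"
    and "smooth_maxwell_solution M a \<alpha> \<alpha>b \<rho> \<sigma>"
  shows "(\<forall>p\<in>kerr_exterior M a.
      (1 / Sig a p) *\<^sub>R
        D3_plus M a (\<lambda>q. 1/2 * tr_chib a q) (\<lambda>q. 3/2 * eps_chib a q)
          (\<lambda>q. Sig a q *\<^sub>R
            D3_plus M a (\<lambda>q. 1/2 * tr_chib a q) (\<lambda>q. 1/2 * eps_chib a q) \<alpha> q) p
      = - D_plus M a (\<lambda>q. 2 *\<^sub>R eta a q) (hdiv M a \<alpha>b) p
        - star_D_plus M a (\<lambda>q. 2 *\<^sub>R eta a q) (hcurl M a \<alpha>b) p)
    \<and> (\<forall>p\<in>kerr_exterior M a.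
      D4_plus M a (\<lambda>q. 1/2 * tr_chi M a q) (\<lambda>q. 3/2 * eps_chi M a q)
        (\<lambda>q. Sig a q *\<^sub>R
          D4_plus M a (\<lambda>q. omega_hat M a q + 1/2 * tr_chi M a q) (\<lambda>q. 1/2 * eps_chi M a q) \<alpha>b q) p
      = - D_plus M a (\<lambda>q. 2 *\<^sub>R etab a q) (hdiv M a (\<lambda>q. Sig a q *\<^sub>R \<alpha> q)) p
        - star_D_plus M a (\<lambda>q. 2 *\<^sub>R etab a q) (hcurl M a (\<lambda>q. Sig a q *\<^sub>R \<alpha> q)) p)"
proof -
  interpret kerr M a
    using assms(1,2) by unfold_locales
  have \<rho>: "Ck_on 2 \<rho> ext" and \<sigma>: "Ck_on 2 \<sigma> ext" and \<alpha>: "horizontal_form M a \<alpha>"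
    and d\<alpha>: "\<And>q. q \<in> ext \<Longrightarrow> \<alpha> differentiable (at q within ext)"
    and mx: "maxwell_equations M a \<alpha> \<alpha>b \<rho> \<sigma>"
    using assms(3) by (auto simp: smooth_maxwell_solution_def smooth_on_Ck smooth_on_differentiable)
  have mx3: "D3_fun M a \<sigma> p + tr_chib a p * \<sigma> p = - hcurl M a \<alpha>b p - eps_chib a p * \<rho> p"
    "D3_fun M a \<rho> p + tr_chib a p * \<rho> p = - hdiv M a \<alpha>b p + eps_chib a p * \<sigma> p"
    "D3 M a \<alpha> p + chib_dot M a p (\<alpha> p) = hgrad M a \<rho> p + hstar M a p (hgrad M a \<sigma> p)
       + (2 * \<rho> p) *\<^sub>R eta a p + (2 * \<sigma> p) *\<^sub>R hstar M a p (eta a p)"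
    and mx4: "D4_fun M a \<sigma> p + tr_chi M a p * \<sigma> p =
       - hcurl M a \<alpha> p - hwedge M a p (eta a p + etab a p) (\<alpha> p) + eps_chi M a p * \<rho> p"
    "D4_fun M a \<rho> p + tr_chi M a p * \<rho> p =
       hdiv M a \<alpha> p + hinner M a p (eta a p + etab a p) (\<alpha> p) - eps_chi M a p * \<sigma> p"
    "D4 M a \<alpha>b p + chi_dot M a p (\<alpha>b p) + omega_hat M a p *\<^sub>R \<alpha>b p =
       - hgrad M a \<rho> p + hstar M a p (hgrad M a \<sigma> p)
       - (2 * \<rho> p) *\<^sub>R etab a p + (2 * \<sigma> p) *\<^sub>R hstar M a p (etab a p)"
    if "p \<in> ext" for p
    using mx that unfolding maxwell_equations_def by blast+
  \<comment> \<open>the minus signs pass through the operators once the scalars are known to be differentiable\<close>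
  have conclude: "D_plus M a \<xi> u p + hstar M a p (D_plus M a \<xi> w p)
      = - D_plus M a \<xi> f p - star_D_plus M a \<xi> g p"
    if p: "p \<in> ext" and du: "u differentiable (at p within ext)" and dw: "w differentiable (at p within ext)"
      and f: "\<And>q. q \<in> ext \<Longrightarrow> f q = - u q" and g: "\<And>q. q \<in> ext \<Longrightarrow> g q = - w q" for p \<xi> u w f g
    using D_plus_cong[OF p f] D_plus_cong[OF p g] D_plus_neg[OF p du] D_plus_neg[OF p dw]
    by (simp add: star_D_plus_def linear_neg[OF linear_hstar[OF p]])
  show ?thesis
  proof (intro conjI ballI)
    fix p assume p: "p \<in> ext"
    define T where "T = D_plus M a (\<lambda>q. 2 *\<^sub>R eta a q)"
    note c = commuted_equation_e3[OF p \<rho> \<sigma>, folded T_def]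
    have S: "Sig a p \<noteq> 0" by (rule nonzero[OF p])
    have "D3_plus M a (\<lambda>q. 1/2 * tr_chib a q) (\<lambda>q. 1/2 * eps_chib a q) \<alpha> q
        = T \<rho> q + hstar M a q (T \<sigma> q)" if q: "q \<in> ext" for q
      using mx3(3)[OF q]
      by (simp add: D3_plus_def chib_dot_def T_def D_plus_def linear_add[OF linear_hstar[OF q]]
        linear_cmul[OF linear_hstar[OF q]] add_ac mult.commute)
    then have "D3_plus M a (\<lambda>q. 1/2 * tr_chib a q) (\<lambda>q. 3/2 * eps_chib a q)
          (\<lambda>q. Sig a q *\<^sub>R
            D3_plus M a (\<lambda>q. 1/2 * tr_chib a q) (\<lambda>q. 1/2 * eps_chib a q) \<alpha> q) p
        = D3_plus M a (\<lambda>q. 1/2 * tr_chib a q) (\<lambda>q. 3/2 * eps_chib a q)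
          (\<lambda>q. Sig a q *\<^sub>R (T \<rho> q + hstar M a q (T \<sigma> q))) p"
      unfolding D3_plus_def[of _ _ _ _ "\<lambda>q. Sig a q *\<^sub>R _ q"] D3_def using p
      by (simp cong: hderiv_cong)
    then show "(1 / Sig a p) *\<^sub>R
        D3_plus M a (\<lambda>q. 1/2 * tr_chib a q) (\<lambda>q. 3/2 * eps_chib a q)
          (\<lambda>q. Sig a q *\<^sub>R
            D3_plus M a (\<lambda>q. 1/2 * tr_chib a q) (\<lambda>q. 1/2 * eps_chib a q) \<alpha> q) p
      = - D_plus M a (\<lambda>q. 2 *\<^sub>R eta a q) (hdiv M a \<alpha>b) p
        - star_D_plus M a (\<lambda>q. 2 *\<^sub>R eta a q) (hcurl M a \<alpha>b) p"
      unfolding c(1) using S apply simp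
      unfolding T_def
      by (rule conclude[OF p c(2,3)]) (use mx3(1,2) in \<open>simp_all add: algebra_simps\<close>)
  next
    fix p assume p: "p \<in> ext"
    define T where "T = D_plus M a (\<lambda>q. 2 *\<^sub>R etab a q)"
    \<comment> \<open>the gradient of \<open>\<rho>\<close> has the opposite sign in the equation for the other null component\<close>
    note c = commuted_equation_e4[OF p Ck2_neg[OF \<rho>] \<sigma>, folded T_def]
    have "D4_plus M a (\<lambda>q. omega_hat M a q + 1/2 * tr_chi M a q) (\<lambda>q. 1/2 * eps_chi M a q) \<alpha>b q
        = T (\<lambda>q. - \<rho> q) q + hstar M a q (T \<sigma> q)" if q: "q \<in> ext" for q
      using mx4(3)[OF q] unfolding T_def D_plus_neg[OF q Ck2(1)[OF \<rho> q]]
      by (simp add: D4_plus_def chi_dot_def D_plus_def linear_add[OF linear_hstar[OF q]]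
        linear_cmul[OF linear_hstar[OF q]] algebra_simps)
    then have "D4_plus M a (\<lambda>q. 1/2 * tr_chi M a q) (\<lambda>q. 3/2 * eps_chi M a q)
        (\<lambda>q. Sig a q *\<^sub>R
          D4_plus M a (\<lambda>q. omega_hat M a q + 1/2 * tr_chi M a q) (\<lambda>q. 1/2 * eps_chi M a q) \<alpha>b q) p
        = D4_plus M a (\<lambda>q. 1/2 * tr_chi M a q) (\<lambda>q. 3/2 * eps_chi M a q)
          (\<lambda>q. Sig a q *\<^sub>R (T (\<lambda>q. - \<rho> q) q + hstar M a q (T \<sigma> q))) p"
      unfolding D4_plus_def[of _ _ _ _ "\<lambda>q. Sig a q *\<^sub>R _ q"] D4_def using p
      by (simp cong: hderiv_cong)
    also have "\<dots> = - D_plus M a (\<lambda>q. 2 *\<^sub>R etab a q) (hdiv M a (\<lambda>q. Sig a q *\<^sub>R \<alpha> q)) p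
        - star_D_plus M a (\<lambda>q. 2 *\<^sub>R etab a q) (hcurl M a (\<lambda>q. Sig a q *\<^sub>R \<alpha> q)) p"
      unfolding c(1) unfolding T_def
    proof (rule conclude[OF p c(2,3)])
      fix q assume q: "q \<in> ext"
      have n: "D4_fun M a (\<lambda>q. - \<rho> q) q = - D4_fun M a \<rho> q"
        unfolding D4_fun_def by (rule along_minus[OF q Ck2(1)[OF \<rho> q]])
      show "hdiv M a (\<lambda>q. Sig a q *\<^sub>R \<alpha> q) q = - (Sig a q * (D4_fun M a (\<lambda>q. - \<rho> q) q
          + tr_chi M a q * - \<rho> q - eps_chi M a q * \<sigma> q))"
      proof -
        have "hdiv M a \<alpha> q + hinner M a q (eta a q + etab a q) (\<alpha> q)
            = D4_fun M a \<rho> q + tr_chi M a q * \<rho> q + eps_chi M a q * \<sigma> q"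
          using mx4(2)[OF q] by simp
        then have "hdiv M a (\<lambda>q. Sig a q *\<^sub>R \<alpha> q) q
            = Sig a q * (D4_fun M a \<rho> q + tr_chi M a q * \<rho> q + eps_chi M a q * \<sigma> q)"
          by (simp only: hdiv_Sig[OF q \<alpha> d\<alpha>])
        then show ?thesis
          unfolding n by (simp add: algebra_simps)
      qed
      show "hcurl M a (\<lambda>q. Sig a q *\<^sub>R \<alpha> q) q = - (Sig a q * (D4_fun M a \<sigma> q
          + tr_chi M a q * \<sigma> q + eps_chi M a q * - \<rho> q))"
      proof -
        have "hcurl M a \<alpha> q + hwedge M a q (eta a q + etab a q) (\<alpha> q)
            = - (D4_fun M a \<sigma> q + tr_chi M a q * \<sigma> q - eps_chi M a q * \<rho> q)"
          using mx4(1)[OF q] by simp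
        then have "hcurl M a (\<lambda>q. Sig a q *\<^sub>R \<alpha> q) q
            = Sig a q * - (D4_fun M a \<sigma> q + tr_chi M a q * \<sigma> q - eps_chi M a q * \<rho> q)"
          by (simp only: hcurl_Sig[OF q \<alpha> d\<alpha>])
        then show ?thesis by (simp add: algebra_simps)
      qed
    qed
    finally show "D4_plus M a (\<lambda>q. 1/2 * tr_chi M a q) (\<lambda>q. 3/2 * eps_chi M a q)
        (\<lambda>q. Sig a q *\<^sub>R
          D4_plus M a (\<lambda>q. omega_hat M a q + 1/2 * tr_chi M a q) (\<lambda>q. 1/2 * eps_chi M a q) \<alpha>b q) p
      = - D_plus M a (\<lambda>q. 2 *\<^sub>R etab a q) (hdiv M a (\<lambda>q. Sig a q *\<^sub>R \<alpha> q)) p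
        - star_D_plus M a (\<lambda>q. 2 *\<^sub>R etab a q) (hcurl M a (\<lambda>q. Sig a q *\<^sub>R \<alpha> q)) p" .
  qed
qed

end
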